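(* Let $Y$ be a closed infinite-dimensional subspace of $JT_G$ such that every normalized weakly null sequence in $Y$ has a subsequence equivalent to the unit vector basis of $\ell_2$. Then $Y$ is a complemented subspace of $JT_G$ isomorphic to $\ell_2$.
   Context: Schreier families: for finite sets, $F<G$ means $\max F<\min G$. $\mathcal S_1=\{F\subset\mathbb N:\#F\le\min F\}$ (with $\emptyset\in\mathcal S_1$), and $\mathcal S_{n+1}=\{\bigcup_{i=1}^dF_i: F_1<\dots<F_d,\ F_i\in\mathcal S_n,\ d\le\min F_1\}$ (together with $\emptyset$). Repeated averages: for infinite $L=\{l_1<l_2<\dots\}\subset\mathbb N$, let $\alpha_k(0,L)=e_{l_k}$. Inductively $\alpha_1(n+1,L)=\frac1{l_1}\sum_{i=1}^{l_1}\alpha_i(n,L)$ and $\alpha_k(n+1,L)=\alpha_1(n+1,L_k)$, where $L_k=L\setminus\bigcup_{i<k}\operatorname{supp}\alpha_i(n+1,L)$. For $n\ge1$ the support of $\alpha_1(n,L)$ is the largest initial segment of $L$ belonging to $\mathcal S_n$, and $\alpha_1(n,L)$ has nonnegative coordinates with sum $1$. $S^{(2)}$ is the completion of $c_{00}(\mathbb N)$ under $\|x\|_{S^{(2)}}=\sup_{F\in\mathcal S_1}(\sum_{i\in F}x(i)^2)^{1/2}$. Tree: fix strictly increasing sequences $(m_j)_{j\in\mathbb N},(n_j)_{j\in\mathbb N}$ of positive integers with $m_j\le n_j$, and a strictly increasing $\gamma:\mathbb N\cup\{\emptyset\}\to\mathbb N$, where $\gamma(\emptyset)<\gamma(n)$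 for all $n\in\mathbb N$. $\mathcal T$ is a tree with root $\emptyset$ whose other nodes form an infinite set $D\subset\mathbb N$; its order is compatible with the usual order on $D$ ($m\preceq n$ implies $m\le n$), the predecessors of each node are linearly ordered, every node (including $\emptyset$) has infinitely many immediate successors, and for every node $n$ (including $\emptyset$) every immediate successor of $n$ is larger than $(3m_{2\gamma(n)+1}^2)^2$. A segment is a set $\{k\in D:m\preceq k\preceq n\}$ with $m\preceq n$ in $D$; a branch is a maximal linearly ordered subset of $D$. Functionals: for each branch $\sigma$, define successive $s_k^\sigma\subset\sigma$ inductively: $j_1=\gamma(\emptyset)$, $j_k=\gamma(\max s_{k-1}^\sigma)$ for $k\ge2$, and $s_k^\sigma$ is the largest initial segment of $\sigma\setminus\bigcup_{i<k}s_i^\sigma$ belonging to $\mathcal S_{n_{2j_k+1}}$. With $\beta_l\ge0$ given by $\beta_l^2=\alpha_1(n_{2j_k+1},\sigma\setminus\bigcup_{i<k}s_i^\sigma)(l)$ for $l\in s_k^\sigma$, put $x_k^\sigma=m_{2j_k+1}^2\sum_{l\in s_k^\sigma}\beta_le_l$ and $\phi_k^\sigma=m_{2j_k+1}^{-2}\sum_{l\in s_k^\sigma}\beta_le_l$, the latter acting on $c_{00}(\mathbb N)$ by the usual pairing. Let $W(\sigma)$ be the set of restrictions $(\sum_{i=1}^n\lambda_i\phi_i^\sigma)|_E$ with $n\in\mathbb N$, $\lambda_i\in\mathbb Q$, $\sum\lambda_i^2\le1$, $E$ an interval of $\mathbb N$, and let $\|x\|_\sigma=\sup\{f(x):f\in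 W(\sigma)\}$. For a segment $s$ let $\|x\|_s=\|x|_s\|_\sigma$ for any branch $\sigma\supset s$ (this does not depend on $\sigma$). $JT_G$ is the completion of $c_{00}(\mathbb N)$ under $$\|x\|=\max\Big\{\|x\|_\infty,\ \sup\Big\|\sum_{i=1}^n\|x\|_{s_i}e_{\min s_i}\Big\|_{S^{(2)}}\Big\},$$ the supremum over all finite families of pairwise disjoint segments $s_1,\dots,s_n$ with $\{\min s_i:i\le n\}\in\mathcal S_1$. Complemented means being the range of a bounded linear projection; isomorphic means linearly homeomorphic. Two sequences $(x_n),(z_n)$ are equivalent if there are $A,B>0$ with $A\|\sum a_nz_n\|\le\|\sum a_nx_n\|\le B\|\sum a_nz_n\|$ for all finitely supported real $(a_n)$. *)

theory Defs
  imports "HOL-Analysis.Analysis"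
begin

text \<open>
  The natural numbers of the construction are the positive ones. They are
  modelled in the type \<open>nat\<close>, and the value 0 is reserved for the root of the tree:
  families of sets contain only subsets of \<open>{1..}\<close>, and finitely supported sequences
  vanish at 0.
\<close>

section \<open>Schreier families\<close>

definition set_less :: "nat set \<Rightarrow> nat set \<Rightarrow> bool" where
  "set_less F G \<longleftrightarrow> Max F < Min G"

text \<open>
  The families are indexed from 1. The value at 0 is the customary one (singletons and the
  empty set); it is never used below.
\<close>

fun schreier :: "nat \<Rightarrow> nat set set" where
  "schreier 0 = {F. F \<subseteq> {1..} \<and> finite F \<and> card F \<le> 1}"
| "schreier (Suc 0) = insert {} {F. F \<subseteq> {1..} \<and> finite F \<and> F \<noteq> {} \<and> card F \<le> Min F}"
| "schreier (Suc (Suc n)) = insert {}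
    {\<Union> (set Fs) | Fs. Fs \<noteq> [] \<and> set Fs \<subseteq> schreier (Suc n) - {{}} \<and>
        sorted_wrt set_less Fs \<and> length Fs \<le> Min (hd Fs)}"

section \<open>Repeated averages\<close>

text \<open>
  \<open>rep_avg n k L\<close> is $\alpha_k(n, L)$ for \<open>k \<ge> 1\<close> and infinite \<open>L\<close>, as a function of the
  coordinate. Since \<open>enumerate\<close> counts from 0, the \<open>k\<close>-th element of \<open>L\<close> is
  \<open>enumerate L (k - 1)\<close>. The junk value at \<open>k = 0\<close> is that at \<open>k = 1\<close>.
\<close>

function rep_avg :: "nat \<Rightarrow> nat \<Rightarrow> nat set \<Rightarrow> nat \<Rightarrow> real" where
  "rep_avg 0 k L = (\<lambda>l. if l = enumerate L (k - 1) then 1 else 0)"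
| "rep_avg (Suc n) k L =
    (if k \<le> 1
     then (\<lambda>l. (\<Sum>i = 1..enumerate L 0. rep_avg n i L l) / real (enumerate L 0))
     else rep_avg (Suc n) 1 (L - (\<Union>i\<in>{1..<k}. {l. rep_avg (Suc n) i L l \<noteq> 0})))"
  by pat_completeness auto
termination
  by (relation "inv_image (less_than <*lex*> less_than) (\<lambda>(n, k, L). (n, k))") auto

declare rep_avg.simps [simp del]

section \<open>Finitely supported sequences and completions\<close>

definition c00 :: "(nat \<Rightarrow> real) set" where
  "c00 = {x. x 0 = 0 \<and> finite {i. x i \<noteq> 0}}"

definition restrict_to :: "nat set \<Rightarrow> (nat \<Rightarrow> real) \<Rightarrow> nat \<Rightarrow> real" where
  "restrict_to A x = (\<lambda>i. if i \<in> A then x i else 0)"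

definition pairing :: "(nat \<Rightarrow> real) \<Rightarrow> (nat \<Rightarrow> real) \<Rightarrow> real" where
  "pairing f x = (\<Sum>i\<in>{i. x i \<noteq> 0}. f i * x i)"

text \<open>
  A Banach space is the completion of \<open>c00\<close> under a norm \<open>p\<close> if \<open>(c00, p)\<close> embeds into it
  linearly and isometrically with dense range. It is unique up to isometric isomorphism
  respecting the embeddings.
\<close>

definition is_completion :: "((nat \<Rightarrow> real) \<Rightarrow> real) \<Rightarrow> ((nat \<Rightarrow> real) \<Rightarrow> 'a::banach) \<Rightarrow> bool" where
  "is_completion p \<iota> \<longleftrightarrow>
    (\<forall>x\<in>c00. \<forall>y\<in>c00. \<iota> (\<lambda>i. x i + y i) = \<iota> x + \<iota> y) \<and>
    (\<forall>c. \<forall>x\<in>c00. \<iota> (\<lambda>i. c * x i) = c *\<^sub>R \<iota> x) \<and>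
    (\<forall>x\<in>c00. norm (\<iota> x) = p x) \<and>
    closure (\<iota> ` c00) = UNIV"

definition S2_norm :: "(nat \<Rightarrow> real) \<Rightarrow> real" where
  "S2_norm x = (SUP F\<in>schreier 1. sqrt (\<Sum>i\<in>F. (x i)\<^sup>2))"

section \<open>The tree\<close>

text \<open>\<open>R\<close> is the (reflexive) tree order on the nodes, \<open>(a, b) \<in> R\<close> meaning $a \preceq b$.\<close>

definition immediate_succ :: "nat rel \<Rightarrow> nat \<Rightarrow> nat \<Rightarrow> bool" where
  "immediate_succ R a b \<longleftrightarrow>
    (a, b) \<in> R \<and> a \<noteq> b \<and> \<not> (\<exists>c. c \<noteq> a \<and> c \<noteq> b \<and> (a, c) \<in> R \<and> (c, b) \<in> R)"

text \<open>
  The root is represented by 0. Consequently \<open>\<gamma> 0\<close> is the value of $\gamma$ at the root,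
  and strict monotonicity of \<open>\<gamma>\<close> on \<open>nat\<close> includes that this value lies below all the
  others. The sequences \<open>m\<close> and \<open>n\<close> are indexed by the positive integers.
\<close>

locale jt_tree =
  fixes m n :: "nat \<Rightarrow> nat" and \<gamma> :: "nat \<Rightarrow> nat" and D :: "nat set" and R :: "nat rel"
  assumes m_strict_mono: "strict_mono_on {1..} m"
    and n_strict_mono: "strict_mono_on {1..} n"
    and m_pos: "\<And>j. j \<ge> 1 \<Longrightarrow> m j \<ge> 1"
    and m_le_n: "\<And>j. j \<ge> 1 \<Longrightarrow> m j \<le> n j"
    and gamma_strict_mono: "strict_mono \<gamma>"
    and gamma_pos: "\<gamma> 0 \<ge> 1"
    and D_infinite: "infinite D"
    and D_pos: "D \<subseteq> {1..}"
    and R_partial_order: "partial_order_on (insert 0 D) R"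
    and root_least: "\<And>t. t \<in> D \<Longrightarrow> (0, t) \<in> R"
    and R_compatible: "\<And>a b. (a, b) \<in> R \<Longrightarrow> a \<le> b"
    and predecessors_linear:
      "\<And>a b t. (a, t) \<in> R \<Longrightarrow> (b, t) \<in> R \<Longrightarrow> (a, b) \<in> R \<or> (b, a) \<in> R"
    and infinitely_many_succ: "\<And>t. t \<in> insert 0 D \<Longrightarrow> infinite {u. immediate_succ R t u}"
    and succ_large: "\<And>t u. t \<in> insert 0 D \<Longrightarrow> immediate_succ R t u \<Longrightarrow>
      u > (3 * (m (2 * \<gamma> t + 1))\<^sup>2)\<^sup>2"

definition segments :: "nat set \<Rightarrow> nat rel \<Rightarrow> nat set set" where
  "segments D R = {{k \<in> D. (a, k) \<in> R \<and> (k, b) \<in> R} | a b. a \<in> D \<and> b \<in> D \<and> (a, b) \<in> R}"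

definition branches :: "nat set \<Rightarrow> nat rel \<Rightarrow> nat set set" where
  "branches D R = {\<sigma>. pred_on.maxchain D (\<lambda>a b. (a, b) \<in> R) \<sigma>}"

section \<open>The functionals on a branch\<close>

definition initial_segment :: "nat set \<Rightarrow> nat set \<Rightarrow> bool" where
  "initial_segment I A \<longleftrightarrow> I \<subseteq> A \<and> (\<forall>i\<in>I. \<forall>a\<in>A. a \<le> i \<longrightarrow> a \<in> I)"

text \<open>For the index \<open>k \<ge> 1\<close>, \<open>s_set n \<gamma> \<sigma> k\<close> is $s_k^\sigma$; recall that \<open>\<gamma> 0\<close> is the value
  at the root, which is $j_1$. Largest means largest for inclusion.\<close>

function s_set :: "(nat \<Rightarrow> nat) \<Rightarrow> (nat \<Rightarrow> nat) \<Rightarrow> nat set \<Rightarrow> nat \<Rightarrow> nat set" where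
  "s_set n \<gamma> \<sigma> k =
    (GREATEST I. initial_segment I (\<sigma> - (\<Union>i\<in>{1..<k}. s_set n \<gamma> \<sigma> i)) \<and>
       I \<in> schreier (n (2 * (if k \<le> 1 then \<gamma> 0 else \<gamma> (Max (s_set n \<gamma> \<sigma> (k - 1)))) + 1)))"
  by pat_completeness auto
termination
  by (relation "inv_image less_than (\<lambda>(n, \<gamma>, \<sigma>, k). k)") auto

declare s_set.simps [simp del]

definition j_index :: "(nat \<Rightarrow> nat) \<Rightarrow> (nat \<Rightarrow> nat) \<Rightarrow> nat set \<Rightarrow> nat \<Rightarrow> nat" where
  "j_index n \<gamma> \<sigma> k = (if k \<le> 1 then \<gamma> 0 else \<gamma> (Max (s_set n \<gamma> \<sigma> (k - 1))))"

definition beta :: "(nat \<Rightarrow> nat) \<Rightarrow> (nat \<Rightarrow> nat) \<Rightarrow> nat set \<Rightarrow> nat \<Rightarrow> nat \<Rightarrow> real" where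
  "beta n \<gamma> \<sigma> k l =
    sqrt (rep_avg (n (2 * j_index n \<gamma> \<sigma> k + 1)) 1 (\<sigma> - (\<Union>i\<in>{1..<k}. s_set n \<gamma> \<sigma> i)) l)"

definition phi ::
  "(nat \<Rightarrow> nat) \<Rightarrow> (nat \<Rightarrow> nat) \<Rightarrow> (nat \<Rightarrow> nat) \<Rightarrow> nat set \<Rightarrow> nat \<Rightarrow> nat \<Rightarrow> real" where
  "phi m n \<gamma> \<sigma> k = (\<lambda>l. if l \<in> s_set n \<gamma> \<sigma> k
     then beta n \<gamma> \<sigma> k l / (real (m (2 * j_index n \<gamma> \<sigma> k + 1)))\<^sup>2 else 0)"

definition W ::
  "(nat \<Rightarrow> nat) \<Rightarrow> (nat \<Rightarrow> nat) \<Rightarrow> (nat \<Rightarrow> nat) \<Rightarrow> nat set \<Rightarrow> (nat \<Rightarrow> real) set" where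
  "W m n \<gamma> \<sigma> =
    {restrict_to E (\<lambda>l. \<Sum>i = 1..N. c i * phi m n \<gamma> \<sigma> i l) | N c E.
       N \<ge> 1 \<and> (\<forall>i\<in>{1..N}. c i \<in> \<rat>) \<and> (\<Sum>i = 1..N. (c i)\<^sup>2) \<le> 1 \<and>
       (\<forall>a\<in>E. \<forall>b\<in>E. {a..b} \<subseteq> E)}"

definition branch_norm ::
  "(nat \<Rightarrow> nat) \<Rightarrow> (nat \<Rightarrow> nat) \<Rightarrow> (nat \<Rightarrow> nat) \<Rightarrow> nat set \<Rightarrow> (nat \<Rightarrow> real) \<Rightarrow> real" where
  "branch_norm m n \<gamma> \<sigma> x = (SUP f\<in>W m n \<gamma> \<sigma>. pairing f x)"

text \<open>Any branch containing the segment may be chosen here; the value does not depend on it.\<close>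

definition segment_norm ::
  "(nat \<Rightarrow> nat) \<Rightarrow> (nat \<Rightarrow> nat) \<Rightarrow> (nat \<Rightarrow> nat) \<Rightarrow> nat set \<Rightarrow> nat rel \<Rightarrow>
    nat set \<Rightarrow> (nat \<Rightarrow> real) \<Rightarrow> real" where
  "segment_norm m n \<gamma> D R s x =
    branch_norm m n \<gamma> (SOME \<sigma>. \<sigma> \<in> branches D R \<and> s \<subseteq> \<sigma>) (restrict_to s x)"

section \<open>The norm of the space\<close>

text \<open>
  Pairwise disjoint segments are distinct because segments are nonempty, so a finite family
  of them is a finite set of sets. Both suprema are over bounded nonempty sets of reals when
  \<open>x \<in> c00\<close>.
\<close>

definition JT_norm ::
  "(nat \<Rightarrow> nat) \<Rightarrow> (nat \<Rightarrow> nat) \<Rightarrow> (nat \<Rightarrow> nat) \<Rightarrow> nat set \<Rightarrow> nat rel \<Rightarrow> (nat \<Rightarrow> real) \<Rightarrow> real" where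
  "JT_norm m n \<gamma> D R x =
    max (SUP i. \<bar>x i\<bar>)
      (SUP A\<in>{A. finite A \<and> A \<subseteq> segments D R \<and> disjoint A \<and> Min ` A \<in> schreier 1}.
        S2_norm (\<lambda>l. \<Sum>s\<in>A. segment_norm m n \<gamma> D R s x * (if l = Min s then 1 else 0)))"

section \<open>The space of square-summable sequences\<close>

typedef l2 = "{a :: nat \<Rightarrow> real. summable (\<lambda>i. (a i)\<^sup>2)}"
  morphisms coords Abs_l2
  by (rule exI[of _ "\<lambda>_. 0"]) simp

setup_lifting type_definition_l2

lemma square_summable_add:
  fixes a b :: "nat \<Rightarrow> real"
  assumes "summable (\<lambda>i. (a i)\<^sup>2)" "summable (\<lambda>i. (b i)\<^sup>2)"
  shows "summable (\<lambda>i. (a i + b i)\<^sup>2)"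
proof (rule summable_comparison_test')
  show "summable (\<lambda>i. 2 * (a i)\<^sup>2 + 2 * (b i)\<^sup>2)"
    using assms by (intro summable_add summable_mult)
  fix i :: nat assume "i \<ge> 0"
  have "0 \<le> (a i - b i)\<^sup>2" by simp
  then have "(a i + b i)\<^sup>2 \<le> 2 * (a i)\<^sup>2 + 2 * (b i)\<^sup>2"
    by (simp add: power2_sum power2_diff)
  then show "norm ((a i + b i)\<^sup>2) \<le> 2 * (a i)\<^sup>2 + 2 * (b i)\<^sup>2"
    by simp
qed

lemma square_summable_scale:
  fixes a :: "nat \<Rightarrow> real"
  assumes "summable (\<lambda>i. (a i)\<^sup>2)"
  shows "summable (\<lambda>i. (c * a i)\<^sup>2)"
  using summable_mult[OF assms, of "c\<^sup>2"] by (simp add: power_mult_distrib)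

lemma L2_set_le_sqrt_suminf:
  fixes a :: "nat \<Rightarrow> real"
  assumes "summable (\<lambda>i. (a i)\<^sup>2)"
  shows "L2_set a {..<N} \<le> sqrt (\<Sum>i. (a i)\<^sup>2)"
  unfolding L2_set_def by (intro real_sqrt_le_mono sum_le_suminf assms) auto

instantiation l2 :: real_normed_vector
begin

lift_definition zero_l2 :: l2 is "\<lambda>_. 0" by simp
lift_definition plus_l2 :: "l2 \<Rightarrow> l2 \<Rightarrow> l2" is "\<lambda>a b i. a i + b i"
  by (rule square_summable_add)
lift_definition uminus_l2 :: "l2 \<Rightarrow> l2" is "\<lambda>a i. - a i" by simp
lift_definition minus_l2 :: "l2 \<Rightarrow> l2 \<Rightarrow> l2" is "\<lambda>a b i. a i - b i"
  using square_summable_add[of _ "\<lambda>i. - _ i"] by simp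
lift_definition scaleR_l2 :: "real \<Rightarrow> l2 \<Rightarrow> l2" is "\<lambda>c a i. c * a i"
  by (rule square_summable_scale)
lift_definition norm_l2 :: "l2 \<Rightarrow> real" is "\<lambda>a. sqrt (\<Sum>i. (a i)\<^sup>2)" .

definition dist_l2 :: "l2 \<Rightarrow> l2 \<Rightarrow> real" where "dist_l2 a b = norm (a - b)"
definition sgn_l2 :: "l2 \<Rightarrow> l2" where "sgn_l2 a = inverse (norm a) *\<^sub>R a"
definition uniformity_l2 :: "(l2 \<times> l2) filter" where
  "uniformity_l2 = (INF e\<in>{0<..}. principal {(x, y). dist x y < e})"
definition open_l2 :: "l2 set \<Rightarrow> bool" where
  "open_l2 U \<longleftrightarrow> (\<forall>x\<in>U. eventually (\<lambda>(x', y). x' = x \<longrightarrow> y \<in> U) uniformity)"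

instance
proof
  fix a b c :: l2 and r q :: real
  show "a + b + c = a + (b + c)" "a + b = b + a" "0 + a = a" "- a + a = 0" "a - b = a + - b"
    "r *\<^sub>R (a + b) = r *\<^sub>R a + r *\<^sub>R b" "(r + q) *\<^sub>R a = r *\<^sub>R a + q *\<^sub>R a"
    "r *\<^sub>R q *\<^sub>R a = (r * q) *\<^sub>R a" "1 *\<^sub>R a = a"
    by (transfer; simp add: algebra_simps)+
  show "dist a b = norm (a - b)" "sgn a = inverse (norm a) *\<^sub>R a"
    "uniformity = (INF e\<in>{0<..}. principal {(x :: l2, y). dist x y < e})"
    by (simp_all add: dist_l2_def sgn_l2_def uniformity_l2_def)
  show "open U \<longleftrightarrow> (\<forall>x\<in>U. \<forall>\<^sub>F (x', y) in uniformity. x' = x \<longrightarrow> y \<in> U)" for U :: "l2 set"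
    by (simp add: open_l2_def)
  show "norm a = 0 \<longleftrightarrow> a = 0"
    by transfer (auto simp: suminf_eq_zero_iff fun_eq_iff)
  show "norm (r *\<^sub>R a) = \<bar>r\<bar> * norm a"
    by transfer (simp add: power_mult_distrib suminf_mult real_sqrt_mult)
  show "norm (a + b) \<le> norm a + norm b"
  proof transfer
    fix a b :: "nat \<Rightarrow> real"
    assume a: "summable (\<lambda>i. (a i)\<^sup>2)" and b: "summable (\<lambda>i. (b i)\<^sup>2)"
    have "(\<lambda>N. sqrt (\<Sum>i<N. (a i + b i)\<^sup>2)) \<longlonglongrightarrow> sqrt (\<Sum>i. (a i + b i)\<^sup>2)"
      by (intro tendsto_real_sqrt summable_LIMSEQ square_summable_add a b)
    moreover have "sqrt (\<Sum>i<N. (a i + b i)\<^sup>2) \<le> sqrt (\<Sum>i. (a i)\<^sup>2) + sqrt (\<Sum>i. (b i)\<^sup>2)" for N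
      using L2_set_triangle_ineq[of a b "{..<N}"] L2_set_le_sqrt_suminf[OF a, of N]
        L2_set_le_sqrt_suminf[OF b, of N]
      unfolding L2_set_def by linarith
    ultimately show "sqrt (\<Sum>i. (a i + b i)\<^sup>2) \<le> sqrt (\<Sum>i. (a i)\<^sup>2) + sqrt (\<Sum>i. (b i)\<^sup>2)"
      by (intro LIMSEQ_le_const2) auto
  qed
qed

end

lift_definition l2_unit :: "nat \<Rightarrow> l2" is "\<lambda>k i. if i = k then 1 else 0"
  by (rule summable_finite[where N = "{_}"]) auto

section \<open>Banach space notions\<close>

definition equivalent_sequences ::
  "(nat \<Rightarrow> 'a::real_normed_vector) \<Rightarrow> (nat \<Rightarrow> 'b::real_normed_vector) \<Rightarrow> bool" where
  "equivalent_sequences x z \<longleftrightarrow>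
    (\<exists>A>0. \<exists>B>0. \<forall>a :: nat \<Rightarrow> real. finite {i. a i \<noteq> 0} \<longrightarrow>
      A * norm (\<Sum>i | a i \<noteq> 0. a i *\<^sub>R z i) \<le> norm (\<Sum>i | a i \<noteq> 0. a i *\<^sub>R x i) \<and>
      norm (\<Sum>i | a i \<noteq> 0. a i *\<^sub>R x i) \<le> B * norm (\<Sum>i | a i \<noteq> 0. a i *\<^sub>R z i))"

text \<open>
  For a sequence in a subspace it makes no difference whether the functionals are defined on
  the subspace or on the whole space, by the Hahn-Banach theorem.
\<close>

definition weakly_null :: "(nat \<Rightarrow> 'a::real_normed_vector) \<Rightarrow> bool" where
  "weakly_null x \<longleftrightarrow> (\<forall>f :: 'a \<Rightarrow> real. bounded_linear f \<longrightarrow> (\<lambda>i. f (x i)) \<longlonglongrightarrow> 0)"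

definition complemented :: "'a::real_normed_vector set \<Rightarrow> bool" where
  "complemented Y \<longleftrightarrow> (\<exists>P. bounded_linear P \<and> P \<circ> P = P \<and> range P = Y)"

definition isomorphic_to_l2 :: "'a::real_normed_vector set \<Rightarrow> bool" where
  "isomorphic_to_l2 Y \<longleftrightarrow> (\<exists>(T :: l2 \<Rightarrow> 'a) S. linear T \<and> homeomorphism UNIV Y T S)"

definition infinite_dimensional :: "'a::real_vector set \<Rightarrow> bool" where
  "infinite_dimensional Y \<longleftrightarrow> \<not> (\<exists>B. finite B \<and> Y \<subseteq> span B)"

end

theory Submission
  imports Defs "HOL-Library.Diagonal_Subsequence"
begin

text \<open>
  On a fixed branch, the functionals map the space boundedly into \<open>\<ell>\<^sub>2\<close>. It suffices to find
  finitely many branches whose functionals, together with finitely many coordinates, form an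
  operator \<open>T\<close> into \<open>\<ell>\<^sub>2\<close> that is bounded below on \<open>Y\<close>: then \<open>Y\<close> is isomorphic to the
  closed subspace \<open>T Y\<close> of \<open>\<ell>\<^sub>2\<close>, and the orthogonal projection onto \<open>T Y\<close> pulls back to a
  projection onto \<open>Y\<close>.

  Block sequences that are small in the supremum norm and on every segment have subsequences
  equivalent to the basis of \<open>c\<^sub>0\<close>, so this cannot happen in \<open>Y\<close>; hence far out the norm of \<open>Y\<close> is
  equivalent to the maximum of the supremum norm and the norms of the segments. For a bounded
  block sequence and \<open>\<epsilon> > 0\<close>, the nodes from which infinitely many members are \<open>\<epsilon>\<close>-large form a
  subtree of finite width, covered by finitely many branches. If no finite set of branches
  controlled \<open>Y\<close>, one could choose, for every \<open>K\<close>, successive normalized flat vectors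
  \<open>z\<^sub>1, \<dots>, z\<^sub>K\<close> near \<open>Y\<close> such that every segment is \<open>\<epsilon>\<close>-large on at most one of them. Their sum
  has norm of order \<open>\<surd>K\<close>, while its norms on segments stay bounded.
\<close>

section \<open>Schreier families\<close>

text \<open>The hypothesis on \<open>Y\<close> concerns weakly null sequences only, so bounded block
  sequences must first be shown to be weakly null: a functional bounded below on one would be
  bounded below on its long averages, which can be chosen with bounded sums.

  At the end, each \<open>z l\<close> has a large segment inside its own range. All ranges lie
  beyond \<open>K\<close>, so these \<open>K\<close> segments form one admissible family, and the
  sum has norm of order sqrt K. Normalizing it gives a unit vector of \<open>Y\<close> close to a
  deep vector whose coordinates and segment norms are of order 1 / sqrt K, contrary to the
  equivalence of norms.

  The obstacle is that exceptional branches are known only after a sequence has been chosen. Hence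
  \<open>K\<close> sequences are chosen first, each flat on the exceptional branches of all earlier
  ones, and then one vector is taken from each, in reversed order. For two such vectors, follow a
  segment until it leaves the exceptional subtree of the farther one: if this happens early, the
  farther vector is small on the rest; otherwise the nearer vector meets only branches on which it
  is flat.\<close>

lemma schreier_finite: "F \<in> schreier p \<Longrightarrow> finite F"
proof (induction p arbitrary: F rule: schreier.induct)
  case (3 p)
  then show ?case by fastforce
qed auto

lemma schreier_empty: "{} \<in> schreier p"
  by (induction p rule: schreier.induct) auto

text \<open>Pieces that miss \<open>G\<close> have to be dropped: \<open>Min\<close> and
  \<open>Max\<close> of the empty set carry no information and would break the ordering of
  successive pieces.\<close>

lemma sorted_wrt_restrict_nonempty:
  assumes "sorted_wrt set_less Fs" "\<And>F. F \<in> set Fs \<Longrightarrow> finite F \<and> F \<noteq> {}"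
  shows "sorted_wrt set_less (filter (\<lambda>F. F \<noteq> {}) (map (\<lambda>F. F \<inter> G) Fs))"
  using assms
proof (induction Fs)
  case (Cons F Fs)
  have "set_less (F \<inter> G) (F' \<inter> G)"
    if "F' \<in> set Fs" "F \<inter> G \<noteq> {}" "F' \<inter> G \<noteq> {}" for F'
  proof -
    have "Max (F \<inter> G) \<le> Max F" "Min F' \<le> Min (F' \<inter> G)"
      using that Cons.prems(2)[of F] Cons.prems(2)[of F'] by (auto intro!: Max_mono Min_antimono)
    moreover have "Max F < Min F'"
      using Cons.prems(1) that(1) by (auto simp: set_less_def)
    ultimately show ?thesis by (simp add: set_less_def)
  qed
  then show ?case using Cons by auto
qed simp

text \<open>Intersecting a decomposition with \<open>G\<close> keeps each piece in the lower family,
  does not increase the number of pieces and does not lower the least element.\<close>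

lemma schreier_hereditary: "F \<in> schreier p \<Longrightarrow> G \<subseteq> F \<Longrightarrow> G \<in> schreier p"
proof (induction p arbitrary: F G rule: schreier.induct)
  case 1
  then have "finite F" "card F \<le> 1" by auto
  then have "card G \<le> 1" using card_mono[of F G] 1 by linarith
  then show ?case using 1 finite_subset by auto
next
  case 2
  show ?case
  proof (cases "G = {}")
    case False
    then have F: "finite F" "F \<noteq> {}" "card F \<le> Min F" "F \<subseteq> {1..}" using 2 by auto
    have "card G \<le> card F" "Min F \<le> Min G"
      using F 2 False by (auto intro: card_mono Min_antimono)
    then have "card G \<le> Min G" using F(3) by linarith
    moreover have "finite G" using F(1) 2 finite_subset by blast
    moreover have "G \<subseteq> {1..}" using F(4) 2 by (meson subset_trans)
    ultimately show ?thesis using False by simp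
  qed simp
next
  case (3 p)
  show ?case
  proof (cases "G = {}")
    case False
    then obtain Fs where Fs: "F = \<Union> (set Fs)" "Fs \<noteq> []" "set Fs \<subseteq> schreier (Suc p) - {{}}"
        "sorted_wrt set_less Fs" "length Fs \<le> Min (hd Fs)"
      using 3 by auto
    have fin: "finite A \<and> A \<noteq> {}" if "A \<in> set Fs" for A
      using that Fs(3) schreier_finite by blast
    define Gs where "Gs = filter (\<lambda>F. F \<noteq> {}) (map (\<lambda>F. F \<inter> G) Fs)"
    have "G = (\<Union>A\<in>set Fs. A \<inter> G)" using Fs(1) 3(3) by blast
    then have G: "G = \<Union> (set Gs)" by (fastforce simp: Gs_def)
    then have ne: "Gs \<noteq> []" using False by auto
    have sub: "set Gs \<subseteq> schreier (Suc p) - {{}}"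
      using 3(1) Fs(3) by (fastforce simp: Gs_def)
    have srt: "sorted_wrt set_less Gs"
      unfolding Gs_def by (rule sorted_wrt_restrict_nonempty[OF Fs(4) fin])
    have "length Gs \<le> length Fs"
      by (metis Gs_def length_filter_le length_map)
    moreover have "Min (hd Fs) \<le> Min (hd Gs)"
    proof -
      have hd: "hd Gs \<in> set Gs" using ne by simp
      then obtain A where A: "A \<in> set Fs" "hd Gs = A \<inter> G" "A \<inter> G \<noteq> {}"
        by (auto simp: Gs_def)
      have "Min (hd Fs) \<le> Min A"
      proof (cases Fs)
        case (Cons B Bs)
        show ?thesis
        proof (cases "A = B")
          case False
          then have "Max B < Min A" using A(1) Cons Fs(4) by (auto simp: set_less_def)
          moreover have "Min B \<le> Max B" using fin[of B] Cons by simp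
          ultimately show ?thesis using Cons by simp
        qed (simp add: Cons)
      qed (use Fs in simp)
      also have "Min A \<le> Min (A \<inter> G)" using A fin[of A] by (auto intro: Min_antimono)
      finally show ?thesis using A(2) by simp
    qed
    ultimately have "length Gs \<le> Min (hd Gs)" using Fs(5) by linarith
    then show ?thesis using G ne sub srt by auto
  qed simp
qed

text \<open>A union of \<open>d\<close> successive Schreier sets covers at most \<open>d\<close> consecutive blocks outside
  the family, because the last point of a block missed by the first set lies in a later one.\<close>

lemma successive_cover_length:
  fixes q :: "nat \<Rightarrow> nat"
  assumes "set Fs \<subseteq> schreier p - {{}}" "sorted_wrt set_less Fs" "mono q"
    and "\<And>i. a \<le> i \<Longrightarrow> i < b \<Longrightarrow> L \<inter> {q i<..q (Suc i)} \<notin> schreier p"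
    and "L \<inter> {q a<..q b} \<subseteq> \<Union> (set Fs)"
  shows "b \<le> a + length Fs"
  using assms
proof (induction Fs arbitrary: a)
  case Nil
  show ?case
  proof (rule ccontr)
    assume "\<not> ?thesis"
    then have ab: "a < b" by simp
    then have "q (Suc a) \<le> q b" using monoD[OF Nil(3), of "Suc a" b] by simp
    then have "L \<inter> {q a<..q (Suc a)} = {}" using Nil(5) by auto
    then show False using Nil(4)[of a] ab schreier_empty by simp
  qed
next
  case (Cons F Fs)
  show ?case
  proof (cases "a < b")
    case True
    have le: "q a \<le> q (Suc a)" "q (Suc a) \<le> q b"
      using monoD[OF Cons.prems(3)] True by auto
    have "\<not> L \<inter> {q a<..q (Suc a)} \<subseteq> F"
      using Cons.prems(1) Cons.prems(4)[of a] True schreier_hereditary by auto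
    then obtain x where "x \<in> L \<inter> {q a<..q (Suc a)}" and xF: "x \<notin> F" by blast
    then have x: "x \<in> L" "q a < x" "x \<le> q (Suc a)" by auto
    then have "x \<in> L \<inter> {q a<..q b}" using le by auto
    then have "x \<in> \<Union> (set (F # Fs))" using Cons.prems(5) by blast
    then obtain F' where F': "F' \<in> set Fs" "x \<in> F'" using xF by auto
    have fin: "finite F" "finite F'"
      using Cons.prems(1) F' schreier_finite by auto
    have lt: "Max F < x"
    proof -
      have "Max F < Min F'" using F'(1) Cons.prems(2) by (auto simp: set_less_def)
      also have "Min F' \<le> x" using F' fin by simp
      finally show ?thesis .
    qed
    have "L \<inter> {q (Suc a)<..q b} \<subseteq> \<Union> (set Fs)"
    proof
      fix y assume y: "y \<in> L \<inter> {q (Suc a)<..q b}"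
      then have "y \<in> \<Union> (set (F # Fs))" using Cons.prems(5) le by auto
      moreover have "y \<notin> F" 
      proof
        assume "y \<in> F"
        then have "y \<le> Max F" using fin(1) by simp
        then show False using y lt x(3) by simp
      qed
      ultimately show "y \<in> \<Union> (set Fs)" by auto
    qed
    then have "b \<le> Suc a + length Fs"
      using Cons.IH[of "Suc a"] Cons.prems by auto
    then show ?thesis by simp
  qed simp
qed

text \<open>Let \<open>d\<close> be the least element of \<open>L\<close>. Beyond \<open>d\<close>
  there are \<open>d + 1\<close> successive blocks of \<open>L\<close> outside the family one level
  below, whereas a set of the next family starting at \<open>d\<close> is a union of at most
  \<open>d\<close> pieces and so covers at most \<open>d\<close> blocks. This makes greatest initial
  segments exist.\<close>

lemma schreier_initial_bounded: "infinite L \<Longrightarrow> \<exists>q. L \<inter> {..q} \<notin> schreier p"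
proof (induction p arbitrary: L rule: schreier.induct)
  case 1
  obtain A where A: "A \<subseteq> L" "finite A" "card A = 2"
    using infinite_arbitrarily_large[OF 1, of 2] by blast
  have "A \<subseteq> L \<inter> {..Max A}" using A by auto
  then have "card A \<le> card (L \<inter> {..Max A})" by (intro card_mono) auto
  then show ?case using A by (auto intro!: exI[of _ "Max A"])
next
  case 2
  define d where "d = (LEAST x. x \<in> L)"
  obtain A where A: "A \<subseteq> L" "finite A" "card A = Suc (Suc d)"
    using infinite_arbitrarily_large[OF 2, of "Suc (Suc d)"] by blast
  have dL: "d \<in> L" "\<And>x. x \<in> L \<Longrightarrow> d \<le> x"
    unfolding d_def using 2 by (metis LeastI finite.emptyI ex_in_conv, metis Least_le)
  have sub: "A \<subseteq> L \<inter> {..Max A}" using A by auto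
  then have "card A \<le> card (L \<inter> {..Max A})" by (intro card_mono) auto
  moreover have ne: "A \<noteq> {}" using A by auto
  moreover have "Min (L \<inter> {..Max A}) = d"
  proof (rule Min_eqI)
    obtain a where "a \<in> A" using ne by auto
    then have "d \<le> a" "a \<le> Max A" using A dL(2) by auto
    then show "d \<in> L \<inter> {..Max A}" using dL(1) by auto
  qed (use dL in auto)
  ultimately show ?case using A sub by (auto intro!: exI[of _ "Max A"])
next
  case (3 p)
  define d where "d = (LEAST x. x \<in> L)"
  have dL: "d \<in> L" "\<And>x. x \<in> L \<Longrightarrow> d \<le> x"
    unfolding d_def using 3(2) by (metis LeastI finite.emptyI ex_in_conv, metis Least_le)
  have step: "\<exists>b\<ge>a. L \<inter> {a<..b} \<notin> schreier (Suc p)" for a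
  proof -
    have "infinite (L - {..a})" using 3(2) by simp
    then obtain b where b: "(L - {..a}) \<inter> {..b} \<notin> schreier (Suc p)" using 3(1) by blast
    have "(L - {..a}) \<inter> {..b} \<subseteq> L \<inter> {a<..max a b}" by auto
    then have "L \<inter> {a<..max a b} \<notin> schreier (Suc p)" using b schreier_hereditary by blast
    then show ?thesis by (meson max.cobounded1)
  qed
  define q where "q = rec_nat d (\<lambda>_ a. SOME b. b \<ge> a \<and> L \<inter> {a<..b} \<notin> schreier (Suc p))"
  have q: "q (Suc i) \<ge> q i \<and> L \<inter> {q i<..q (Suc i)} \<notin> schreier (Suc p)" for i
    unfolding q_def using someI_ex[OF step[of "q i", unfolded q_def]] by (simp add: q_def)
  have mq: "mono q" using q by (intro mono_iff_le_Suc[THEN iffD2]) auto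
  have q0: "q 0 = d" by (simp add: q_def)
  show ?case
  proof (rule exI[of _ "q (Suc d)"], rule notI)
    assume I: "L \<inter> {..q (Suc d)} \<in> schreier (Suc (Suc p))"
    have dI: "d \<in> L \<inter> {..q (Suc d)}" using dL(1) monoD[OF mq, of 0 "Suc d"] q0 by auto
    then obtain Fs where Fs: "L \<inter> {..q (Suc d)} = \<Union> (set Fs)" "Fs \<noteq> []"
        "set Fs \<subseteq> schreier (Suc p) - {{}}" "sorted_wrt set_less Fs" "length Fs \<le> Min (hd Fs)"
      using I by auto
    have "Suc d \<le> 0 + length Fs"
      using Fs q mq by (intro successive_cover_length[of Fs "Suc p" q 0 "Suc d" L]) auto
    moreover have "Min (hd Fs) \<le> d"
    proof -
      obtain B Bs where Fs': "Fs = B # Bs" using Fs(2) by (cases Fs) auto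
      obtain F where F: "F \<in> set Fs" "d \<in> F" using Fs(1) dI by auto
      have fin: "finite F" "finite B" "B \<noteq> {}" using F Fs(3) Fs' schreier_finite by auto
      have "Min B \<le> Min F"
      proof (cases "F = B")
        case False
        then have "Max B < Min F" using F(1) Fs' Fs(4) by (auto simp: set_less_def)
        moreover have "Min B \<le> Max B" using fin by simp
        ultimately show ?thesis by simp
      qed simp
      also have "Min F \<le> d" using fin F by simp
      finally show ?thesis using Fs' by simp
    qed
    ultimately show False using Fs(5) by simp
  qed
qed

lemma initial_segment_linear:
  assumes "initial_segment I L" "initial_segment J L"
  shows "I \<subseteq> J \<or> J \<subseteq> I"
  using assms unfolding initial_segment_def by (meson linear subsetD subsetI)

text \<open>Inclusion is only a partial order, so \<open>GREATEST\<close> needs a maximum to exist.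
  Initial segments are linearly ordered, and those in the family stay below a fixed bound; they form
  a finite chain, whose union is therefore a member.\<close>

lemma initial_segment_greatest:
  fixes L :: "nat set" and p :: nat
  assumes "infinite L"
  defines "I \<equiv> (GREATEST I. initial_segment I L \<and> I \<in> schreier p)"
  shows "initial_segment I L" "I \<in> schreier p"
    "\<And>J. initial_segment J L \<Longrightarrow> J \<in> schreier p \<Longrightarrow> J \<subseteq> I"
proof -
  obtain q where q: "L \<inter> {..q} \<notin> schreier p" using schreier_initial_bounded[OF assms(1)] by blast
  let ?A = "{J. initial_segment J L \<and> J \<in> schreier p}"
  have "?A \<subseteq> Pow {..q}"
  proof
    fix J assume "J \<in> ?A"
    then have J: "initial_segment J L" "J \<in> schreier p" by auto
    have "initial_segment (L \<inter> {..q}) L" by (auto simp: initial_segment_def)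
    from initial_segment_linear[OF J(1) this] have "J \<subseteq> L \<inter> {..q}"
      using schreier_hereditary[OF J(2), of "L \<inter> {..q}"] q by metis
    then show "J \<in> Pow {..q}" by auto
  qed
  then have fin: "finite ?A" by (rule finite_subset) simp
  have ne: "{} \<in> ?A" by (simp add: initial_segment_def schreier_empty)
  have "\<Union> ?A \<in> ?A"
  proof (rule Union_in_chain[OF fin])
    show "subset.chain ?A ?A"
      unfolding subset_chain_def
    proof (intro conjI ballI subset_refl)
      fix A B assume "A \<in> ?A" "B \<in> ?A"
      then show "A \<subseteq> B \<or> B \<subseteq> A" by (intro initial_segment_linear[of A L B]) auto
    qed
  qed (use ne in blast)
  then have eq: "I = \<Union> ?A" unfolding I_def by (intro Greatest_equality) auto
  show "initial_segment I L" "I \<in> schreier p"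
    using \<open>\<Union> ?A \<in> ?A\<close> eq by auto
  show "\<And>J. initial_segment J L \<Longrightarrow> J \<in> schreier p \<Longrightarrow> J \<subseteq> I" using eq by auto
qed

section \<open>Repeated averages\<close>

lemma rep_avg_bounds: "0 \<le> rep_avg p k L l \<and> rep_avg p k L l \<le> 1"
proof (induction p k L arbitrary: l rule: rep_avg.induct)
  case (1 k L)
  then show ?case by (simp add: rep_avg.simps)
next
  case (2 p k L)
  show ?case
  proof (cases "k \<le> 1")
    case True
    have IH: "0 \<le> rep_avg p i L l" "rep_avg p i L l \<le> 1" if "i \<in> {1..enumerate L 0}" for i
      using 2(1)[OF True that] by auto
    have "(\<Sum>i = 1..enumerate L 0. rep_avg p i L l) \<le> (\<Sum>i = 1..enumerate L 0. 1)"
      by (intro sum_mono IH)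
    \<comment> \<open>If 0 lies in \<open>L\<close>, the divisor is 0 and the quotient is 0 as
      well.\<close>
    then have "(\<Sum>i = 1..enumerate L 0. rep_avg p i L l) / real (enumerate L 0) \<le> 1"
      by (auto simp: divide_le_eq_1)
    moreover have "0 \<le> (\<Sum>i = 1..enumerate L 0. rep_avg p i L l)"
      by (intro sum_nonneg IH)
    ultimately show ?thesis using True by (simp add: rep_avg.simps)
  next
    case False
    then show ?thesis using 2(3)[OF False] by (simp add: rep_avg.simps(2))
  qed
qed

text \<open>Finiteness of the supports is proved together with the inclusion because it keeps the
  set that remains after removing earlier supports infinite, as the next step of the recursion
  requires.\<close>

lemma rep_avg_support:
  "infinite L \<Longrightarrow> finite {l. rep_avg p k L l \<noteq> 0} \<and> {l. rep_avg p k L l \<noteq> 0} \<subseteq> L"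
proof (induction p k L rule: rep_avg.induct)
  case (1 k L)
  then show ?case by (auto simp: rep_avg.simps enumerate_in_set)
next
  case (2 p k L)
  show ?case
  proof (cases "k \<le> 1")
    case True
    have "{l. rep_avg (Suc p) k L l \<noteq> 0} \<subseteq> (\<Union>i\<in>{1..enumerate L 0}. {l. rep_avg p i L l \<noteq> 0})"
    proof clarify
      fix l assume "rep_avg (Suc p) k L l \<noteq> 0"
      then have "(\<Sum>i = 1..enumerate L 0. rep_avg p i L l) \<noteq> 0"
        using True by (auto simp: rep_avg.simps(2))
      then obtain i where "i \<in> {1..enumerate L 0}" "rep_avg p i L l \<noteq> 0"
        by (meson sum.neutral)
      then show "l \<in> (\<Union>i\<in>{1..enumerate L 0}. {l. rep_avg p i L l \<noteq> 0})" by blast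
    qed
    moreover have "finite (\<Union>i\<in>{1..enumerate L 0}. {l. rep_avg p i L l \<noteq> 0}) \<and>
        (\<Union>i\<in>{1..enumerate L 0}. {l. rep_avg p i L l \<noteq> 0}) \<subseteq> L"
      using 2(1)[OF True] 2(4) by blast
    ultimately show ?thesis by (meson finite_subset subset_trans)
  next
    case False
    let ?L = "L - (\<Union>i\<in>{1..<k}. {l. rep_avg (Suc p) i L l \<noteq> 0})"
    have "finite (\<Union>i\<in>{1..<k}. {l. rep_avg (Suc p) i L l \<noteq> 0})"
      using 2(2)[OF False] 2(4) by blast
    then have "infinite ?L" using 2(4) by simp
    then have "finite {l. rep_avg (Suc p) 1 ?L l \<noteq> 0} \<and> {l. rep_avg (Suc p) 1 ?L l \<noteq> 0} \<subseteq> ?L"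
      by (rule 2(3)[OF False])
    then show ?thesis using False by (auto simp: rep_avg.simps(2)[of p k])
  qed
qed

lemma enumerate_local:
  fixes L L' :: "nat set"
  assumes "infinite L" "infinite L'" "L \<inter> {..q} = L' \<inter> {..q}" "enumerate L k \<le> q"
  shows "enumerate L' k = enumerate L k"
  using assms
proof (induction k arbitrary: L L')
  case 0
  have mem: "x \<in> L \<longleftrightarrow> x \<in> L'" if "x \<le> q" for x using 0(3) that by blast
  have 1: "enumerate L 0 \<in> L'"
    using enumerate_in_set[OF 0(1), of 0] mem 0(4) by blast
  then have le: "enumerate L' 0 \<le> enumerate L 0" by (simp add: enumerate_0 Least_le)
  then have "enumerate L' 0 \<le> q" using 0(4) by linarith
  then have "enumerate L' 0 \<in> L" using enumerate_in_set[OF 0(2), of 0] mem by blast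
  then have "enumerate L 0 \<le> enumerate L' 0" by (simp add: enumerate_0 Least_le)
  then show ?case using le by simp
next
  case (Suc k)
  have mem: "x \<in> L \<longleftrightarrow> x \<in> L'" if "x \<le> q" for x using Suc(4) that by blast
  have lt: "enumerate L 0 \<le> q"
    using Suc(2) Suc(5) enumerate_mono[of 0 "Suc k" L] by linarith
  have z: "enumerate L' 0 = enumerate L 0"
  proof -
    have 1: "enumerate L 0 \<in> L'"
      using enumerate_in_set[OF Suc(2), of 0] mem lt by blast
    then have le: "enumerate L' 0 \<le> enumerate L 0" by (simp add: enumerate_0 Least_le)
    then have "enumerate L' 0 \<le> q" using lt by linarith
    then have "enumerate L' 0 \<in> L" using enumerate_in_set[OF Suc(3), of 0] mem by blast
    then have "enumerate L 0 \<le> enumerate L' 0" by (simp add: enumerate_0 Least_le)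
    then show ?thesis using le by simp
  qed
  have int: "(L - {enumerate L 0}) \<inter> {..q} = (L' - {enumerate L' 0}) \<inter> {..q}"
    using mem z by auto
  have "enumerate (L' - {enumerate L' 0}) k = enumerate (L - {enumerate L 0}) k"
    by (rule Suc.IH[OF _ _ int]) (use Suc.prems in \<open>simp_all add: enumerate_Suc'[symmetric]\<close>)
  then show ?case by (simp add: enumerate_Suc')
qed

text \<open>Every step of the recursion looks only at smaller elements of the set. If already the
  least element exceeds \<open>q\<close>, no point up to \<open>q\<close> belongs to either set and
  both values are 0. Two branches through a common node thus get the same averages there.\<close>

lemma rep_avg_local:
  assumes "infinite L" "infinite L'" "L \<inter> {..q} = L' \<inter> {..q}" "l \<le> q"
  shows "rep_avg p k L l = rep_avg p k L' l"
  using assms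
proof (induction p k L arbitrary: L' l rule: rep_avg.induct)
  case (1 k L)
  have "l = enumerate L (k - 1) \<longleftrightarrow> l = enumerate L' (k - 1)"
    using enumerate_local[of L L' q "k - 1"] enumerate_local[of L' L q "k - 1"] 1 by metis
  then show ?case by (simp add: rep_avg.simps)
next
  case (2 p k L)
  show ?case
  proof (cases "k \<le> 1")
    case True
    show ?thesis
    proof (cases "enumerate L 0 \<le> q")
      case le: True
      have e: "enumerate L' 0 = enumerate L 0" using 2 le by (intro enumerate_local)
      have "rep_avg p i L l = rep_avg p i L' l" if "i \<in> {1..enumerate L 0}" for i
        using 2(1)[OF True that] 2 by blast
      then show ?thesis using True e by (simp add: rep_avg.simps(2))
    next
      case False
      have "enumerate L 0 \<le> l" if "l \<in> L" using that by (simp add: enumerate_0 Least_le)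
      then have "l \<notin> L" using False 2(7) by linarith
      moreover from this have "l \<notin> L'" using 2(6,7) by blast
      ultimately have "rep_avg (Suc p) k L l = 0" "rep_avg (Suc p) k L' l = 0"
        using rep_avg_support[OF 2(4), of "Suc p" k] rep_avg_support[OF 2(5), of "Suc p" k]
        by blast+
      then show ?thesis by simp
    qed
  next
    case False
    let ?L = "\<lambda>L. L - (\<Union>i\<in>{1..<k}. {l. rep_avg (Suc p) i L l \<noteq> 0})"
    have inf: "infinite (?L A)" if "infinite A" for A
    proof -
      have "finite (\<Union>i\<in>{1..<k}. {l. rep_avg (Suc p) i A l \<noteq> 0})"
        using rep_avg_support[OF that] by blast
      then show ?thesis using that by simp
    qed
    have "\<forall>i\<in>{1..<k}. \<forall>l\<le>q. rep_avg (Suc p) i L l = rep_avg (Suc p) i L' l"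
      using 2(2)[OF False] 2(4-6) by blast
    then have eq: "?L L \<inter> {..q} = ?L L' \<inter> {..q}" using 2(6) by fastforce
    have "rep_avg (Suc p) 1 (?L L) l = rep_avg (Suc p) 1 (?L L') l"
      by (rule 2(3)[OF False inf[OF 2(4)] inf[OF 2(5)] eq 2(7)])
    then show ?thesis using False by (simp add: rep_avg.simps(2)[of p k])
  qed
qed

section \<open>The sets and functionals on a branch\<close>

definition rest_set :: "(nat \<Rightarrow> nat) \<Rightarrow> (nat \<Rightarrow> nat) \<Rightarrow> nat set \<Rightarrow> nat \<Rightarrow> nat set" where
  "rest_set n \<gamma> \<sigma> k = \<sigma> - (\<Union>i\<in>{1..<k}. s_set n \<gamma> \<sigma> i)"

lemma s_set_eq:
  "s_set n \<gamma> \<sigma> k =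
    (GREATEST I. initial_segment I (rest_set n \<gamma> \<sigma> k) \<and>
      I \<in> schreier (n (2 * j_index n \<gamma> \<sigma> k + 1)))"
  by (subst s_set.simps) (simp add: rest_set_def j_index_def)

lemma rest_set_infinite:
  assumes "infinite \<sigma>"
  shows "infinite (rest_set n \<gamma> \<sigma> k) \<and> finite (s_set n \<gamma> \<sigma> k)"
proof (induction k rule: less_induct)
  case (less k)
  then have "finite (\<Union>i\<in>{1..<k}. s_set n \<gamma> \<sigma> i)" by auto
  then have "infinite (rest_set n \<gamma> \<sigma> k)" using assms by (simp add: rest_set_def)
  moreover from this have "finite (s_set n \<gamma> \<sigma> k)"
    unfolding s_set_eq by (intro schreier_finite[OF initial_segment_greatest(2)])
  ultimately show ?case by simp
qed

lemma
  assumes "infinite \<sigma>"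
  shows s_set_initial: "initial_segment (s_set n \<gamma> \<sigma> k) (rest_set n \<gamma> \<sigma> k)"
    and s_set_schreier: "s_set n \<gamma> \<sigma> k \<in> schreier (n (2 * j_index n \<gamma> \<sigma> k + 1))"
    and s_set_greatest: "\<And>J. initial_segment J (rest_set n \<gamma> \<sigma> k) \<Longrightarrow>
      J \<in> schreier (n (2 * j_index n \<gamma> \<sigma> k + 1)) \<Longrightarrow> J \<subseteq> s_set n \<gamma> \<sigma> k"
    and s_set_finite: "finite (s_set n \<gamma> \<sigma> k)"
  using initial_segment_greatest[of "rest_set n \<gamma> \<sigma> k"] rest_set_infinite[OF assms, of n \<gamma> k]
  by (auto simp: s_set_eq)

lemma s_set_subset: "infinite \<sigma> \<Longrightarrow> s_set n \<gamma> \<sigma> k \<subseteq> \<sigma>"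
  using s_set_initial[of \<sigma> n \<gamma> k] by (auto simp: initial_segment_def rest_set_def)

lemma s_set_less_rest:
  assumes "infinite \<sigma>" "1 \<le> i" "i < k" "x \<in> s_set n \<gamma> \<sigma> i" "y \<in> rest_set n \<gamma> \<sigma> k"
  shows "x < y"
proof (rule ccontr)
  assume "\<not> x < y"
  then have "y \<le> x" by simp
  moreover have "y \<in> rest_set n \<gamma> \<sigma> i" using assms by (auto simp: rest_set_def)
  ultimately have "y \<in> s_set n \<gamma> \<sigma> i"
    using s_set_initial[OF assms(1), of n \<gamma> i] assms(4) by (auto simp: initial_segment_def)
  then show False using assms by (auto simp: rest_set_def)
qed

lemma s_set_successive:
  assumes "infinite \<sigma>" "1 \<le> i" "i < k" "x \<in> s_set n \<gamma> \<sigma> i" "y \<in> s_set n \<gamma> \<sigma> k"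
  shows "x < y"
  using s_set_less_rest[OF assms(1-4)] s_set_initial[OF assms(1), of n \<gamma> k] assms(5)
  by (auto simp: initial_segment_def)

text \<open>The index depends on the maximum of the previous set, which a cut at \<open>q\<close>
  need not see. As soon as the remainder has a point up to \<open>q\<close>, the whole previous set
  lies below that point, so it is the same for both branches.\<close>

lemma s_set_local_aux:
  assumes "infinite \<sigma>" "infinite \<sigma>'" "\<sigma> \<inter> {..q} = \<sigma>' \<inter> {..q}" "1 \<le> k"
    and IH: "\<And>i. 1 \<le> i \<Longrightarrow> i < k \<Longrightarrow> s_set n \<gamma> \<sigma> i \<inter> {..q} = s_set n \<gamma> \<sigma>' i \<inter> {..q}"
  shows "rest_set n \<gamma> \<sigma> k \<inter> {..q} = rest_set n \<gamma> \<sigma>' k \<inter> {..q}"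
    and "rest_set n \<gamma> \<sigma> k \<inter> {..q} \<noteq> {} \<Longrightarrow> j_index n \<gamma> \<sigma> k = j_index n \<gamma> \<sigma>' k"
proof -
  have "s_set n \<gamma> \<sigma> i \<inter> {..q} = s_set n \<gamma> \<sigma>' i \<inter> {..q}" if "i \<in> {1..<k}" for i
    using IH[of i] that by simp
  then show eq: "rest_set n \<gamma> \<sigma> k \<inter> {..q} = rest_set n \<gamma> \<sigma>' k \<inter> {..q}"
    using assms(3) unfolding rest_set_def by blast
  assume "rest_set n \<gamma> \<sigma> k \<inter> {..q} \<noteq> {}"
  then obtain g where g: "g \<in> rest_set n \<gamma> \<sigma> k" "g \<in> rest_set n \<gamma> \<sigma>' k" "g \<le> q" using eq by auto
  show "j_index n \<gamma> \<sigma> k = j_index n \<gamma> \<sigma>' k"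
  proof (cases "k \<le> 1")
    case False
    have "x \<le> q" if "x \<in> s_set n \<gamma> \<sigma> (k - 1) \<or> x \<in> s_set n \<gamma> \<sigma>' (k - 1)" for x
    proof -
      have "x < g"
        using that s_set_less_rest[OF assms(1), of "k - 1" k x n \<gamma> g]
          s_set_less_rest[OF assms(2), of "k - 1" k x n \<gamma> g] g(1,2) False by auto
      then show ?thesis using g(3) by simp
    qed
    then have "s_set n \<gamma> \<sigma> (k - 1) \<subseteq> {..q}" "s_set n \<gamma> \<sigma>' (k - 1) \<subseteq> {..q}" by blast+
    then have "s_set n \<gamma> \<sigma> (k - 1) = s_set n \<gamma> \<sigma>' (k - 1)"
      using IH[of "k - 1"] False by (simp add: Int_absorb2)
    then show ?thesis using False by (simp add: j_index_def)
  qed (simp add: j_index_def)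
qed

text \<open>The part of one set up to \<open>x\<close> is an initial segment of the other remainder
  and lies in the same Schreier family, so it is contained in the greatest such segment.\<close>

lemma s_set_local_subset:
  assumes "infinite \<sigma>" "infinite \<sigma>'"
    and "rest_set n \<gamma> \<sigma> k \<inter> {..q} = rest_set n \<gamma> \<sigma>' k \<inter> {..q}"
    and "rest_set n \<gamma> \<sigma> k \<inter> {..q} \<noteq> {} \<Longrightarrow> j_index n \<gamma> \<sigma> k = j_index n \<gamma> \<sigma>' k"
  shows "s_set n \<gamma> \<sigma> k \<inter> {..q} \<subseteq> s_set n \<gamma> \<sigma>' k"
proof
  fix x assume x: "x \<in> s_set n \<gamma> \<sigma> k \<inter> {..q}"
  note ini = s_set_initial[OF assms(1), of n \<gamma> k]
  have "x \<in> rest_set n \<gamma> \<sigma> k \<inter> {..q}" using x ini by (auto simp: initial_segment_def)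
  then have j: "j_index n \<gamma> \<sigma> k = j_index n \<gamma> \<sigma>' k" using assms(4) by blast
  let ?I = "s_set n \<gamma> \<sigma> k \<inter> {..x}"
  have "?I \<in> schreier (n (2 * j_index n \<gamma> \<sigma>' k + 1))"
    using s_set_schreier[OF assms(1), of n \<gamma> k] j schreier_hereditary by fastforce
  moreover have "initial_segment ?I (rest_set n \<gamma> \<sigma>' k)"
    unfolding initial_segment_def
  proof (intro conjI ballI impI subsetI)
    fix y assume "y \<in> ?I"
    then have "y \<in> rest_set n \<gamma> \<sigma> k \<inter> {..q}" using x ini by (auto simp: initial_segment_def)
    then show "y \<in> rest_set n \<gamma> \<sigma>' k" using assms(3) by blast
  next
    fix i a assume a: "i \<in> ?I" "a \<in> rest_set n \<gamma> \<sigma>' k" "a \<le> i"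
    then have "a \<in> rest_set n \<gamma> \<sigma>' k \<inter> {..q}" using x by auto
    then have "a \<in> rest_set n \<gamma> \<sigma> k" using assms(3) by blast
    then show "a \<in> ?I" using a ini by (auto simp: initial_segment_def)
  qed
  ultimately have "?I \<subseteq> s_set n \<gamma> \<sigma>' k" by (intro s_set_greatest[OF assms(2)])
  then show "x \<in> s_set n \<gamma> \<sigma>' k" using x by auto
qed

lemma s_set_local:
  assumes "infinite \<sigma>" "infinite \<sigma>'" "\<sigma> \<inter> {..q} = \<sigma>' \<inter> {..q}" "1 \<le> k"
  shows "s_set n \<gamma> \<sigma> k \<inter> {..q} = s_set n \<gamma> \<sigma>' k \<inter> {..q}"
  using assms(4)
proof (induction k rule: less_induct)
  case (less k)
  then have IH: "s_set n \<gamma> \<sigma> i \<inter> {..q} = s_set n \<gamma> \<sigma>' i \<inter> {..q}" if "1 \<le> i" "i < k" for i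
    using that by blast
  note aux = s_set_local_aux[OF assms(1-3) less.prems IH]
  have "s_set n \<gamma> \<sigma> k \<inter> {..q} \<subseteq> s_set n \<gamma> \<sigma>' k"
    by (rule s_set_local_subset[OF assms(1,2) aux])
  moreover have "s_set n \<gamma> \<sigma>' k \<inter> {..q} \<subseteq> s_set n \<gamma> \<sigma> k"
    using aux by (intro s_set_local_subset[OF assms(2,1)]) auto
  ultimately show ?case by blast
qed

lemma phi_local:
  assumes "infinite \<sigma>" "infinite \<sigma>'" "\<sigma> \<inter> {..q} = \<sigma>' \<inter> {..q}" "1 \<le> k" "l \<le> q"
  shows "phi m n \<gamma> \<sigma> k l = phi m n \<gamma> \<sigma>' k l"
proof (cases "l \<in> s_set n \<gamma> \<sigma> k")
  case True
  then have True': "l \<in> s_set n \<gamma> \<sigma>' k" using s_set_local[OF assms(1-4)] assms(5) by blast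
  note aux = s_set_local_aux[OF assms(1-4) s_set_local[OF assms(1-3)]]
  have "l \<in> rest_set n \<gamma> \<sigma> k \<inter> {..q}"
    using True s_set_initial[OF assms(1), of n \<gamma> k] assms(5) by (auto simp: initial_segment_def)
  then have j: "j_index n \<gamma> \<sigma> k = j_index n \<gamma> \<sigma>' k" using aux(2) by blast
  have "rep_avg p 1 (rest_set n \<gamma> \<sigma> k) l = rep_avg p 1 (rest_set n \<gamma> \<sigma>' k) l" for p
    using rest_set_infinite assms aux(1) by (intro rep_avg_local) auto
  then show ?thesis using True True' j by (simp add: phi_def beta_def rest_set_def)
next
  case False
  then have "l \<notin> s_set n \<gamma> \<sigma>' k" using s_set_local[OF assms(1-4)] assms(5) by blast
  then show ?thesis using False by (simp add: phi_def)
qed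

lemma phi_bounds: "0 \<le> phi m n \<gamma> \<sigma> k l" "phi m n \<gamma> \<sigma> k l \<le> 1"
proof -
  let ?b = "beta n \<gamma> \<sigma> k l" and ?m = "m (2 * j_index n \<gamma> \<sigma> k + 1)"
  have b: "0 \<le> ?b" "?b \<le> 1" using rep_avg_bounds by (auto simp: beta_def)
  then show "0 \<le> phi m n \<gamma> \<sigma> k l" by (simp add: phi_def)
  \<comment> \<open>Nothing is assumed about \<open>m\<close> here; for a zero denominator the
    quotient is 0.\<close>
  show "phi m n \<gamma> \<sigma> k l \<le> 1"
  proof (cases "?m = 0")
    case False
    then have "1 \<le> real ?m" by simp
    then have "1 \<le> real ?m ^ 2" by (rule one_le_power)
    then have "?b \<le> real ?m ^ 2" using b by linarith
    then have "?b / real ?m ^ 2 \<le> 1" using b False by (simp add: divide_le_eq_1 del: of_nat_mult)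
    then show ?thesis by (simp add: phi_def)
  qed (simp add: phi_def)
qed

lemma phi_support: "phi m n \<gamma> \<sigma> k l \<noteq> 0 \<Longrightarrow> l \<in> s_set n \<gamma> \<sigma> k"
  by (auto simp: phi_def split: if_splits)

section \<open>Finitely supported sequences\<close>

lemma c00_zero: "(\<lambda>_. 0) \<in> c00"
  by (simp add: c00_def)

lemma c00_finite: "x \<in> c00 \<Longrightarrow> finite {i. x i \<noteq> 0}"
  by (simp add: c00_def)

lemma c00_at_0: "x \<in> c00 \<Longrightarrow> x 0 = 0"
  by (simp add: c00_def)

lemma c00_mono:
  assumes "x \<in> c00" "\<And>i. x i = 0 \<Longrightarrow> y i = 0"
  shows "y \<in> c00"
proof -
  have "{i. y i \<noteq> 0} \<subseteq> {i. x i \<noteq> 0}" using assms(2) by blast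
  then have "finite {i. y i \<noteq> 0}" using c00_finite[OF assms(1)] finite_subset by blast
  moreover have "y 0 = 0" using assms(2)[OF c00_at_0[OF assms(1)]] .
  ultimately show ?thesis by (simp add: c00_def)
qed

lemma c00_scale: "x \<in> c00 \<Longrightarrow> (\<lambda>i. c * x i) \<in> c00"
  by (rule c00_mono[of x]) auto

lemma c00_restrict: "x \<in> c00 \<Longrightarrow> restrict_to E x \<in> c00"
  by (rule c00_mono[of x]) (auto simp: restrict_to_def)

lemma c00_add:
  assumes "x \<in> c00" "y \<in> c00"
  shows "(\<lambda>i. x i + y i) \<in> c00"
proof -
  have "{i. x i + y i \<noteq> 0} \<subseteq> {i. x i \<noteq> 0} \<union> {i. y i \<noteq> 0}" by auto
  then have "finite {i. x i + y i \<noteq> 0}"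
    using c00_finite[OF assms(1)] c00_finite[OF assms(2)] by (meson finite_UnI finite_subset)
  then show ?thesis using assms by (simp add: c00_def)
qed

lemma c00_sum:
  assumes "\<And>j. j \<in> J \<Longrightarrow> x j \<in> c00"
  shows "(\<lambda>i. \<Sum>j\<in>J. x j i) \<in> c00"
proof (cases "finite J")
  case True
  then show ?thesis using assms
    by (induction J rule: finite_induct) (auto simp: c00_zero c00_add)
qed (simp add: c00_zero)

lemma restrict_restrict: "restrict_to A (restrict_to B x) = restrict_to (A \<inter> B) x"
  by (auto simp: restrict_to_def)

lemma restrict_eqI: "(\<And>i. x i \<noteq> 0 \<Longrightarrow> i \<in> A) \<Longrightarrow> restrict_to A x = x"
  unfolding restrict_to_def by (rule ext) auto

lemma restrict_zeroI: "(\<And>i. i \<in> A \<Longrightarrow> x i = 0) \<Longrightarrow> restrict_to A x = (\<lambda>_. 0)"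
  by (auto simp: restrict_to_def)

text \<open>The sum in \<open>pairing\<close> runs over the support of \<open>x\<close>, which
  varies with \<open>x\<close>. A common finite index set is needed to compare pairings with
  different vectors.\<close>

lemma pairing_eq:
  assumes "finite S" "\<And>i. x i \<noteq> 0 \<Longrightarrow> i \<in> S"
  shows "pairing f x = (\<Sum>i\<in>S. f i * x i)"
  unfolding pairing_def by (rule sum.mono_neutral_left) (use assms in auto)

lemma pairing_zero [simp]: "pairing f (\<lambda>_. 0) = 0"
  by (simp add: pairing_def)

lemma pairing_add:
  assumes "x \<in> c00" "y \<in> c00"
  shows "pairing f (\<lambda>i. x i + y i) = pairing f x + pairing f y"
proof -
  let ?S = "{i. x i \<noteq> 0} \<union> {i. y i \<noteq> 0}"
  have "finite ?S" using assms c00_finite by blast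
  then have "pairing f (\<lambda>i. x i + y i) = (\<Sum>i\<in>?S. f i * (x i + y i))"
    "pairing f x = (\<Sum>i\<in>?S. f i * x i)" "pairing f y = (\<Sum>i\<in>?S. f i * y i)"
    by (intro pairing_eq; auto)+
  then show ?thesis by (simp add: sum.distrib distrib_left)
qed

lemma pairing_scale: "pairing f (\<lambda>i. c * x i) = c * pairing f x"
proof (cases "c = 0")
  case False
  then show ?thesis by (simp add: pairing_def sum_distrib_left ac_simps)
qed (simp add: pairing_def)

lemma pairing_sum:
  assumes "\<And>j. j \<in> J \<Longrightarrow> x j \<in> c00"
  shows "pairing f (\<lambda>i. \<Sum>j\<in>J. x j i) = (\<Sum>j\<in>J. pairing f (x j))"
proof (cases "finite J")
  case True
  then show ?thesis using assms
  proof (induction J rule: finite_induct)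
    case (insert j J)
    then show ?case by (simp add: pairing_add c00_sum)
  qed simp
qed simp

lemma pairing_restrict:
  assumes "x \<in> c00"
  shows "pairing (restrict_to E f) x = pairing f (restrict_to E x)"
proof -
  have "pairing f (restrict_to E x) = (\<Sum>i | x i \<noteq> 0. f i * restrict_to E x i)"
    using c00_finite[OF assms] by (intro pairing_eq) (auto simp: restrict_to_def split: if_splits)
  also have "\<dots> = pairing (restrict_to E f) x"
    unfolding pairing_def restrict_to_def by (rule sum.cong) auto
  finally show ?thesis by simp
qed

lemma pairing_cong: "(\<And>i. x i \<noteq> 0 \<Longrightarrow> f i = g i) \<Longrightarrow> pairing f x = pairing g x"
  unfolding pairing_def by (rule sum.cong) auto

section \<open>Branches and segments\<close>

definition tchain :: "nat set \<Rightarrow> nat rel \<Rightarrow> nat set \<Rightarrow> bool" where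
  "tchain D R C \<longleftrightarrow> C \<subseteq> D \<and> (\<forall>a\<in>C. \<forall>b\<in>C. (a, b) \<in> R \<or> (b, a) \<in> R)"

lemma tchain_subset: "tchain D R C \<Longrightarrow> C' \<subseteq> C \<Longrightarrow> tchain D R C'"
  unfolding tchain_def by blast

context jt_tree
begin

lemma R_refl: "t \<in> D \<Longrightarrow> (t, t) \<in> R"
  using partial_order_onD(1)[OF R_partial_order] by (simp add: refl_on_def)

lemma R_trans: "(a, b) \<in> R \<Longrightarrow> (b, c) \<in> R \<Longrightarrow> (a, c) \<in> R"
  using partial_order_onD(2)[OF R_partial_order] by (rule transD)

lemma R_antisym: "(a, b) \<in> R \<Longrightarrow> (b, a) \<in> R \<Longrightarrow> a = b"
  using partial_order_onD(3)[OF R_partial_order] by (rule antisymD)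

lemma R_field: "(a, b) \<in> R \<Longrightarrow> a \<noteq> 0 \<Longrightarrow> a \<in> D \<and> b \<in> D"
  using partial_order_onD(4)[OF R_partial_order] R_compatible[of a b] by auto

lemma D_nonzero: "t \<in> D \<Longrightarrow> 1 \<le> t"
  using D_pos by auto

lemma chain_iff_tchain: "pred_on.chain D (\<lambda>a b. (a, b) \<in> R) C \<longleftrightarrow> tchain D R C"
  unfolding pred_on.chain_def tchain_def sup2CI using R_refl by (auto 4 4)

lemma branch_iff:
  "\<sigma> \<in> branches D R \<longleftrightarrow> tchain D R \<sigma> \<and> (\<forall>C. tchain D R C \<longrightarrow> \<sigma> \<subseteq> C \<longrightarrow> C = \<sigma>)"
  unfolding branches_def pred_on.maxchain_def chain_iff_tchain by (auto simp: psubset_eq)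

lemma branch_tchain: "\<sigma> \<in> branches D R \<Longrightarrow> tchain D R \<sigma>"
  by (simp add: branch_iff)

lemma branch_subset: "\<sigma> \<in> branches D R \<Longrightarrow> \<sigma> \<subseteq> D"
  using branch_tchain by (simp add: tchain_def)

lemma tchain_extend:
  assumes "tchain D R C"
  shows "\<exists>\<sigma>\<in>branches D R. C \<subseteq> \<sigma>"
proof -
  let ?A = "{X. tchain D R X \<and> C \<subseteq> X}"
  have "\<exists>M\<in>?A. \<forall>X\<in>?A. M \<subseteq> X \<longrightarrow> X = M"
  proof (rule subset_Zorn_nonempty)
    show "?A \<noteq> {}" using assms by blast
    fix \<C> assume ne: "\<C> \<noteq> {}" and "subset.chain ?A \<C>"
    then have sub: "\<And>X. X \<in> \<C> \<Longrightarrow> tchain D R X \<and> C \<subseteq> X"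
      and lin: "\<And>X Y. X \<in> \<C> \<Longrightarrow> Y \<in> \<C> \<Longrightarrow> X \<subseteq> Y \<or> Y \<subseteq> X"
      unfolding subset_chain_def by blast+
    have "tchain D R (\<Union>\<C>)"
      unfolding tchain_def
    proof (intro conjI ballI)
      show "\<Union>\<C> \<subseteq> D" using sub unfolding tchain_def by blast
      fix a b assume "a \<in> \<Union>\<C>" "b \<in> \<Union>\<C>"
      then obtain X Y where XY: "X \<in> \<C>" "a \<in> X" "Y \<in> \<C>" "b \<in> Y" by blast
      from lin[OF XY(1,3)] show "(a, b) \<in> R \<or> (b, a) \<in> R"
        using sub[OF XY(1)] sub[OF XY(3)] XY(2,4) unfolding tchain_def by blast
    qed
    moreover have "C \<subseteq> \<Union>\<C>" using ne sub by blast
    ultimately show "\<Union>\<C> \<in> ?A" by blast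
  qed
  then obtain M where MA: "M \<in> ?A" and max: "\<forall>X\<in>?A. M \<subseteq> X \<longrightarrow> X = M" by (rule bexE)
  have "X = M" if "tchain D R X" "M \<subseteq> X" for X
  proof -
    have "X \<in> ?A" using MA that by auto
    then show ?thesis using max that(2) by blast
  qed
  then have "M \<in> branches D R" unfolding branch_iff using MA by blast
  then show ?thesis using MA by blast
qed

text \<open>By maximality it suffices that \<open>a\<close> is comparable with all of the branch:
  with nodes above \<open>t\<close> by transitivity, with nodes below \<open>t\<close> because
  predecessors of \<open>t\<close> are linearly ordered.\<close>

lemma branch_down:
  assumes "\<sigma> \<in> branches D R" "t \<in> \<sigma>" "(a, t) \<in> R" "a \<in> D"
  shows "a \<in> \<sigma>"
proof -
  have ch: "\<sigma> \<subseteq> D" "\<And>b c. b \<in> \<sigma> \<Longrightarrow> c \<in> \<sigma> \<Longrightarrow> (b, c) \<in> R \<or> (c, b) \<in> R"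
    using branch_tchain[OF assms(1)] unfolding tchain_def by blast+
  have a: "(a, b) \<in> R \<or> (b, a) \<in> R" if b: "b \<in> \<sigma>" for b
    using ch(2)[OF b assms(2)] R_trans[OF assms(3), of b] predecessors_linear[OF assms(3), of b]
    by blast
  have "tchain D R (insert a \<sigma>)"
    unfolding tchain_def using ch a assms(4) R_refl[OF assms(4)] by blast
  then have "insert a \<sigma> = \<sigma>" using assms(1) unfolding branch_iff by blast
  then show ?thesis by blast
qed

lemma tchain_le: "tchain D R C \<Longrightarrow> a \<in> C \<Longrightarrow> b \<in> C \<Longrightarrow> a \<le> b \<Longrightarrow> (a, b) \<in> R"
  unfolding tchain_def using R_compatible by (metis le_antisym)

text \<open>A finite branch would have a last node, and an immediate successor of that node would
  prolong the chain.\<close>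

lemma branch_infinite:
  assumes "\<sigma> \<in> branches D R"
  shows "infinite \<sigma>"
proof
  assume fin: "finite \<sigma>"
  have ch: "tchain D R \<sigma>" by (rule branch_tchain[OF assms])
  have ne: "\<sigma> \<noteq> {}"
  proof
    assume e: "\<sigma> = {}"
    obtain t where "t \<in> D" using D_infinite by (meson finite.emptyI subsetI finite_subset)
    then have "tchain D R {t}" using R_refl by (auto simp: tchain_def)
    then show False using assms e unfolding branch_iff by blast
  qed
  define t where "t = Max \<sigma>"
  have t: "t \<in> \<sigma>" "\<And>b. b \<in> \<sigma> \<Longrightarrow> (b, t) \<in> R"
    using fin ne tchain_le[OF ch] by (auto simp: t_def)
  then have tD: "t \<in> D" using branch_subset[OF assms] by blast
  then obtain u where u: "immediate_succ R t u"
    using infinitely_many_succ[of t] by (metis (no_types) Collect_empty_eq finite.emptyI insertI2)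
  then have tu: "(t, u) \<in> R" "t \<noteq> u" by (auto simp: immediate_succ_def)
  then have uD: "u \<in> D" using R_field[of t u] D_nonzero[OF tD] by simp
  have bu: "(b, u) \<in> R" if "b \<in> \<sigma>" for b using R_trans[OF t(2)[OF that] tu(1)] .
  have "tchain D R (insert u \<sigma>)"
    using ch bu uD R_refl[OF uD] unfolding tchain_def by blast
  then have "insert u \<sigma> = \<sigma>" using assms unfolding branch_iff by blast
  then have "(u, t) \<in> R" using t by blast
  then show False using tu R_antisym by blast
qed

text \<open>A node determines its past. Combined with the locality of the functionals, this makes
  branches through a common node indistinguishable up to that node.\<close>

lemma branches_agree:
  assumes "\<sigma> \<in> branches D R" "\<sigma>' \<in> branches D R" "l \<in> \<sigma>" "l \<in> \<sigma>'"
  shows "\<sigma> \<inter> {..l} = \<sigma>' \<inter> {..l}"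
proof -
  have "a \<in> \<sigma>'" if ab: "\<sigma> \<in> branches D R" "\<sigma>' \<in> branches D R" "l \<in> \<sigma>" "l \<in> \<sigma>'" "a \<in> \<sigma>" "a \<le> l"
    for a \<sigma> \<sigma>'
    using branch_down[OF ab(2,4) tchain_le[OF branch_tchain[OF ab(1)] ab(5,3,6)]]
      branch_subset[OF ab(1)] ab(5) by blast
  then show ?thesis using assms by blast
qed

lemma phi_branches_agree:
  assumes "\<sigma> \<in> branches D R" "\<sigma>' \<in> branches D R" "l \<in> \<sigma>" "l \<in> \<sigma>'" "1 \<le> k"
  shows "phi m n \<gamma> \<sigma> k l = phi m n \<gamma> \<sigma>' k l"
  using phi_local[OF branch_infinite[OF assms(1)] branch_infinite[OF assms(2)]
      branches_agree[OF assms(1-4)] assms(5)] by simp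

lemma segment_eq:
  assumes "s \<in> segments D R"
  obtains a b where "a \<in> D" "b \<in> D" "(a, b) \<in> R" "s = {k \<in> D. (a, k) \<in> R \<and> (k, b) \<in> R}"
    "Min s = a" "Max s = b" "finite s" "a \<in> s" "b \<in> s"
proof -
  obtain a b where ab: "a \<in> D" "b \<in> D" "(a, b) \<in> R" "s = {k \<in> D. (a, k) \<in> R \<and> (k, b) \<in> R}"
    using assms unfolding segments_def by blast
  have "s \<subseteq> {..b}" using ab(4) R_compatible by auto
  then have fin: "finite s" using finite_subset by blast
  have mem: "a \<in> s" "b \<in> s" using ab R_refl by auto
  have "Min s = a" "Max s = b"
    using ab(4) fin mem R_compatible by (auto intro!: Min_eqI Max_eqI)
  with ab fin mem show ?thesis using that by blast
qed

lemma segment_finite: "s \<in> segments D R \<Longrightarrow> finite s"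
  by (erule segment_eq)

lemma segment_nonempty: "s \<in> segments D R \<Longrightarrow> s \<noteq> {}"
  by (erule segment_eq) blast

lemma segment_subset_D: "s \<in> segments D R \<Longrightarrow> s \<subseteq> D"
  by (auto simp: segments_def)

lemma segment_Min: "s \<in> segments D R \<Longrightarrow> Min s \<in> s"
  by (simp add: segment_finite segment_nonempty)

lemma segment_tchain:
  assumes "s \<in> segments D R"
  shows "tchain D R s"
proof -
  from assms obtain a b where "s = {k \<in> D. (a, k) \<in> R \<and> (k, b) \<in> R}" by (rule segment_eq)
  then show ?thesis unfolding tchain_def using predecessors_linear by blast
qed

lemma segmentI:
  assumes "a \<in> D" "b \<in> D" "(a, b) \<in> R"
  shows "{k \<in> D. (a, k) \<in> R \<and> (k, b) \<in> R} \<in> segments D R"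
  using assms unfolding segments_def by blast

text \<open>Together with \<open>segment_branch_interval\<close>: segments are traces of intervals
  on branches. Intervals matter because \<open>W\<close> is stable under restriction to
  them.\<close>

lemma branch_interval_segment:
  assumes "\<sigma> \<in> branches D R" "a \<in> \<sigma>" "b \<in> \<sigma>" "a \<le> b"
  shows "\<sigma> \<inter> {a..b} \<in> segments D R"
proof -
  note ch = branch_tchain[OF assms(1)] and sub = branch_subset[OF assms(1)]
  have "k \<in> \<sigma> \<inter> {a..b} \<longleftrightarrow> k \<in> D \<and> (a, k) \<in> R \<and> (k, b) \<in> R" for k
  proof
    assume "k \<in> \<sigma> \<inter> {a..b}"
    then show "k \<in> D \<and> (a, k) \<in> R \<and> (k, b) \<in> R"
      using tchain_le[OF ch] assms(2,3) sub by auto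
  next
    assume k: "k \<in> D \<and> (a, k) \<in> R \<and> (k, b) \<in> R"
    then show "k \<in> \<sigma> \<inter> {a..b}"
      using branch_down[OF assms(1,3), of k] R_compatible by auto
  qed
  then have "\<sigma> \<inter> {a..b} = {k \<in> D. (a, k) \<in> R \<and> (k, b) \<in> R}" by blast
  then show ?thesis
    using segmentI[of a b] tchain_le[OF ch assms(2-4)] assms(2,3) sub by auto
qed

lemma segment_branch_interval:
  assumes "s \<in> segments D R" "\<sigma> \<in> branches D R" "s \<subseteq> \<sigma>"
  shows "s = \<sigma> \<inter> {Min s..Max s}"
proof -
  from assms(1) obtain a b where ab: "s = {k \<in> D. (a, k) \<in> R \<and> (k, b) \<in> R}"
    "Min s = a" "Max s = b" "finite s" "a \<in> s" "b \<in> s" by (rule segment_eq)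
  note ch = branch_tchain[OF assms(2)]
  show ?thesis
  proof (intro equalityI subsetI)
    fix k assume "k \<in> s"
    then show "k \<in> \<sigma> \<inter> {Min s..Max s}" using ab(4) assms(3) by auto
  next
    fix k assume k: "k \<in> \<sigma> \<inter> {Min s..Max s}"
    then have "(a, k) \<in> R" "(k, b) \<in> R"
      using tchain_le[OF ch] ab(2,3,5,6) assms(3) by auto
    then show "k \<in> s" using ab(1) k branch_subset[OF assms(2)] by auto
  qed
qed

lemma segment_branch:
  assumes "s \<in> segments D R"
  obtains \<sigma> where "\<sigma> \<in> branches D R" "s \<subseteq> \<sigma>" "s = \<sigma> \<inter> {Min s..Max s}"
  using tchain_extend[OF segment_tchain[OF assms]] segment_branch_interval[OF assms] by blast

lemma segment_cut:
  assumes "s \<in> segments D R" "a \<in> s" "b \<in> s" "a \<le> b"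
  shows "s \<inter> {a..b} \<in> segments D R" "Min (s \<inter> {a..b}) = a"
proof -
  obtain \<sigma> where \<sigma>: "\<sigma> \<in> branches D R" "s \<subseteq> \<sigma>" "s = \<sigma> \<inter> {Min s..Max s}"
    by (rule segment_branch[OF assms(1)])
  have "Min s \<le> a" "b \<le> Max s" using segment_finite[OF assms(1)] assms(2,3) by auto
  then have "\<sigma> \<inter> {a..b} \<subseteq> \<sigma> \<inter> {Min s..Max s}" by auto
  then have "s \<inter> {a..b} = \<sigma> \<inter> {a..b}" using \<sigma>(2,3) by blast
  then show "s \<inter> {a..b} \<in> segments D R"
    using branch_interval_segment[OF \<sigma>(1), of a b] assms(2-4) \<sigma>(2) by (simp add: subset_iff)
  show "Min (s \<inter> {a..b}) = a"
    using segment_finite[OF assms(1)] assms(2-4) by (intro Min_eqI) auto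
qed

text \<open>Serves to move the start of a segment towards the root. The old segment is the trace of
  an interval on the new one, so the norm cannot drop.\<close>

lemma segment_extend_down:
  assumes "s \<in> segments D R" "a \<in> D" "(a, Min s) \<in> R"
  obtains s' where "s' \<in> segments D R" "Min s' = a" "s \<subseteq> s'" "s = s' \<inter> {Min s..}"
proof -
  from assms(1) obtain c b where cb: "c \<in> D" "b \<in> D" "(c, b) \<in> R"
    "s = {k \<in> D. (c, k) \<in> R \<and> (k, b) \<in> R}" "Min s = c" "Max s = b" by (rule segment_eq)
  let ?s = "{k \<in> D. (a, k) \<in> R \<and> (k, b) \<in> R}"
  have ac: "(a, c) \<in> R" using assms(3) cb(5) by simp
  have seg: "?s \<in> segments D R"
    by (rule segmentI[OF assms(2) cb(2) R_trans[OF ac cb(3)]])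
  have mn: "Min ?s = a"
    using segment_finite[OF seg] R_compatible assms(2) R_refl R_trans[OF ac cb(3)]
    by (intro Min_eqI) auto
  have sub: "s \<subseteq> ?s" using cb(4) R_trans[OF ac] by blast
  have int: "s = ?s \<inter> {c..}"
  proof (intro equalityI subsetI)
    fix k assume "k \<in> s"
    then show "k \<in> ?s \<inter> {c..}" using cb(4) R_trans[OF ac] R_compatible by auto
  next
    fix k assume k: "k \<in> ?s \<inter> {c..}"
    then have "(c, k) \<in> R \<or> (k, c) \<in> R" using predecessors_linear[OF cb(3)] by blast
    then have "(c, k) \<in> R"
    proof
      assume "(k, c) \<in> R"
      then have "k = c" using k R_compatible[of k c] by simp
      then show ?thesis using R_refl[OF cb(1)] by simp
    qed
    then show "k \<in> s" using k cb(4) by blast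
  qed
  then have "s = ?s \<inter> {Min s..}" unfolding cb(5) .
  with that[OF seg mn sub] show ?thesis by metis
qed

end

section \<open>Norms of branches and segments\<close>

definition ivl :: "nat set \<Rightarrow> bool" where
  "ivl E \<longleftrightarrow> (\<forall>a\<in>E. \<forall>b\<in>E. {a..b} \<subseteq> E)"

lemma ivl_UNIV: "ivl UNIV" and ivl_atLeast: "ivl {a..}" and ivl_atLeastAtMost: "ivl {a..b}"
  by (auto simp: ivl_def)

lemma ivl_Int: "ivl E \<Longrightarrow> ivl F \<Longrightarrow> ivl (E \<inter> F)"
  unfolding ivl_def by blast

text \<open>The sum of absolute values serves as a crude upper bound that shows all suprema below to
  be taken over bounded sets.\<close>

definition l1 :: "(nat \<Rightarrow> real) \<Rightarrow> real" where
  "l1 x = (\<Sum>i | x i \<noteq> 0. \<bar>x i\<bar>)"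

lemma l1_nonneg: "0 \<le> l1 x"
  by (simp add: l1_def sum_nonneg)

lemma l1_eq: "finite S \<Longrightarrow> (\<And>i. x i \<noteq> 0 \<Longrightarrow> i \<in> S) \<Longrightarrow> l1 x = (\<Sum>i\<in>S. \<bar>x i\<bar>)"
  unfolding l1_def by (rule sum.mono_neutral_left) auto

lemma l1_restrict_le:
  assumes "x \<in> c00"
  shows "l1 (restrict_to E x) \<le> l1 x"
proof -
  have "l1 (restrict_to E x) = (\<Sum>i | x i \<noteq> 0. \<bar>restrict_to E x i\<bar>)"
    using c00_finite[OF assms] by (intro l1_eq) (auto simp: restrict_to_def split: if_splits)
  also have "\<dots> \<le> l1 x" unfolding l1_def by (intro sum_mono) (simp add: restrict_to_def)
  finally show ?thesis .
qed

text \<open>Coefficients in \<open>W\<close> are rational. Rounding towards zero keeps the sum of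
  their squares at most 1.\<close>

lemma rational_below:
  fixes c \<delta> :: real
  assumes "\<delta> > 0"
  obtains r where "r \<in> \<rat>" "\<bar>r\<bar> \<le> \<bar>c\<bar>" "\<bar>r - c\<bar> \<le> \<delta>"
proof (cases "c = 0")
  case True
  then show ?thesis using that[of 0] assms by simp
next
  case False
  define d where "d = min \<delta> \<bar>c\<bar>"
  have d: "0 < d" "d \<le> \<delta>" "d \<le> \<bar>c\<bar>" using False assms by (auto simp: d_def)
  show ?thesis
  proof (cases "c > 0")
    case True
    obtain r where "r \<in> \<rat>" "c - d < r" "r < c"
      using Rats_dense_in_real[of "c - d" c] d by auto
    then show ?thesis using that[of r] True d by auto
  next
    case False
    obtain r where "r \<in> \<rat>" "c < r" "r < c + d"
      using Rats_dense_in_real[of c "c + d"] d by auto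
    then show ?thesis using that[of r] False d by auto
  qed
qed

context jt_tree
begin

abbreviation bn :: "nat set \<Rightarrow> (nat \<Rightarrow> real) \<Rightarrow> real" where
  "bn \<equiv> branch_norm m n \<gamma>"

abbreviation sn :: "nat set \<Rightarrow> (nat \<Rightarrow> real) \<Rightarrow> real" where
  "sn \<equiv> segment_norm m n \<gamma> D R"

abbreviation ph :: "nat set \<Rightarrow> nat \<Rightarrow> nat \<Rightarrow> real" where
  "ph \<equiv> phi m n \<gamma>"

text \<open>By duality in \<open>\<ell>\<^sub>2\<close>, the branch norm is the supremum of these
  values over \<open>N\<close> and over restrictions of \<open>x\<close> to intervals;
  \<open>branch_norm_le\<close> and \<open>phn_le_branch_norm\<close> are the two halves.\<close>

definition phn :: "nat set \<Rightarrow> nat \<Rightarrow> (nat \<Rightarrow> real) \<Rightarrow> real" where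
  "phn \<sigma> N x = L2_set (\<lambda>k. pairing (ph \<sigma> k) x) {1..N}"

lemma phn_nonneg: "0 \<le> phn \<sigma> N x"
  by (simp add: phn_def L2_set_nonneg)

lemma phn_add:
  assumes "x \<in> c00" "y \<in> c00"
  shows "phn \<sigma> N (\<lambda>i. x i + y i) \<le> phn \<sigma> N x + phn \<sigma> N y"
  unfolding phn_def pairing_add[OF assms] by (rule L2_set_triangle_ineq)

lemma phn_scale: "phn \<sigma> N (\<lambda>i. c * x i) = \<bar>c\<bar> * phn \<sigma> N x"
proof -
  have "L2_set (\<lambda>k. c * pairing (ph \<sigma> k) x) {1..N} = sqrt (c\<^sup>2 * (\<Sum>k = 1..N. (pairing (ph \<sigma> k) x)\<^sup>2))"
    by (simp add: L2_set_def power_mult_distrib sum_distrib_left)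
  then show ?thesis
    by (simp add: phn_def pairing_scale real_sqrt_mult) (simp add: L2_set_def)
qed

text \<open>The sets on one branch are successive, so at most one functional is nonzero at
  \<open>l\<close>.\<close>

lemma sum_phi_le_1:
  assumes "infinite \<sigma>"
  shows "(\<Sum>k = 1..N. ph \<sigma> k l) \<le> 1"
proof (cases "\<exists>k\<in>{1..N}. l \<in> s_set n \<gamma> \<sigma> k")
  case True
  then obtain k where k: "k \<in> {1..N}" "l \<in> s_set n \<gamma> \<sigma> k" by blast
  have "ph \<sigma> j l = 0" if "j \<in> {1..N} - {k}" for j
  proof (rule ccontr)
    assume "ph \<sigma> j l \<noteq> 0"
    then have l: "l \<in> s_set n \<gamma> \<sigma> j" by (rule phi_support)
    have "j < k \<or> k < j" using that by auto
    then show False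
      using s_set_successive[OF assms, of j k l n \<gamma> l] s_set_successive[OF assms, of k j l n \<gamma> l]
        l k that by auto
  qed
  then have "(\<Sum>k = 1..N. ph \<sigma> k l) = (\<Sum>k\<in>{k}. ph \<sigma> k l)"
    using k by (intro sum.mono_neutral_right) auto
  then show ?thesis by (simp add: phi_bounds)
next
  case False
  then have "ph \<sigma> k l = 0" if "k \<in> {1..N}" for k using phi_support that by blast
  then show ?thesis by simp
qed

lemma phn_le_l1:
  assumes "infinite \<sigma>" "x \<in> c00"
  shows "phn \<sigma> N x \<le> l1 x"
proof -
  let ?S = "{i. x i \<noteq> 0}"
  have "phn \<sigma> N x \<le> (\<Sum>k = 1..N. \<bar>pairing (ph \<sigma> k) x\<bar>)"
    unfolding phn_def by (rule L2_set_le_sum_abs)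
  also have "\<dots> \<le> (\<Sum>k = 1..N. \<Sum>i\<in>?S. ph \<sigma> k i * \<bar>x i\<bar>)"
    unfolding pairing_def
    by (intro sum_mono order_trans[OF sum_abs]) (simp add: abs_mult phi_bounds)
  also have "\<dots> = (\<Sum>i\<in>?S. (\<Sum>k = 1..N. ph \<sigma> k i) * \<bar>x i\<bar>)"
    by (subst sum.swap) (simp add: sum_distrib_right)
  also have "\<dots> \<le> (\<Sum>i\<in>?S. 1 * \<bar>x i\<bar>)"
    by (intro sum_mono mult_right_mono sum_phi_le_1 assms(1)) auto
  finally show ?thesis by (simp add: l1_def)
qed

lemma pairing_W:
  assumes "x \<in> c00"
  shows "pairing (restrict_to E (\<lambda>l. \<Sum>i = 1..N. c i * ph \<sigma> i l)) x =
    (\<Sum>i = 1..N. c i * pairing (ph \<sigma> i) (restrict_to E x))"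
proof -
  let ?y = "restrict_to E x"
  have "pairing (\<lambda>l. \<Sum>i = 1..N. c i * ph \<sigma> i l) ?y = (\<Sum>i = 1..N. c i * pairing (ph \<sigma> i) ?y)"
    unfolding pairing_def sum_distrib_right sum_distrib_left
    by (subst sum.swap) (simp add: mult.assoc)
  then show ?thesis by (simp add: pairing_restrict[OF assms])
qed

lemma pairing_W_le:
  assumes "x \<in> c00" "f \<in> W m n \<gamma> \<sigma>"
  obtains E N where "ivl E" "pairing f x \<le> phn \<sigma> N (restrict_to E x)"
proof -
  from assms(2) obtain N c E where f: "f = restrict_to E (\<lambda>l. \<Sum>i = 1..N. c i * ph \<sigma> i l)"
    "(\<Sum>i = 1..N. (c i)\<^sup>2) \<le> 1" "\<forall>a\<in>E. \<forall>b\<in>E. {a..b} \<subseteq> E"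
    unfolding W_def by blast
  let ?a = "\<lambda>i. pairing (ph \<sigma> i) (restrict_to E x)"
  have c: "L2_set c {1..N} \<le> 1" using f(2) by (simp add: L2_set_def)
  have "pairing f x = (\<Sum>i = 1..N. c i * ?a i)" unfolding f(1) by (rule pairing_W[OF assms(1)])
  also have "\<dots> \<le> (\<Sum>i = 1..N. \<bar>c i\<bar> * \<bar>?a i\<bar>)"
    by (intro sum_mono) (metis abs_ge_self abs_mult)
  also have "\<dots> \<le> L2_set c {1..N} * L2_set ?a {1..N}" by (rule L2_set_mult_ineq)
  also have "\<dots> \<le> 1 * L2_set ?a {1..N}" by (rule mult_right_mono[OF c L2_set_nonneg])
  finally show ?thesis using that[of E N] f(3) by (simp add: phn_def ivl_def)
qed

lemma zero_in_W: "(\<lambda>_. 0) \<in> W m n \<gamma> \<sigma>"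
  unfolding W_def
  by (auto simp: restrict_to_def intro!: exI[of _ 1] exI[of _ "\<lambda>_. 0"] exI[of _ "{}"])

lemma branch_norm_bdd:
  assumes "infinite \<sigma>" "x \<in> c00"
  shows "bdd_above ((\<lambda>f. pairing f x) ` W m n \<gamma> \<sigma>)"
proof (rule bdd_aboveI2)
  fix f assume "f \<in> W m n \<gamma> \<sigma>"
  then obtain E N where "ivl E" "pairing f x \<le> phn \<sigma> N (restrict_to E x)"
    by (rule pairing_W_le[OF assms(2)])
  then show "pairing f x \<le> l1 x"
    using phn_le_l1[OF assms(1) c00_restrict[OF assms(2), of E], of N] l1_restrict_le[OF assms(2), of E]
    by linarith
qed

lemma branch_norm_le:
  assumes "x \<in> c00" "\<And>E N. ivl E \<Longrightarrow> phn \<sigma> N (restrict_to E x) \<le> K"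
  shows "bn \<sigma> x \<le> K"
  unfolding branch_norm_def
proof (rule cSUP_least)
  show "W m n \<gamma> \<sigma> \<noteq> {}" using zero_in_W by blast
  fix f assume "f \<in> W m n \<gamma> \<sigma>"
  then obtain E N where "ivl E" "pairing f x \<le> phn \<sigma> N (restrict_to E x)"
    by (rule pairing_W_le[OF assms(1)])
  then show "pairing f x \<le> K" using assms(2)[of E N] by linarith
qed

lemma branch_norm_nonneg:
  assumes "infinite \<sigma>" "x \<in> c00"
  shows "0 \<le> bn \<sigma> x"
  using cSUP_upper[OF zero_in_W branch_norm_bdd[OF assms]]
  by (simp add: branch_norm_def pairing_def)

text \<open>Equality in the Cauchy-Schwarz inequality is attained at the coefficients
  \<open>a i / v\<close>. Replacing them by rationals rounded towards zero stays inside
  \<open>W\<close> and loses at most \<open>e\<close>.\<close>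

lemma phn_le_branch_norm:
  assumes "infinite \<sigma>" "x \<in> c00" "ivl E"
  shows "phn \<sigma> N (restrict_to E x) \<le> bn \<sigma> x"
proof (cases "phn \<sigma> N (restrict_to E x) = 0 \<or> N = 0")
  case True
  then have "phn \<sigma> N (restrict_to E x) = 0" by (auto simp: phn_def)
  then show ?thesis using branch_norm_nonneg[OF assms(1,2)] by simp
next
  case False
  define a where "a i = pairing (ph \<sigma> i) (restrict_to E x)" for i
  define v where "v = phn \<sigma> N (restrict_to E x)"
  have v: "v > 0" unfolding v_def using False phn_nonneg[of \<sigma> N "restrict_to E x"] by argo
  have v2: "(\<Sum>i = 1..N. (a i)\<^sup>2) = v\<^sup>2"
    by (simp add: v_def phn_def L2_set_def a_def sum_nonneg)
  \<comment> \<open>The added 1 keeps the divisor in \<delta> positive.\<close>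
  define C where "C = (\<Sum>i = 1..N. \<bar>a i\<bar>) + 1"
  have C: "C > 0" by (simp add: C_def add_nonneg_pos sum_nonneg)
  have "v \<le> bn \<sigma> x + e" if e: "e > 0" for e
  proof -
    define \<delta> where "\<delta> = e / C"
    have \<delta>: "\<delta> > 0" using e C by (simp add: \<delta>_def)
    have "\<exists>r. r \<in> \<rat> \<and> \<bar>r\<bar> \<le> \<bar>a i / v\<bar> \<and> \<bar>r - a i / v\<bar> \<le> \<delta>" for i
      using rational_below[OF \<delta>, of "a i / v"] by metis
    then obtain r where r: "\<And>i. r i \<in> \<rat>" "\<And>i. \<bar>r i\<bar> \<le> \<bar>a i / v\<bar>" "\<And>i. \<bar>r i - a i / v\<bar> \<le> \<delta>"
      by metis
    have "(\<Sum>i = 1..N. (r i)\<^sup>2) \<le> (\<Sum>i = 1..N. (a i / v)\<^sup>2)"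
      using r(2) unfolding abs_le_square_iff by (rule sum_mono)
    also have "\<dots> = 1" using v v2 by (simp add: power_divide flip: sum_divide_distrib)
    finally have "restrict_to E (\<lambda>l. \<Sum>i = 1..N. r i * ph \<sigma> i l) \<in> W m n \<gamma> \<sigma>"
      unfolding W_def using r(1) assms(3) False
      by (intro CollectI exI[of _ N] exI[of _ r] exI[of _ E]) (auto simp: ivl_def)
    then have "pairing (restrict_to E (\<lambda>l. \<Sum>i = 1..N. r i * ph \<sigma> i l)) x \<le> bn \<sigma> x"
      unfolding branch_norm_def by (rule cSUP_upper[OF _ branch_norm_bdd[OF assms(1,2)]])
    then have "(\<Sum>i = 1..N. r i * a i) \<le> bn \<sigma> x"
      unfolding pairing_W[OF assms(2)] a_def .
    moreover have "v - e \<le> (\<Sum>i = 1..N. r i * a i)"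
    proof -
      have "v = (\<Sum>i = 1..N. a i / v * a i)"
        using v v2 by (simp add: power2_eq_square flip: sum_divide_distrib)
      also have "\<dots> \<le> (\<Sum>i = 1..N. r i * a i + \<delta> * \<bar>a i\<bar>)"
      proof (rule sum_mono)
        fix i
        have "(a i / v - r i) * a i \<le> \<bar>a i / v - r i\<bar> * \<bar>a i\<bar>" by (metis abs_ge_self abs_mult)
        also have "\<dots> \<le> \<delta> * \<bar>a i\<bar>"
          using r(3)[of i] by (intro mult_right_mono) (auto simp: abs_minus_commute)
        finally show "a i / v * a i \<le> r i * a i + \<delta> * \<bar>a i\<bar>" by (simp add: algebra_simps)
      qed
      also have "\<dots> = (\<Sum>i = 1..N. r i * a i) + \<delta> * (C - 1)"
        by (simp add: sum.distrib sum_distrib_left C_def)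
      also have "\<delta> * (C - 1) \<le> e" using \<delta> C by (simp add: \<delta>_def field_simps)
      finally show ?thesis by simp
    qed
    ultimately show ?thesis by linarith
  qed
  then show ?thesis unfolding v_def[symmetric] by (rule field_le_epsilon)
qed

lemma branch_norm_add:
  assumes "infinite \<sigma>" "x \<in> c00" "y \<in> c00"
  shows "bn \<sigma> (\<lambda>i. x i + y i) \<le> bn \<sigma> x + bn \<sigma> y"
proof (rule branch_norm_le[OF c00_add[OF assms(2,3)]])
  fix E N assume E: "ivl E"
  have "restrict_to E (\<lambda>i. x i + y i) = (\<lambda>i. restrict_to E x i + restrict_to E y i)"
    by (auto simp: restrict_to_def)
  then have "phn \<sigma> N (restrict_to E (\<lambda>i. x i + y i)) \<le>
      phn \<sigma> N (restrict_to E x) + phn \<sigma> N (restrict_to E y)"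
    using phn_add[OF c00_restrict[OF assms(2)] c00_restrict[OF assms(3)]] by simp
  then show "phn \<sigma> N (restrict_to E (\<lambda>i. x i + y i)) \<le> bn \<sigma> x + bn \<sigma> y"
    using phn_le_branch_norm[OF assms(1,2) E, of N] phn_le_branch_norm[OF assms(1,3) E, of N]
    by linarith
qed

lemma branch_norm_scale_le:
  assumes "infinite \<sigma>" "x \<in> c00"
  shows "bn \<sigma> (\<lambda>i. c * x i) \<le> \<bar>c\<bar> * bn \<sigma> x"
proof (rule branch_norm_le[OF c00_scale[OF assms(2)]])
  fix E N assume E: "ivl E"
  have "restrict_to E (\<lambda>i. c * x i) = (\<lambda>i. c * restrict_to E x i)"
    by (auto simp: restrict_to_def)
  then have "phn \<sigma> N (restrict_to E (\<lambda>i. c * x i)) = \<bar>c\<bar> * phn \<sigma> N (restrict_to E x)"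
    by (simp add: phn_scale)
  then show "phn \<sigma> N (restrict_to E (\<lambda>i. c * x i)) \<le> \<bar>c\<bar> * bn \<sigma> x"
    using phn_le_branch_norm[OF assms E, of N] by (simp add: mult_left_mono)
qed

lemma branch_norm_restrict:
  assumes "infinite \<sigma>" "x \<in> c00" "ivl F"
  shows "bn \<sigma> (restrict_to F x) \<le> bn \<sigma> x"
  by (rule branch_norm_le[OF c00_restrict[OF assms(2)]])
    (simp add: restrict_restrict phn_le_branch_norm[OF assms(1,2)] ivl_Int assms(3))

lemma branch_norm_le_l1:
  assumes "infinite \<sigma>" "x \<in> c00"
  shows "bn \<sigma> x \<le> l1 x"
proof (rule branch_norm_le[OF assms(2)])
  fix E N assume "ivl E"
  show "phn \<sigma> N (restrict_to E x) \<le> l1 x"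
    using phn_le_l1[OF assms(1) c00_restrict[OF assms(2), of E], of N]
      l1_restrict_le[OF assms(2), of E] by linarith
qed

section \<open>Norms on segments and their independence of the chosen branch\<close>

lemma pairing_W_subset:
  assumes "\<And>k i. 1 \<le> k \<Longrightarrow> x i \<noteq> 0 \<Longrightarrow> ph \<sigma> k i = ph \<sigma>' k i" "x \<in> c00"
  shows "(\<lambda>f. pairing f x) ` W m n \<gamma> \<sigma> \<subseteq> (\<lambda>f. pairing f x) ` W m n \<gamma> \<sigma>'"
proof (rule image_subsetI)
  fix f assume "f \<in> W m n \<gamma> \<sigma>"
  then obtain N c E where f: "f = restrict_to E (\<lambda>l. \<Sum>i = 1..N. c i * ph \<sigma> i l)"
    and W: "N \<ge> 1" "\<forall>i\<in>{1..N}. c i \<in> \<rat>" "(\<Sum>i = 1..N. (c i)\<^sup>2) \<le> 1" "\<forall>a\<in>E. \<forall>b\<in>E. {a..b} \<subseteq> E"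
    unfolding W_def by blast
  have eq: "pairing (ph \<sigma> k) (restrict_to E x) = pairing (ph \<sigma>' k) (restrict_to E x)"
    if "1 \<le> k" for k
    using assms(1)[OF that] by (intro pairing_cong) (auto simp: restrict_to_def split: if_splits)
  have "pairing f x = pairing (restrict_to E (\<lambda>l. \<Sum>i = 1..N. c i * ph \<sigma>' i l)) x"
    unfolding f pairing_W[OF assms(2)] by (rule sum.cong) (auto simp: eq)
  moreover have "restrict_to E (\<lambda>l. \<Sum>i = 1..N. c i * ph \<sigma>' i l) \<in> W m n \<gamma> \<sigma>'"
    unfolding W_def using W by blast
  ultimately show "pairing f x \<in> (\<lambda>f. pairing f x) ` W m n \<gamma> \<sigma>'" by (rule image_eqI)
qed

lemma branch_norm_cong:
  assumes "\<And>k i. 1 \<le> k \<Longrightarrow> x i \<noteq> 0 \<Longrightarrow> ph \<sigma> k i = ph \<sigma>' k i" "x \<in> c00"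
  shows "bn \<sigma> x = bn \<sigma>' x"
proof -
  have "(\<lambda>f. pairing f x) ` W m n \<gamma> \<sigma> = (\<lambda>f. pairing f x) ` W m n \<gamma> \<sigma>'"
    by (rule equalityI; rule pairing_W_subset[OF _ assms(2)]) (use assms(1) in \<open>simp_all\<close>)
  then show ?thesis unfolding branch_norm_def by simp
qed

text \<open>The branch picked by \<open>SOME\<close> may be replaced by any convenient one, since
  the functionals of both agree at every point of \<open>s\<close>.\<close>

lemma segment_norm_eq:
  assumes "\<sigma> \<in> branches D R" "s \<subseteq> \<sigma>" "x \<in> c00"
  shows "sn s x = bn \<sigma> (restrict_to s x)"
proof -
  define \<tau> where "\<tau> = (SOME \<tau>. \<tau> \<in> branches D R \<and> s \<subseteq> \<tau>)"
  have \<tau>: "\<tau> \<in> branches D R" "s \<subseteq> \<tau>"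
    using someI[of "\<lambda>\<tau>. \<tau> \<in> branches D R \<and> s \<subseteq> \<tau>" \<sigma>] assms(1,2) unfolding \<tau>_def by blast+
  have "bn \<tau> (restrict_to s x) = bn \<sigma> (restrict_to s x)"
  proof (rule branch_norm_cong[OF _ c00_restrict[OF assms(3)]])
    fix k i :: nat assume k: "1 \<le> k" and "restrict_to s x i \<noteq> 0"
    then have "i \<in> s" by (simp add: restrict_to_def split: if_splits)
    then show "ph \<tau> k i = ph \<sigma> k i"
      using phi_branches_agree[OF \<tau>(1) assms(1) _ _ k] \<tau>(2) assms(2) by blast
  qed
  then show ?thesis unfolding segment_norm_def \<tau>_def .
qed

lemma tchain_norm_obtain:
  assumes "tchain D R s"
  obtains \<sigma> where "\<sigma> \<in> branches D R" "infinite \<sigma>" "s \<subseteq> \<sigma>"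
  using tchain_extend[OF assms] branch_infinite by blast

text \<open>This and the following facts are stated for chains, so that they also cover the empty
  set, which arises when a segment is intersected with a subtree and is not itself a
  segment.\<close>

lemma segment_norm_nonneg:
  assumes "tchain D R s" "x \<in> c00"
  shows "0 \<le> sn s x"
proof -
  obtain \<sigma> where \<sigma>: "\<sigma> \<in> branches D R" "infinite \<sigma>" "s \<subseteq> \<sigma>"
    by (rule tchain_norm_obtain[OF assms(1)])
  show ?thesis unfolding segment_norm_eq[OF \<sigma>(1,3) assms(2)]
    by (rule branch_norm_nonneg[OF \<sigma>(2) c00_restrict[OF assms(2)]])
qed

lemma segment_norm_add:
  assumes "tchain D R s" "x \<in> c00" "y \<in> c00"
  shows "sn s (\<lambda>i. x i + y i) \<le> sn s x + sn s y"
proof -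
  obtain \<sigma> where \<sigma>: "\<sigma> \<in> branches D R" "infinite \<sigma>" "s \<subseteq> \<sigma>"
    by (rule tchain_norm_obtain[OF assms(1)])
  have "restrict_to s (\<lambda>i. x i + y i) = (\<lambda>i. restrict_to s x i + restrict_to s y i)"
    by (auto simp: restrict_to_def)
  then show ?thesis
    unfolding segment_norm_eq[OF \<sigma>(1,3) assms(2)] segment_norm_eq[OF \<sigma>(1,3) assms(3)]
      segment_norm_eq[OF \<sigma>(1,3) c00_add[OF assms(2,3)]]
    using branch_norm_add[OF \<sigma>(2) c00_restrict[OF assms(2)] c00_restrict[OF assms(3)]] by simp
qed

lemma segment_norm_scale_le:
  assumes "tchain D R s" "x \<in> c00"
  shows "sn s (\<lambda>i. c * x i) \<le> \<bar>c\<bar> * sn s x"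
proof -
  obtain \<sigma> where \<sigma>: "\<sigma> \<in> branches D R" "infinite \<sigma>" "s \<subseteq> \<sigma>"
    by (rule tchain_norm_obtain[OF assms(1)])
  have "restrict_to s (\<lambda>i. c * x i) = (\<lambda>i. c * restrict_to s x i)"
    by (auto simp: restrict_to_def)
  then show ?thesis
    unfolding segment_norm_eq[OF \<sigma>(1,3) assms(2)] segment_norm_eq[OF \<sigma>(1,3) c00_scale[OF assms(2)]]
    using branch_norm_scale_le[OF \<sigma>(2) c00_restrict[OF assms(2)]] by simp
qed

lemma segment_norm_zero:
  assumes "tchain D R s" "\<And>i. i \<in> s \<Longrightarrow> x i = 0" "x \<in> c00"
  shows "sn s x = 0"
proof -
  obtain \<sigma> where \<sigma>: "\<sigma> \<in> branches D R" "infinite \<sigma>" "s \<subseteq> \<sigma>"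
    by (rule tchain_norm_obtain[OF assms(1)])
  have "bn \<sigma> (\<lambda>_. 0) = 0"
    using branch_norm_le_l1[OF \<sigma>(2) c00_zero] branch_norm_nonneg[OF \<sigma>(2) c00_zero]
    by (simp add: l1_def)
  then show ?thesis
    unfolding segment_norm_eq[OF \<sigma>(1,3) assms(3)] using restrict_zeroI[of s x] assms(2) by simp
qed

lemma segment_norm_sum:
  assumes "tchain D R s" "\<And>j. j \<in> J \<Longrightarrow> x j \<in> c00"
  shows "sn s (\<lambda>i. \<Sum>j\<in>J. x j i) \<le> (\<Sum>j\<in>J. sn s (x j))"
proof (cases "finite J")
  case True
  then show ?thesis using assms(2)
  proof (induction J rule: finite_induct)
    case empty
    show ?case by (simp add: segment_norm_zero[OF assms(1) _ c00_zero])
  next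
    case (insert j J)
    have J: "\<And>i. i \<in> J \<Longrightarrow> x i \<in> c00" "x j \<in> c00" using insert.prems by auto
    have "sn s (\<lambda>i. x j i + (\<Sum>j\<in>J. x j i)) \<le> sn s (x j) + sn s (\<lambda>i. \<Sum>j\<in>J. x j i)"
      by (rule segment_norm_add[OF assms(1) J(2) c00_sum[OF J(1)]])
    then show ?case using insert.IH[OF J(1)] insert.hyps by simp
  qed
qed (simp add: segment_norm_zero[OF assms(1) _ c00_zero])

lemma segment_norm_le_l1:
  assumes "tchain D R s" "x \<in> c00"
  shows "sn s x \<le> l1 (restrict_to s x)"
proof -
  obtain \<sigma> where \<sigma>: "\<sigma> \<in> branches D R" "infinite \<sigma>" "s \<subseteq> \<sigma>"
    by (rule tchain_norm_obtain[OF assms(1)])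
  show ?thesis unfolding segment_norm_eq[OF \<sigma>(1,3) assms(2)]
    by (rule branch_norm_le_l1[OF \<sigma>(2) c00_restrict[OF assms(2)]])
qed

lemma segment_norm_cong:
  assumes "tchain D R s" "x \<in> c00" "y \<in> c00" "\<And>i. i \<in> s \<Longrightarrow> x i = y i"
  shows "sn s x = sn s y"
proof -
  have "restrict_to s x = restrict_to s y" using assms(4) by (auto simp: restrict_to_def)
  then show ?thesis by (simp add: segment_norm_def)
qed

lemma segment_norm_restrict:
  assumes "tchain D R s" "ivl E" "x \<in> c00" "s' \<subseteq> s" "\<And>i. x i \<noteq> 0 \<Longrightarrow> i \<in> s' \<longleftrightarrow> i \<in> s \<and> i \<in> E"
  shows "sn s' x \<le> sn s x"
proof -
  obtain \<sigma> where \<sigma>: "\<sigma> \<in> branches D R" "infinite \<sigma>" "s \<subseteq> \<sigma>"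
    by (rule tchain_norm_obtain[OF assms(1)])
  have "restrict_to s' x = restrict_to E (restrict_to s x)"
    using assms(5) by (auto simp: restrict_to_def fun_eq_iff)
  then show ?thesis
    unfolding segment_norm_eq[OF \<sigma>(1,3) assms(3)]
      segment_norm_eq[OF \<sigma>(1) subset_trans[OF assms(4) \<sigma>(3)] assms(3)]
    using branch_norm_restrict[OF \<sigma>(2) c00_restrict[OF assms(3)] assms(2)] by simp
qed

lemma segment_norm_split:
  assumes "tchain D R s" "x \<in> c00" "s = s1 \<union> s2" "s1 \<inter> s2 = {}"
  shows "sn s x \<le> sn s1 x + sn s2 x"
proof -
  obtain \<sigma> where \<sigma>: "\<sigma> \<in> branches D R" "infinite \<sigma>" "s \<subseteq> \<sigma>"
    by (rule tchain_norm_obtain[OF assms(1)])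
  have eq: "restrict_to s x = (\<lambda>i. restrict_to s1 x i + restrict_to s2 x i)"
    using assms(3,4) by (auto simp: restrict_to_def fun_eq_iff)
  have s12: "s1 \<subseteq> \<sigma>" "s2 \<subseteq> \<sigma>" using \<sigma>(3) assms(3) by auto
  show ?thesis
    unfolding segment_norm_eq[OF \<sigma>(1,3) assms(2)] segment_norm_eq[OF \<sigma>(1) s12(1) assms(2)]
      segment_norm_eq[OF \<sigma>(1) s12(2) assms(2)] eq
    by (rule branch_norm_add[OF \<sigma>(2) c00_restrict[OF assms(2)] c00_restrict[OF assms(2)]])
qed

section \<open>The norm of the space\<close>

abbreviation JN :: "(nat \<Rightarrow> real) \<Rightarrow> real" where
  "JN \<equiv> JT_norm m n \<gamma> D R"

text \<open>These are the families over which \<open>JT_norm\<close> takes its second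
  supremum.\<close>

definition adm :: "nat set set \<Rightarrow> bool" where
  "adm A \<longleftrightarrow> finite A \<and> A \<subseteq> segments D R \<and> disjoint A \<and> Min ` A \<in> schreier 1"

lemma inj_on_Min:
  assumes "A \<subseteq> segments D R" "disjoint A"
  shows "inj_on Min A"
proof (rule inj_onI, rule ccontr)
  fix s t assume st: "s \<in> A" "t \<in> A" "Min s = Min t" "s \<noteq> t"
  then have "s \<inter> t = {}" using assms(2) by (meson disjointD)
  then show False using st assms(1) segment_Min by (metis disjoint_iff subsetD)
qed

lemma Min_segment_pos: "s \<in> segments D R \<Longrightarrow> 1 \<le> Min s"
  using segment_Min segment_subset_D D_nonzero by blast

lemma admI:
  assumes "finite A" "A \<subseteq> segments D R" "disjoint A" "\<And>s. s \<in> A \<Longrightarrow> card A \<le> Min s"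
  shows "adm A"
proof (cases "A = {}")
  case False
  have "card (Min ` A) \<le> card A" by (rule card_image_le[OF assms(1)])
  moreover have "card A \<le> Min (Min ` A)" using False assms(1,4) by simp
  ultimately have "card (Min ` A) \<le> Min (Min ` A)" by (rule order_trans)
  moreover have "Min ` A \<subseteq> {1..}" using assms(2) Min_segment_pos by auto
  ultimately show ?thesis using assms(1-3) False by (simp add: adm_def del: Min_ge_iff)
qed (simp add: adm_def)

lemma adm_card:
  assumes "adm A" "s \<in> A"
  shows "card A \<le> Min s"
proof -
  have "card (Min ` A) \<le> Min (Min ` A)" "finite (Min ` A)"
    using assms by (auto simp: adm_def simp del: Min_ge_iff)
  moreover have "card (Min ` A) = card A"
    using assms(1) by (intro card_image inj_on_Min) (auto simp: adm_def)
  ultimately show ?thesis using assms(2) by (metis Min_le image_eqI order_trans)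
qed

text \<open>Disjoint segments have distinct minima, so each weight sits at its own coordinate; the
  set of minima is in the Schreier family, so the supremum is attained there and the norm becomes a
  plain square sum.\<close>

lemma S2_norm_adm:
  assumes "adm A"
  shows "S2_norm (\<lambda>l. \<Sum>s\<in>A. w s * (if l = Min s then 1 else 0)) = L2_set w A"
proof -
  let ?g = "\<lambda>l. \<Sum>s\<in>A. w s * (if l = Min s then 1 else 0)"
  have A: "finite A" "A \<subseteq> segments D R" "disjoint A" "Min ` A \<in> schreier 1"
    using assms by (auto simp: adm_def)
  note inj = inj_on_Min[OF A(2,3)]
  have gM: "?g (Min s) = w s" if "s \<in> A" for s
  proof -
    have "?g (Min s) = (\<Sum>t\<in>{s}. w t * (if Min s = Min t then 1 else 0))"
      using that A(1) inj by (intro sum.mono_neutral_right) (auto simp: inj_on_def)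
    then show ?thesis by simp
  qed
  have g0: "?g l = 0" if "l \<notin> Min ` A" for l
    using that by (intro sum.neutral) auto
  have top: "(\<Sum>i\<in>Min ` A. (?g i)\<^sup>2) = (\<Sum>s\<in>A. (w s)\<^sup>2)"
    using gM by (subst sum.reindex[OF inj]) simp
  have le: "sqrt (\<Sum>i\<in>F. (?g i)\<^sup>2) \<le> L2_set w A" if "F \<in> schreier 1" for F
  proof -
    have fin: "finite F" using that schreier_finite by blast
    have "(\<Sum>i\<in>F. (?g i)\<^sup>2) = (\<Sum>i\<in>F \<inter> Min ` A. (?g i)\<^sup>2)"
    proof (rule sum.mono_neutral_right[OF fin])
      show "\<forall>i\<in>F - F \<inter> Min ` A. (?g i)\<^sup>2 = 0" using g0 by auto
    qed auto
    also have "\<dots> \<le> (\<Sum>i\<in>Min ` A. (?g i)\<^sup>2)"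
      using A(1) by (intro sum_mono2) auto
    finally show ?thesis unfolding L2_set_def top by simp
  qed
  show ?thesis
    unfolding S2_norm_def
  proof (rule cSup_eq_maximum)
    show "L2_set w A \<in> (\<lambda>F. sqrt (\<Sum>i\<in>F. (?g i)\<^sup>2)) ` schreier 1"
      using A(4) top by (auto simp: L2_set_def intro!: image_eqI[of _ _ "Min ` A"])
  qed (use le in auto)
qed

lemma sum_l1_restrict:
  assumes "finite A" "disjoint A" "x \<in> c00"
  shows "(\<Sum>s\<in>A. l1 (restrict_to s x)) \<le> l1 x"
proof -
  let ?S = "{i. x i \<noteq> 0}"
  have fin: "finite ?S" by (rule c00_finite[OF assms(3)])
  have "(\<Sum>s\<in>A. l1 (restrict_to s x)) = (\<Sum>s\<in>A. \<Sum>i\<in>?S. \<bar>restrict_to s x i\<bar>)"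
    using fin by (intro sum.cong l1_eq) (auto simp: restrict_to_def split: if_splits)
  also have "\<dots> = (\<Sum>i\<in>?S. \<Sum>s\<in>A. \<bar>restrict_to s x i\<bar>)" by (rule sum.swap)
  also have "\<dots> \<le> (\<Sum>i\<in>?S. \<bar>x i\<bar>)"
  proof (rule sum_mono)
    fix i
    show "(\<Sum>s\<in>A. \<bar>restrict_to s x i\<bar>) \<le> \<bar>x i\<bar>"
    proof (cases "\<exists>s\<in>A. i \<in> s")
      case True
      then obtain s where s: "s \<in> A" "i \<in> s" by blast
      have z: "i \<notin> t" if "t \<in> A - {s}" for t
        using disjointD[OF assms(2) _ s(1), of t] that s by blast
      have "(\<Sum>s\<in>A. \<bar>restrict_to s x i\<bar>) = (\<Sum>s\<in>{s}. \<bar>restrict_to s x i\<bar>)"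
      proof (rule sum.mono_neutral_right[OF assms(1)])
        show "\<forall>t\<in>A - {s}. \<bar>restrict_to t x i\<bar> = 0"
          using z by (simp add: restrict_to_def)
      qed (use s in auto)
      then show ?thesis using s by (simp add: restrict_to_def)
    next
      case False
      then have "(\<Sum>s\<in>A. \<bar>restrict_to s x i\<bar>) = 0" by (intro sum.neutral) (auto simp: restrict_to_def)
      then show ?thesis by simp
    qed
  qed
  finally show ?thesis by (simp add: l1_def)
qed

lemma JN_eq: "JN x = max (SUP i. \<bar>x i\<bar>) (SUP A\<in>{A. adm A}. L2_set (\<lambda>s. sn s x) A)"
proof -
  have "(\<lambda>A. S2_norm (\<lambda>l. \<Sum>s\<in>A. sn s x * (if l = Min s then 1 else 0))) ` {A. adm A} =
      (\<lambda>A. L2_set (\<lambda>s. sn s x) A) ` {A. adm A}"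
    by (rule image_cong) (simp_all add: S2_norm_adm)
  then show ?thesis unfolding JT_norm_def adm_def by simp
qed

lemma L2_segment_norm_le_l1:
  assumes "adm A" "x \<in> c00"
  shows "L2_set (\<lambda>s. sn s x) A \<le> l1 x"
proof -
  have A: "finite A" "A \<subseteq> segments D R" "disjoint A" using assms by (auto simp: adm_def)
  have ch: "tchain D R s" if "s \<in> A" for s using that A(2) segment_tchain by blast
  have "L2_set (\<lambda>s. sn s x) A \<le> (\<Sum>s\<in>A. sn s x)"
    by (rule L2_set_le_sum) (rule segment_norm_nonneg[OF ch assms(2)])
  also have "\<dots> \<le> (\<Sum>s\<in>A. l1 (restrict_to s x))"
    by (rule sum_mono) (rule segment_norm_le_l1[OF ch assms(2)])
  also have "\<dots> \<le> l1 x" by (rule sum_l1_restrict[OF A(1,3) assms(2)])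
  finally show ?thesis .
qed

lemma adm_empty: "adm {}"
  by (simp add: adm_def)

lemma abs_coord_le_JN:
  assumes "x \<in> c00"
  shows "\<bar>x i\<bar> \<le> JN x"
proof -
  have "\<bar>x i\<bar> \<le> l1 x" for i
  proof (cases "x i = 0")
    case True
    then show ?thesis by (simp add: l1_nonneg)
  next
    case False
    then show ?thesis unfolding l1_def
      using member_le_sum[of i "{i. x i \<noteq> 0}" "\<lambda>i. \<bar>x i\<bar>"] c00_finite[OF assms] by simp
  qed
  then have "bdd_above (range (\<lambda>i. \<bar>x i\<bar>))" by (intro bdd_aboveI2)
  then have "\<bar>x i\<bar> \<le> (SUP i. \<bar>x i\<bar>)" by (rule cSUP_upper[OF UNIV_I])
  then show ?thesis unfolding JN_eq by simp
qed

lemma L2_segment_norm_le_JN: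
  assumes "adm A" "x \<in> c00"
  shows "L2_set (\<lambda>s. sn s x) A \<le> JN x"
proof -
  have "bdd_above ((\<lambda>A. L2_set (\<lambda>s. sn s x) A) ` {A. adm A})"
    using L2_segment_norm_le_l1[OF _ assms(2)] by (intro bdd_aboveI2[of _ _ "l1 x"]) auto
  then have "L2_set (\<lambda>s. sn s x) A \<le> (SUP A\<in>{A. adm A}. L2_set (\<lambda>s. sn s x) A)"
    using assms(1) by (intro cSUP_upper) auto
  then show ?thesis unfolding JN_eq by simp
qed

lemma JN_le:
  assumes "\<And>i. \<bar>x i\<bar> \<le> K" "\<And>A. adm A \<Longrightarrow> L2_set (\<lambda>s. sn s x) A \<le> K"
  shows "JN x \<le> K"
  unfolding JN_eq using assms adm_empty by (intro max.boundedI cSUP_least) auto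

lemma JN_nonneg: "x \<in> c00 \<Longrightarrow> 0 \<le> JN x"
  using abs_coord_le_JN[of x 0] abs_ge_zero order_trans by blast

lemma segment_norm_le_JN:
  assumes "s \<in> segments D R" "x \<in> c00"
  shows "sn s x \<le> JN x"
proof -
  have "adm {s}"
  proof (rule admI)
    show "disjoint {s}" by (rule disjointI) blast
    fix t assume "t \<in> {s}"
    then have "t = s" by blast
    then show "card {s} \<le> Min t" using Min_segment_pos[OF assms(1)] by (simp del: Min_ge_iff)
  qed (use assms(1) in auto)
  from L2_segment_norm_le_JN[OF this assms(2)]
  show ?thesis using segment_norm_nonneg[OF segment_tchain[OF assms(1)] assms(2)] by simp
qed

text \<open>A branch is infinite and hence no segment, but the functionals vanish off it and a
  finitely supported vector meets only its part up to some node \<open>b\<close> beyond the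
  support.\<close>

lemma branch_norm_le_JN:
  assumes "\<sigma> \<in> branches D R" "x \<in> c00"
  shows "bn \<sigma> x \<le> JN x"
proof -
  note inf = branch_infinite[OF assms(1)]
  define a where "a = (LEAST a. a \<in> \<sigma>)"
  have "\<exists>a. a \<in> \<sigma>" using infinite_imp_nonempty[OF inf] by blast
  then have a: "a \<in> \<sigma>" unfolding a_def by (rule LeastI_ex)
  have a_le: "a \<le> b" if "b \<in> \<sigma>" for b unfolding a_def using that by (rule Least_le)
  obtain q where q: "{i. x i \<noteq> 0} \<subseteq> {..q}"
    using c00_finite[OF assms(2)] finite_nat_iff_bounded_le by blast
  obtain b where b: "b \<in> \<sigma>" "q < b" using inf infinite_nat_iff_unbounded by blast
  let ?s = "\<sigma> \<inter> {a..b}"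
  have seg: "?s \<in> segments D R"
    by (rule branch_interval_segment[OF assms(1) a b(1) a_le[OF b(1)]])
  have "bn \<sigma> x \<le> bn \<sigma> (restrict_to ?s x)"
  proof (rule branch_norm_le[OF assms(2)])
    fix E N assume E: "ivl E"
    have "pairing (ph \<sigma> k) (restrict_to E x) = pairing (ph \<sigma> k) (restrict_to E (restrict_to ?s x))" for k
    proof -
      have "pairing (ph \<sigma> k) (restrict_to E (restrict_to ?s x)) =
          (\<Sum>i | x i \<noteq> 0. ph \<sigma> k i * restrict_to E (restrict_to ?s x) i)"
        using c00_finite[OF assms(2)]
        by (intro pairing_eq) (auto simp: restrict_to_def split: if_splits)
      also have "\<dots> = (\<Sum>i | x i \<noteq> 0. ph \<sigma> k i * restrict_to E x i)"
      proof (rule sum.cong[OF refl])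
        fix i assume i: "i \<in> {i. x i \<noteq> 0}"
        show "ph \<sigma> k i * restrict_to E (restrict_to ?s x) i = ph \<sigma> k i * restrict_to E x i"
        proof (cases "ph \<sigma> k i = 0")
          case False
          then have "i \<in> \<sigma>" using phi_support s_set_subset[OF inf] by blast
          moreover have "i \<le> b" using i q b(2) by fastforce
          ultimately have "i \<in> ?s" using a_le by simp
          then show ?thesis by (simp add: restrict_to_def)
        qed simp
      qed
      also have "\<dots> = pairing (ph \<sigma> k) (restrict_to E x)"
        using c00_finite[OF assms(2)]
        by (intro pairing_eq[symmetric]) (auto simp: restrict_to_def split: if_splits)
      finally show ?thesis by simp
    qed
    then have "phn \<sigma> N (restrict_to E x) = phn \<sigma> N (restrict_to E (restrict_to ?s x))"
      by (simp add: phn_def)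
    then show "phn \<sigma> N (restrict_to E x) \<le> bn \<sigma> (restrict_to ?s x)"
      using phn_le_branch_norm[OF inf c00_restrict[OF assms(2)] E] by simp
  qed
  also have "\<dots> = sn ?s x" by (rule segment_norm_eq[OF assms(1) _ assms(2), symmetric]) blast
  also have "\<dots> \<le> JN x" by (rule segment_norm_le_JN[OF seg assms(2)])
  finally show ?thesis .
qed

lemma phn_le_JN:
  assumes "\<sigma> \<in> branches D R" "x \<in> c00"
  shows "phn \<sigma> N x \<le> JN x"
proof -
  have "phn \<sigma> N (restrict_to UNIV x) \<le> bn \<sigma> x"
    by (rule phn_le_branch_norm[OF branch_infinite[OF assms(1)] assms(2) ivl_UNIV])
  then show ?thesis using branch_norm_le_JN[OF assms] by (simp add: restrict_to_def)
qed

end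

section \<open>Block sequences\<close>

definition block :: "(nat \<Rightarrow> nat) \<Rightarrow> (nat \<Rightarrow> nat \<Rightarrow> real) \<Rightarrow> bool" where
  "block p x \<longleftrightarrow> strict_mono p \<and>
    (\<forall>j. x j \<in> c00 \<and> (\<forall>i. x j i \<noteq> 0 \<longrightarrow> p j < i \<and> i \<le> p (Suc j)))"

lemma
  assumes "block p x"
  shows block_strict_mono: "strict_mono p"
    and block_c00: "x j \<in> c00"
    and block_gt: "x j i \<noteq> 0 \<Longrightarrow> p j < i"
    and block_le: "x j i \<noteq> 0 \<Longrightarrow> i \<le> p (Suc j)"
  using assms unfolding block_def by blast+

lemma block_subseq:
  assumes "block p x" "strict_mono r"
  shows "block (\<lambda>j. p (r j)) (\<lambda>j. x (r j))"
  unfolding block_def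
proof (intro conjI allI impI)
  note p = block_strict_mono[OF assms(1)]
  show "strict_mono (\<lambda>j. p (r j))" using strict_monoD[OF p] strict_monoD[OF assms(2)]
    by (intro strict_monoI) blast
  fix j
  show "x (r j) \<in> c00" by (rule block_c00[OF assms(1)])
  fix i assume i: "x (r j) i \<noteq> 0"
  then show "p (r j) < i" by (rule block_gt[OF assms(1)])
  have "Suc (r j) \<le> r (Suc j)" using strict_monoD[OF assms(2), of j "Suc j"] by simp
  then have "p (Suc (r j)) \<le> p (r (Suc j))" using strict_mono_less_eq[OF p] by blast
  then show "i \<le> p (r (Suc j))" using block_le[OF assms(1) i] by linarith
qed

lemma block_scale:
  assumes "block p x"
  shows "block p (\<lambda>j i. c j * x j i)"
  unfolding block_def
proof (intro conjI allI impI)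
  fix j
  show "(\<lambda>i. c j * x j i) \<in> c00" by (rule c00_scale[OF block_c00[OF assms]])
  fix i assume "c j * x j i \<noteq> 0"
  then have "x j i \<noteq> 0" by simp
  then show "p j < i" "i \<le> p (Suc j)" by (rule block_gt[OF assms], rule block_le[OF assms])
qed (rule block_strict_mono[OF assms])

lemma block_disjoint:
  assumes "block p x" "x j i \<noteq> 0" "x j' i \<noteq> 0"
  shows "j = j'"
proof -
  have "\<not> j < j'" if "x j i \<noteq> 0" "x j' i \<noteq> 0" for j j'
  proof
    assume "j < j'"
    then have "p (Suc j) \<le> p j'" using strict_mono_less_eq[OF block_strict_mono[OF assms(1)]] by simp
    then show False using block_le[OF assms(1) that(1)] block_gt[OF assms(1) that(2)] by linarith
  qed
  from this[OF assms(2,3)] this[OF assms(3,2)] show ?thesis by simp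
qed

lemma block_sum_coord:
  assumes "block p x" "finite J"
  shows "(\<Sum>j\<in>J. x j i) = 0 \<or> (\<exists>j\<in>J. (\<Sum>j\<in>J. x j i) = x j i)"
proof (cases "\<exists>j\<in>J. x j i \<noteq> 0")
  case True
  then obtain j where j: "j \<in> J" "x j i \<noteq> 0" by blast
  have z: "x j' i = 0" if "j' \<in> J - {j}" for j'
    using block_disjoint[OF assms(1) j(2), of j'] that by blast
  have "(\<Sum>j\<in>J. x j i) = (\<Sum>j\<in>{j}. x j i)"
    using j(1) z by (intro sum.mono_neutral_right[OF assms(2)]) simp_all
  then show ?thesis using j by auto
next
  case False
  then have "(\<Sum>j\<in>J. x j i) = 0" by (intro sum.neutral) blast
  then show ?thesis ..
qed

lemma L2_set_sum_le: "finite J \<Longrightarrow> L2_set (\<lambda>s. \<Sum>j\<in>J. f j s) A \<le> (\<Sum>j\<in>J. L2_set (f j) A)"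
proof (induction J rule: finite_induct)
  case (insert j J)
  have "L2_set (\<lambda>s. f j s + (\<Sum>j\<in>J. f j s)) A \<le> L2_set (f j) A + L2_set (\<lambda>s. \<Sum>j\<in>J. f j s) A"
    by (rule L2_set_triangle_ineq)
  then show ?case using insert by simp
qed (simp add: L2_set_def)

lemma sum_half_powers: "finite J \<Longrightarrow> (\<Sum>j\<in>J. (1 / 2 :: real) ^ j) \<le> 2"
  using sum_le_suminf[of "\<lambda>j. (1 / 2 :: real) ^ j" J] suminf_geometric[of "1 / 2 :: real"]
    summable_geometric[of "1 / 2 :: real"] by simp

text \<open>Each single alternative is settled by passing to a subsequence; the diagonal sequence is
  eventually a subsequence of each of these and settles all of them.\<close>

lemma diagonal_decide:
  fixes A :: "nat \<Rightarrow> nat \<Rightarrow> bool"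
  obtains r :: "nat \<Rightarrow> nat" where "strict_mono r"
    "\<And>t. (\<forall>\<^sub>F j in sequentially. A t (r j)) \<or> (\<forall>\<^sub>F j in sequentially. \<not> A t (r j))"
proof -
  interpret subseqs "\<lambda>t s. (\<forall>j. A t (s j)) \<or> (\<forall>j. \<not> A t (s j))"
  proof
    fix t and s :: "nat \<Rightarrow> nat" assume "strict_mono s"
    show "\<exists>r' :: nat \<Rightarrow> nat. strict_mono r' \<and> ((\<forall>j. A t ((s \<circ> r') j)) \<or> (\<forall>j. \<not> A t ((s \<circ> r') j)))"
    proof (cases "infinite {j. A t (s j)}")
      case True
      let ?r = "enumerate {j. A t (s j)}"
      have "A t ((s \<circ> ?r) j)" for j using enumerate_in_set[OF True, of j] by simp
      then show ?thesis using strict_mono_enumerate[OF True] by blast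
    next
      case False
      then have inf: "infinite {j. \<not> A t (s j)}"
        using finite_Collect_not infinite_UNIV_nat by blast
      let ?r = "enumerate {j. \<not> A t (s j)}"
      have "\<not> A t ((s \<circ> ?r) j)" for j using enumerate_in_set[OF inf, of j] by simp
      then show ?thesis using strict_mono_enumerate[OF inf] by blast
    qed
  qed
  have "(\<forall>\<^sub>F j in sequentially. A t (diagseq j)) \<or> (\<forall>\<^sub>F j in sequentially. \<not> A t (diagseq j))" for t
  proof -
    have "(\<forall>j. A t ((diagseq \<circ> (+) (Suc t)) j)) \<or> (\<forall>j. \<not> A t ((diagseq \<circ> (+) (Suc t)) j))"
      by (rule diagseq_holds) auto
    then show ?thesis
    proof
      assume "\<forall>j. A t ((diagseq \<circ> (+) (Suc t)) j)"
      then have "\<forall>\<^sub>F j in sequentially. A t (diagseq (j + Suc t))" by (simp add: add.commute)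
      then show ?thesis
        using eventually_sequentially_seg[of "\<lambda>j. A t (diagseq j)" "Suc t"] by blast
    next
      assume "\<forall>j. \<not> A t ((diagseq \<circ> (+) (Suc t)) j)"
      then have "\<forall>\<^sub>F j in sequentially. \<not> A t (diagseq (j + Suc t))" by (simp add: add.commute)
      then show ?thesis
        using eventually_sequentially_seg[of "\<lambda>j. \<not> A t (diagseq j)" "Suc t"] by blast
    qed
  qed
  then show ?thesis using that subseq_diagseq by blast
qed

section \<open>Segments that are large on the members of a block sequence\<close>

context jt_tree
begin

lemma segment_norm_supp:
  assumes "tchain D R s" "s' \<subseteq> s" "x \<in> c00" "\<And>i. i \<in> s \<Longrightarrow> x i \<noteq> 0 \<Longrightarrow> i \<in> s'"
  shows "sn s' x = sn s x"
proof -
  obtain \<sigma> where \<sigma>: "\<sigma> \<in> branches D R" "infinite \<sigma>" "s \<subseteq> \<sigma>"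
    by (rule tchain_norm_obtain[OF assms(1)])
  have "restrict_to s' x = restrict_to s x"
    unfolding restrict_to_def using assms(2,4) by (intro ext) auto
  then show ?thesis
    using segment_norm_eq[OF \<sigma>(1,3) assms(3)]
      segment_norm_eq[OF \<sigma>(1) subset_trans[OF assms(2) \<sigma>(3)] assms(3)] by simp
qed

text \<open>Trimming to the range of the vector makes segments for different blocks disjoint and
  moves their starting points far out, as admissibility requires. Positivity excludes an empty
  intersection, which would not be a segment.\<close>

lemma segment_range:
  assumes "s \<in> segments D R" "x \<in> c00" "\<And>i. x i \<noteq> 0 \<Longrightarrow> q < i \<and> i \<le> q'" "sn s x > 0"
  obtains s' where "s' \<in> segments D R" "s' \<subseteq> s" "s' \<subseteq> {q<..q'}" "sn s' x = sn s x"
proof -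
  let ?s = "s \<inter> {q<..q'}"
  note ch = segment_tchain[OF assms(1)]
  have eq: "sn ?s x = sn s x"
    using assms(3) by (intro segment_norm_supp[OF ch _ assms(2)]) auto
  have ne: "?s \<noteq> {}"
  proof
    assume e: "?s = {}"
    have "sn {} x = 0" using tchain_subset[OF ch] by (intro segment_norm_zero assms(2)) auto
    then show False using eq e assms(4) by simp
  qed
  have fin: "finite ?s" using segment_finite[OF assms(1)] by simp
  define a b where "a = Min ?s" and "b = Max ?s"
  have a: "a \<in> ?s" "\<And>k. k \<in> ?s \<Longrightarrow> a \<le> k" and b: "b \<in> ?s" "\<And>k. k \<in> ?s \<Longrightarrow> k \<le> b"
    unfolding a_def b_def using Min_in[OF fin ne] Max_in[OF fin ne] fin by simp_all
  have cut: "?s = s \<inter> {a..b}"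
  proof (intro equalityI subsetI)
    fix k assume "k \<in> s \<inter> {a..b}"
    then show "k \<in> ?s" using a(1) b(1) by simp
  qed (use a(2) b(2) in simp)
  have "?s \<in> segments D R"
    unfolding cut using a b by (intro segment_cut(1)[OF assms(1)]) simp_all
  then show ?thesis using that[of ?s] eq by simp
qed

text \<open>An admissible family of \<mu> segments contains only points from \<mu> on. It misses
  blocks ending before \<mu>; on a block starting at or after \<mu> it has size at most
  \<open>e j * sqrt (p j)\<close>; and at most one block straddles \<mu>, contributing at most 2.
  The other blocks add up to at most 2.\<close>

lemma c0_bound:
  assumes "block p x" "\<And>j. JN (x j) \<le> 2" "\<And>j. 0 \<le> e j"
    and small: "\<And>j s. s \<in> segments D R \<Longrightarrow> sn s (x j) \<le> e j"
    and e: "\<And>j. e j * sqrt (p j) \<le> (1 / 2) ^ j"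
    and J: "finite J"
  shows "JN (\<lambda>i. \<Sum>j\<in>J. x j i) \<le> 4"
proof (rule JN_le)
  note xc = block_c00[OF assms(1)]
  fix i
  show "\<bar>\<Sum>j\<in>J. x j i\<bar> \<le> 4"
    using block_sum_coord[OF assms(1) J, of i]
  proof
    assume "\<exists>j\<in>J. (\<Sum>j\<in>J. x j i) = x j i"
    then obtain j where "(\<Sum>j\<in>J. x j i) = x j i" by blast
    then show ?thesis using abs_coord_le_JN[OF xc[of j], of i] assms(2)[of j] by simp
  qed simp
next
  note xc = block_c00[OF assms(1)]
  fix A assume A: "adm A"
  define \<mu> where "\<mu> = card A"
  have seg: "s \<in> segments D R" if "s \<in> A" for s using A that by (auto simp: adm_def)
  note ch = segment_tchain[OF seg]
  let ?c = "\<lambda>j. if p j < \<mu> \<and> \<mu> \<le> p (Suc j) then 2 else (0::real)"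
  have each: "L2_set (\<lambda>s. sn s (x j)) A \<le> (1 / 2) ^ j + ?c j" for j
  proof -
    consider "p (Suc j) < \<mu>" | "\<mu> \<le> p j" | "p j < \<mu> \<and> \<mu> \<le> p (Suc j)" by linarith
    then show ?thesis
    proof cases
      case 1
      have "sn s (x j) = 0" if s: "s \<in> A" for s
      proof (rule segment_norm_zero[OF ch[OF s] _ xc])
        fix i assume "i \<in> s"
        then have "\<mu> \<le> i"
          using adm_card[OF A s] segment_finite[OF seg[OF s]] unfolding \<mu>_def
          by (meson Min_le order_trans)
        then show "x j i = 0" using block_le[OF assms(1), of j i] 1 by (meson leD le_trans)
      qed
      then have "L2_set (\<lambda>s. sn s (x j)) A = 0" by (simp add: L2_set_def)
      then show ?thesis by simp
    next
      case 2
      have "L2_set (\<lambda>s. sn s (x j)) A \<le> L2_set (\<lambda>s. e j) A"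
        using small[OF seg] segment_norm_nonneg[OF ch xc] by (intro L2_set_mono) auto
      also have "\<dots> = e j * sqrt \<mu>"
        using assms(3)[of j] by (simp add: L2_set_def \<mu>_def real_sqrt_mult)
      also have "\<dots> \<le> e j * sqrt (p j)" using assms(3)[of j] 2 by (intro mult_left_mono) auto
      finally show ?thesis using e[of j] by (simp split: if_splits)
    next
      case 3
      have "L2_set (\<lambda>s. sn s (x j)) A \<le> 2"
        using L2_segment_norm_le_JN[OF A xc[of j]] assms(2)[of j] by linarith
      then show ?thesis using 3 by (simp add: add_increasing)
    qed
  qed
  have "(\<Sum>j\<in>J. ?c j) \<le> 2"
  proof (cases "\<exists>j\<in>J. p j < \<mu> \<and> \<mu> \<le> p (Suc j)")
    case True
    then obtain j where j: "j \<in> J" "p j < \<mu>" "\<mu> \<le> p (Suc j)" by blast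
    have z: "?c j' = 0" if "j' \<in> J - {j}" for j'
    proof -
      have "j' < j \<or> j < j'" using that by auto
      then have "p (Suc j') \<le> p j \<or> p (Suc j) \<le> p j'"
        using strict_mono_less_eq[OF block_strict_mono[OF assms(1)]] by (simp add: Suc_le_eq)
      then show ?thesis using j by auto
    qed
    have "(\<Sum>j\<in>J. ?c j) = (\<Sum>j\<in>{j}. ?c j)"
      using j(1) z by (intro sum.mono_neutral_right[OF J]) blast+
    then show ?thesis by simp
  next
    case False
    then have "(\<Sum>j\<in>J. ?c j) = 0" by (intro sum.neutral) auto
    then show ?thesis by simp
  qed
  moreover have "L2_set (\<lambda>s. sn s (\<lambda>i. \<Sum>j\<in>J. x j i)) A \<le> (\<Sum>j\<in>J. (1 / 2) ^ j + ?c j)"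
  proof -
    have "L2_set (\<lambda>s. sn s (\<lambda>i. \<Sum>j\<in>J. x j i)) A \<le> L2_set (\<lambda>s. \<Sum>j\<in>J. sn s (x j)) A"
    proof (rule L2_set_mono)
      fix s assume s: "s \<in> A"
      show "sn s (\<lambda>i. \<Sum>j\<in>J. x j i) \<le> (\<Sum>j\<in>J. sn s (x j))"
        by (rule segment_norm_sum[OF ch[OF s] xc])
      show "0 \<le> sn s (\<lambda>i. \<Sum>j\<in>J. x j i)"
        by (rule segment_norm_nonneg[OF ch[OF s] c00_sum[OF xc]])
    qed
    also have "\<dots> \<le> (\<Sum>j\<in>J. L2_set (\<lambda>s. sn s (x j)) A)" by (rule L2_set_sum_le[OF J])
    also have "\<dots> \<le> (\<Sum>j\<in>J. (1 / 2) ^ j + ?c j)" by (rule sum_mono) (rule each)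
    finally show ?thesis .
  qed
  ultimately show "L2_set (\<lambda>s. sn s (\<lambda>i. \<Sum>j\<in>J. x j i)) A \<le> 4"
    using sum_half_powers[OF J] by (simp add: sum.distrib)
qed

text \<open>Trimmed to a block far enough out, large segments issuing from incomparable nodes are
  disjoint and start beyond their own number. They form an admissible family, and the norm bound 2
  limits their number.\<close>

lemma antichain_bound:
  assumes "block p x" "\<And>j. JN (x j) \<le> 2" "\<epsilon> > 0" "finite C" "C \<subseteq> D"
    and anti: "\<And>a b. a \<in> C \<Longrightarrow> b \<in> C \<Longrightarrow> (a, b) \<in> R \<Longrightarrow> a = b"
    and big: "\<And>t. t \<in> C \<Longrightarrow> \<forall>\<^sub>F j in sequentially. \<exists>s\<in>segments D R. Min s = t \<and> \<epsilon> < sn s (x j)"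
  shows "real (card C) * \<epsilon>\<^sup>2 \<le> 4"
proof -
  note xc = block_c00[OF assms(1)]
  have ev: "\<forall>\<^sub>F j in sequentially. \<forall>t\<in>C. \<exists>s\<in>segments D R. Min s = t \<and> \<epsilon> < sn s (x j)"
    using big by (intro eventually_ball_finite[OF assms(4)]) blast
  have "\<forall>\<^sub>F j in sequentially. card C \<le> j \<and>
      (\<forall>t\<in>C. \<exists>s\<in>segments D R. Min s = t \<and> \<epsilon> < sn s (x j))"
    using ev eventually_ge_at_top[of "card C"] by (rule eventually_elim2) blast
  then obtain j where j: "card C \<le> j" "\<forall>t\<in>C. \<exists>s\<in>segments D R. Min s = t \<and> \<epsilon> < sn s (x j)"
    using eventually_happens'[OF sequentially_bot] by blast
  have "\<forall>t\<in>C. \<exists>s'. s' \<in> segments D R \<and> s' \<subseteq> {p j<..p (Suc j)} \<and> \<epsilon> < sn s' (x j) \<and>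
      (\<forall>k\<in>s'. (t, k) \<in> R)"
  proof
    fix t assume "t \<in> C"
    then obtain s where s: "s \<in> segments D R" "Min s = t" "\<epsilon> < sn s (x j)" using j(2) by blast
    have pos: "0 < sn s (x j)" using s(3) assms(3) by linarith
    obtain s' where s': "s' \<in> segments D R" "s' \<subseteq> s" "s' \<subseteq> {p j<..p (Suc j)}" "sn s' (x j) = sn s (x j)"
      using block_gt[OF assms(1)] block_le[OF assms(1)]
      by (rule_tac segment_range[OF s(1) xc _ pos]) blast+
    have "(t, k) \<in> R" if "k \<in> s'" for k
    proof -
      have k: "k \<in> s" using that s'(2) by blast
      show ?thesis
        using tchain_le[OF segment_tchain[OF s(1)] segment_Min[OF s(1)] k]
          Min_le[OF segment_finite[OF s(1)] k] s(2) by simp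
    qed
    then show "\<exists>s'. s' \<in> segments D R \<and> s' \<subseteq> {p j<..p (Suc j)} \<and> \<epsilon> < sn s' (x j) \<and>
        (\<forall>k\<in>s'. (t, k) \<in> R)"
      using s' s(3) by auto
  qed
  then obtain S where S: "\<And>t. t \<in> C \<Longrightarrow> S t \<in> segments D R"
    "\<And>t. t \<in> C \<Longrightarrow> S t \<subseteq> {p j<..p (Suc j)}" "\<And>t. t \<in> C \<Longrightarrow> \<epsilon> < sn (S t) (x j)"
    "\<And>t k. t \<in> C \<Longrightarrow> k \<in> S t \<Longrightarrow> (t, k) \<in> R"
    by metis
  have disj: "S t \<inter> S u = {}" if "t \<in> C" "u \<in> C" "t \<noteq> u" for t u
  proof (rule ccontr)
    assume "S t \<inter> S u \<noteq> {}"
    then obtain k where "k \<in> S t" "k \<in> S u" by blast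
    then have "(t, u) \<in> R \<or> (u, t) \<in> R" using S(4) that predecessors_linear by blast
    then show False using anti that by blast
  qed
  have inj: "inj_on S C"
    using disj S(1) segment_nonempty unfolding inj_on_def by (metis inf.idem)
  have "adm (S ` C)"
  proof (rule admI)
    show "disjoint (S ` C)"
    proof (rule disjointI)
      fix a b assume "a \<in> S ` C" "b \<in> S ` C" "a \<noteq> b"
      then show "a \<inter> b = {}" using disj by blast
    qed
    fix s assume "s \<in> S ` C"
    then obtain t where t: "t \<in> C" "s = S t" by blast
    have "p j < Min s" using segment_Min[OF S(1)[OF t(1)]] S(2)[OF t(1)] t(2) by auto
    moreover have "j \<le> p j" by (rule strict_mono_imp_increasing[OF block_strict_mono[OF assms(1)]])
    ultimately show "card (S ` C) \<le> Min s" using j(1) card_image_le[OF assms(4), of S] by linarith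
  qed (use assms(4) S(1) in auto)
  then have "L2_set (\<lambda>s. sn s (x j)) (S ` C) \<le> 2"
    using L2_segment_norm_le_JN[OF _ xc] assms(2)[of j] by (meson order_trans)
  moreover have "sqrt (card C * \<epsilon>\<^sup>2) \<le> L2_set (\<lambda>s. sn s (x j)) (S ` C)"
  proof -
    have "card C * \<epsilon>\<^sup>2 = (\<Sum>t\<in>C. \<epsilon>\<^sup>2)" by simp
    also have "\<dots> \<le> (\<Sum>t\<in>C. (sn (S t) (x j))\<^sup>2)"
    proof (rule sum_mono)
      fix t assume "t \<in> C"
      then show "\<epsilon>\<^sup>2 \<le> (sn (S t) (x j))\<^sup>2" using S(3)[of t] assms(3) by (intro power_mono) auto
    qed
    also have "\<dots> = (\<Sum>s\<in>S ` C. (sn s (x j))\<^sup>2)" by (simp add: sum.reindex[OF inj])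
    finally show ?thesis unfolding L2_set_def by (rule real_sqrt_le_mono)
  qed
  ultimately have "sqrt (card C * \<epsilon>\<^sup>2) \<le> 2" by linarith
  then have "card C * \<epsilon>\<^sup>2 \<le> 2\<^sup>2" by (rule sqrt_le_D)
  then show ?thesis by simp
qed

text \<open>Dilworth's theorem for a tree. Take an antichain \<open>C\<close> of greatest size. The
  nodes comparable with a given \<open>t\<close> in \<open>C\<close> form a chain: two incomparable
  ones above \<open>t\<close> could replace \<open>t\<close> in a larger antichain. These chains
  cover \<open>P\<close>, and each extends to a branch.\<close>

lemma tree_width_branches:
  fixes P :: "nat set" and K :: nat
  assumes "P \<subseteq> D"
    and bound: "\<forall>C. finite C \<and> C \<subseteq> P \<and> (\<forall>a\<in>C. \<forall>b\<in>C. (a, b) \<in> R \<longrightarrow> a = b) \<longrightarrow> card C \<le> K"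
  obtains B where "finite B" "B \<subseteq> branches D R" "P \<subseteq> \<Union>B"
proof -
  define anti where "anti C \<longleftrightarrow> finite C \<and> C \<subseteq> P \<and> (\<forall>a\<in>C. \<forall>b\<in>C. (a, b) \<in> R \<longrightarrow> a = b)" for C
  let ?Q = "\<lambda>k. \<exists>C. anti C \<and> card C = k"
  have bd: "card C \<le> K" if "anti C" for C
    using that unfolding anti_def by (rule bound[rule_format])
  have "?Q 0" by (auto simp: anti_def intro!: exI[of _ "{}"])
  then have "\<exists>k. ?Q k \<and> (\<forall>k'. ?Q k' \<longrightarrow> k' \<le> k)"
    by (rule Nat.ex_has_greatest_nat[of ?Q 0 K]) (use bd in blast)
  then obtain C where C: "anti C" and max: "\<And>C'. anti C' \<Longrightarrow> card C' \<le> card C" by blast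
  have fin: "finite C" and CP: "C \<subseteq> P" and inc: "\<And>a b. a \<in> C \<Longrightarrow> b \<in> C \<Longrightarrow> (a, b) \<in> R \<Longrightarrow> a = b"
    using C unfolding anti_def by blast+
  define G where "G t = {u \<in> P. (u, t) \<in> R \<or> (t, u) \<in> R}" for t
  have above: "(u, v) \<in> R \<or> (v, u) \<in> R"
    if t: "t \<in> C" and u: "u \<in> P" "(t, u) \<in> R" and v: "v \<in> P" "(t, v) \<in> R" for t u v
  proof (rule ccontr)
    assume n: "\<not> ?thesis"
    have sep: "(u, w) \<notin> R \<and> (w, u) \<notin> R" if w: "w \<in> C - {t}" and u: "(t, u) \<in> R" for w u
    proof -
      have "(u, w) \<in> R \<Longrightarrow> (t, w) \<in> R" using R_trans[OF u] by blast
      moreover have "(w, u) \<in> R \<Longrightarrow> (t, w) \<in> R \<or> (w, t) \<in> R"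
        using predecessors_linear[OF u, of w] by blast
      ultimately show ?thesis using inc[OF t, of w] inc[of w t] t w by blast
    qed
    have uv: "u \<noteq> v" using n R_refl u(1) assms(1) by blast
    have nu: "u \<notin> C - {t}" "v \<notin> C - {t}"
      using sep[OF _ u(2), of u] sep[OF _ v(2), of v] R_refl u(1) v(1) assms(1) by blast+
    have "anti (insert u (insert v (C - {t})))"
      unfolding anti_def using fin CP u(1) v(1) n sep[OF _ u(2)] sep[OF _ v(2)] inc by blast
    then have "card (insert u (insert v (C - {t}))) \<le> card C" by (rule max)
    moreover have "card (insert u (insert v (C - {t}))) = Suc (card C)"
      using nu uv fin card_Suc_Diff1[OF fin t] by simp
    ultimately show False by simp
  qed
  have chain: "tchain D R (G t)" if t: "t \<in> C" for t
    unfolding tchain_def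
  proof (intro conjI ballI)
    show "G t \<subseteq> D" using assms(1) unfolding G_def by blast
    fix u v assume "u \<in> G t" "v \<in> G t"
    then have u: "u \<in> P" "(u, t) \<in> R \<or> (t, u) \<in> R" and v: "v \<in> P" "(v, t) \<in> R \<or> (t, v) \<in> R"
      unfolding G_def by blast+
    show "(u, v) \<in> R \<or> (v, u) \<in> R"
      using u(2) v(2) above[OF t u(1) _ v(1)] predecessors_linear[of u t v] R_trans[of u t v]
        R_trans[of v t u] by blast
  qed
  have cover: "P \<subseteq> (\<Union>t\<in>C. G t)"
  proof
    fix u assume u: "u \<in> P"
    show "u \<in> (\<Union>t\<in>C. G t)"
    proof (rule ccontr)
      assume "u \<notin> (\<Union>t\<in>C. G t)"
      then have n: "(u, t) \<notin> R" "(t, u) \<notin> R" if "t \<in> C" for t using that u unfolding G_def by blast+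
      have uC: "u \<notin> C" using n(1)[of u] R_refl u assms(1) by blast
      have "anti (insert u C)"
        unfolding anti_def using fin CP u n inc by blast
      then have "card (insert u C) \<le> card C" by (rule max)
      then show False using uC fin by simp
    qed
  qed
  have "\<forall>t\<in>C. \<exists>\<sigma>. \<sigma> \<in> branches D R \<and> G t \<subseteq> \<sigma>" using tchain_extend[OF chain] by blast
  then obtain S where S: "\<And>t. t \<in> C \<Longrightarrow> S t \<in> branches D R" "\<And>t. t \<in> C \<Longrightarrow> G t \<subseteq> S t" by metis
  show ?thesis
  proof (rule that)
    show "finite (S ` C)" using fin by simp
    show "S ` C \<subseteq> branches D R" using S(1) by blast
    show "P \<subseteq> \<Union> (S ` C)" using cover S(2) by blast
  qed
qed

text \<open>The nodes from which segments are infinitely often \<open>\<epsilon>\<close>-large on the subsequence lie on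
  finitely many branches, because large segments with incomparable starting points are disjoint.\<close>

lemma block_selection:
  assumes "block p x" "\<And>j. JN (x j) \<le> 2" "\<epsilon> > 0"
  obtains r P B where "strict_mono r" "finite B" "B \<subseteq> branches D R" "P \<subseteq> D" "P \<subseteq> \<Union>B"
    "\<And>a t. t \<in> P \<Longrightarrow> a \<in> D \<Longrightarrow> (a, t) \<in> R \<Longrightarrow> a \<in> P"
    "\<And>t. t \<in> D - P \<Longrightarrow> \<forall>\<^sub>F j in sequentially. \<forall>s\<in>segments D R. Min s = t \<longrightarrow> sn s (x (r j)) \<le> \<epsilon>"
proof -
  define A where "A t j \<longleftrightarrow> (\<exists>s\<in>segments D R. Min s = t \<and> \<epsilon> < sn s (x j))" for t j
  obtain r where r: "strict_mono r"
    "\<And>t. (\<forall>\<^sub>F j in sequentially. A t (r j)) \<or> (\<forall>\<^sub>F j in sequentially. \<not> A t (r j))"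
    using diagonal_decide[of A] by blast
  \<comment> \<open>After the diagonal choice, a node starts large segments either for all late
    members of the sequence or for none of them.\<close>
  define P where "P = {t \<in> D. \<forall>\<^sub>F j in sequentially. A t (r j)}"
  have PD: "P \<subseteq> D" by (auto simp: P_def)
  have down: "a \<in> P" if t: "t \<in> P" "a \<in> D" "(a, t) \<in> R" for a t
  proof -
    have step: "A a j" if At: "A t j" for j
    proof -
      obtain s where s: "s \<in> segments D R" "Min s = t" "\<epsilon> < sn s (x j)"
        using At unfolding A_def by blast
      obtain s' where s': "s' \<in> segments D R" "Min s' = a" "s \<subseteq> s'" "s = s' \<inter> {Min s..}"
        using segment_extend_down[OF s(1) t(2)] t(3) s(2) by blast
      have "sn s (x j) \<le> sn s' (x j)"
        by (rule segment_norm_restrict[OF segment_tchain[OF s'(1)] ivl_atLeast block_c00[OF assms(1)] s'(3)])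
          (use s'(4) in blast)
      then have "\<epsilon> < sn s' (x j)" using s(3) by linarith
      then show ?thesis using s'(1,2) unfolding A_def by blast
    qed
    have "\<forall>\<^sub>F j in sequentially. A t (r j)" using t(1) by (simp add: P_def)
    then have "\<forall>\<^sub>F j in sequentially. A a (r j)" by (rule eventually_mono) (rule step)
    then show ?thesis using t(2) by (simp add: P_def)
  qed
  have width: "\<forall>C. finite C \<and> C \<subseteq> P \<and> (\<forall>a\<in>C. \<forall>b\<in>C. (a, b) \<in> R \<longrightarrow> a = b) \<longrightarrow>
      card C \<le> nat \<lfloor>4 / \<epsilon>\<^sup>2\<rfloor>"
  proof (intro allI impI)
    fix C assume C: "finite C \<and> C \<subseteq> P \<and> (\<forall>a\<in>C. \<forall>b\<in>C. (a, b) \<in> R \<longrightarrow> a = b)"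
    have "real (card C) * \<epsilon>\<^sup>2 \<le> 4"
    proof (rule antichain_bound[OF block_subseq[OF assms(1) r(1)] assms(2,3)])
      show "finite C" "C \<subseteq> D" using C PD by blast+
      show "a = b" if "a \<in> C" "b \<in> C" "(a, b) \<in> R" for a b using C that by blast
      fix t assume "t \<in> C"
      then show "\<forall>\<^sub>F j in sequentially. \<exists>s\<in>segments D R. Min s = t \<and> \<epsilon> < sn s (x (r j))"
        using C unfolding P_def A_def by blast
    qed
    then have "real (card C) \<le> 4 / \<epsilon>\<^sup>2" using assms(3) by (simp add: field_simps)
    then show "card C \<le> nat \<lfloor>4 / \<epsilon>\<^sup>2\<rfloor>" by (simp add: le_nat_floor)
  qed
  obtain B where B: "finite B" "B \<subseteq> branches D R" "P \<subseteq> \<Union>B"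
    by (rule tree_width_branches[OF PD width])
  have late:  "\<forall>\<^sub>F j in sequentially. \<forall>s\<in>segments D R. Min s = t \<longrightarrow> sn s (x (r j)) \<le> \<epsilon>"
    if "t \<in> D - P" for t
  proof -
    have "\<forall>\<^sub>F j in sequentially. \<not> A t (r j)" using r(2)[of t] that unfolding P_def by blast
    then show ?thesis by (rule eventually_mono) (auto simp: A_def not_less)
  qed
  show ?thesis by (rule that[OF r(1) B(1,2) PD B(3)]) (use down late in blast)+
qed

text \<open>An interval cuts at most two blocks and contains or misses the others. The contained
  blocks form a subsum, controlled by \<kappa> without any restriction, and each cut block costs at
  most \<open>2 * \<alpha>\<close>.\<close>

lemma branch_norm_block_sum:
  assumes "block p x" "\<And>j. JN (x j) \<le> 2" "\<sigma> \<in> branches D R" "finite J" "0 \<le> \<alpha>"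
    and a: "\<And>j. j \<in> J \<Longrightarrow> \<bar>a j\<bar> \<le> \<alpha>"
    and \<kappa>: "\<And>J' N. J' \<subseteq> J \<Longrightarrow> phn \<sigma> N (\<lambda>i. \<Sum>j\<in>J'. a j * x j i) \<le> \<kappa>"
  shows "bn \<sigma> (\<lambda>i. \<Sum>j\<in>J. a j * x j i) \<le> \<kappa> + 4 * \<alpha>"
proof (rule branch_norm_le)
  note xc = block_c00[OF assms(1)] and inf = branch_infinite[OF assms(3)]
  show "(\<lambda>i. \<Sum>j\<in>J. a j * x j i) \<in> c00" by (intro c00_sum c00_scale xc)
  fix E N assume E: "ivl E"
  define J1 where "J1 = {j \<in> J. \<forall>i. x j i \<noteq> 0 \<longrightarrow> i \<in> E}"
  define J2 where "J2 = {j \<in> J. j \<notin> J1 \<and> (\<exists>i\<in>E. x j i \<noteq> 0)}"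
  have fin: "finite J1" "finite J2" using assms(4) by (auto simp: J1_def J2_def)
  have sub: "J1 \<subseteq> J" "J2 \<subseteq> J" "J1 \<inter> J2 = {}" by (auto simp: J1_def J2_def)
  \<comment> \<open>A block strictly between two blocks met by \<open>E\<close> has points of
    \<open>E\<close> on both sides, so it lies in \<open>E\<close> and is not cut.\<close>
  have card2: "card J2 \<le> 2"
  proof (rule ccontr)
    assume "\<not> card J2 \<le> 2"
    then have c: "card J2 > 2" by simp
    then have ne: "J2 \<noteq> {}" by auto
    have "card {Min J2, Max J2} \<le> 2" by (simp add: card_insert_if)
    then have "\<not> J2 \<subseteq> {Min J2, Max J2}" using c card_mono[of "{Min J2, Max J2}" J2] by auto
    then obtain c where c: "c \<in> J2" "c \<noteq> Min J2" "c \<noteq> Max J2" by blast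
    then have lt: "Min J2 < c" "c < Max J2" using fin(2) by (simp_all add: le_neq_implies_less)
    have mem: "Min J2 \<in> J2" "Max J2 \<in> J2" using fin(2) ne by auto
    obtain u where u: "u \<in> E" "x (Min J2) u \<noteq> 0" using mem(1) unfolding J2_def by blast
    obtain v where v: "v \<in> E" "x (Max J2) v \<noteq> 0" using mem(2) unfolding J2_def by blast
    have p: "p (Suc (Min J2)) \<le> p c" "p (Suc c) \<le> p (Max J2)"
      using strict_mono_less_eq[OF block_strict_mono[OF assms(1)]] lt by (simp_all add: Suc_le_eq)
    have "i \<in> E" if i: "x c i \<noteq> 0" for i
    proof -
      have "u \<le> i" "i \<le> v"
        using block_le[OF assms(1) u(2)] block_gt[OF assms(1) i] block_le[OF assms(1) i]
          block_gt[OF assms(1) v(2)] p by linarith+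
      then show ?thesis using E u(1) v(1) unfolding ivl_def by (meson atLeastAtMost_iff subsetD)
    qed
    then show False using c(1) unfolding J1_def J2_def by blast
  qed
  let ?u = "\<lambda>i. \<Sum>j\<in>J1. a j * x j i" and ?v = "\<lambda>i. \<Sum>j\<in>J2. a j * restrict_to E (x j) i"
  have split: "restrict_to E (\<lambda>i. \<Sum>j\<in>J. a j * x j i) = (\<lambda>i. ?u i + ?v i)"
  proof
    fix i
    have "restrict_to E (\<lambda>i. \<Sum>j\<in>J. a j * x j i) i = (\<Sum>j\<in>J. a j * restrict_to E (x j) i)"
      by (simp add: restrict_to_def)
    also have "\<dots> = (\<Sum>j\<in>J1 \<union> J2. a j * restrict_to E (x j) i)"
    proof (rule sum.mono_neutral_right[OF assms(4)])
      show "J1 \<union> J2 \<subseteq> J" using sub by blast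
      show "\<forall>j\<in>J - (J1 \<union> J2). a j * restrict_to E (x j) i = 0"
        by (auto simp: J1_def J2_def restrict_to_def)
    qed
    also have "\<dots> = (\<Sum>j\<in>J1. a j * restrict_to E (x j) i) + ?v i"
      by (rule sum.union_disjoint[OF fin sub(3)])
    also have "(\<Sum>j\<in>J1. a j * restrict_to E (x j) i) = ?u i"
      by (rule sum.cong) (auto simp: J1_def restrict_to_def)
    finally show "restrict_to E (\<lambda>i. \<Sum>j\<in>J. a j * x j i) i = ?u i + ?v i" .
  qed
  have vc: "(\<lambda>i. a j * restrict_to E (x j) i) \<in> c00" for j by (intro c00_scale c00_restrict xc)
  have "phn \<sigma> N ?v \<le> (\<Sum>j\<in>J2. phn \<sigma> N (\<lambda>i. a j * restrict_to E (x j) i))"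
    unfolding phn_def pairing_sum[OF vc] by (rule L2_set_sum_le[OF fin(2)])
  also have "\<dots> \<le> (\<Sum>j\<in>J2. \<alpha> * 2)"
  proof (rule sum_mono)
    fix j assume j: "j \<in> J2"
    have "phn \<sigma> N (restrict_to E (x j)) \<le> 2"
      using phn_le_branch_norm[OF inf xc E, of N j] branch_norm_le_JN[OF assms(3) xc, of j]
        assms(2)[of j] by linarith
    then show "phn \<sigma> N (\<lambda>i. a j * restrict_to E (x j) i) \<le> \<alpha> * 2"
      unfolding phn_scale using a[of j] j sub(2) phn_nonneg assms(5) by (intro mult_mono) auto
  qed
  also have "\<dots> \<le> 4 * \<alpha>"
  proof -
    have "real (card J2) * (\<alpha> * 2) \<le> 2 * (\<alpha> * 2)"
      using card2 assms(5) by (intro mult_right_mono) auto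
    then show ?thesis by simp
  qed
  finally have "phn \<sigma> N ?v \<le> 4 * \<alpha>" .
  moreover have "phn \<sigma> N (\<lambda>i. ?u i + ?v i) \<le> phn \<sigma> N ?u + phn \<sigma> N ?v"
    by (rule phn_add) (intro c00_sum c00_scale c00_restrict xc)+
  ultimately show "phn \<sigma> N (restrict_to E (\<lambda>i. \<Sum>j\<in>J. a j * x j i)) \<le> \<kappa> + 4 * \<alpha>"
    unfolding split using \<kappa>[OF sub(1), of N] by linarith
qed

text \<open>Each functional sees at most one summand, so squares add up as for orthogonal
  vectors.\<close>

lemma phn_sum_disjoint:
  assumes "\<And>j. j \<in> J \<Longrightarrow> x j \<in> c00" "finite J" "0 \<le> b"
    and "\<And>j. j \<in> J \<Longrightarrow> phn \<sigma> N (x j) \<le> b"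
    and disj: "\<And>k i j. 1 \<le> k \<Longrightarrow> i \<in> J \<Longrightarrow> j \<in> J \<Longrightarrow> pairing (ph \<sigma> k) (x i) \<noteq> 0 \<Longrightarrow>
      pairing (ph \<sigma> k) (x j) \<noteq> 0 \<Longrightarrow> i = j"
  shows "phn \<sigma> N (\<lambda>i. \<Sum>j\<in>J. x j i) \<le> sqrt (card J) * b"
proof -
  let ?g = "\<lambda>j k. pairing (ph \<sigma> k) (x j)"
  have "(\<Sum>j\<in>J. ?g j k)\<^sup>2 = (\<Sum>j\<in>J. (?g j k)\<^sup>2)" if k: "1 \<le> k" for k
  proof (cases "\<exists>j\<in>J. ?g j k \<noteq> 0")
    case True
    then obtain j where j: "j \<in> J" "?g j k \<noteq> 0" by blast
    have z: "?g i k = 0" if "i \<in> J - {j}" for i using disj[OF k _ j(1) _ j(2), of i] that by blast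
    have "(\<Sum>j\<in>J. ?g j k) = (\<Sum>j\<in>{j}. ?g j k)" "(\<Sum>j\<in>J. (?g j k)\<^sup>2) = (\<Sum>j\<in>{j}. (?g j k)\<^sup>2)"
      using j z by (intro sum.mono_neutral_right[OF assms(2)]; simp)+
    then show ?thesis by simp
  next
    case False
    then have "\<And>j. j \<in> J \<Longrightarrow> ?g j k = 0" by blast
    then show ?thesis by simp
  qed
  then have "(\<Sum>k = 1..N. (\<Sum>j\<in>J. ?g j k)\<^sup>2) = (\<Sum>k = 1..N. \<Sum>j\<in>J. (?g j k)\<^sup>2)"
    by (intro sum.cong) auto
  also have "\<dots> = (\<Sum>j\<in>J. \<Sum>k = 1..N. (?g j k)\<^sup>2)" by (rule sum.swap)
  also have "\<dots> \<le> (\<Sum>j\<in>J. b\<^sup>2)"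
  proof (rule sum_mono)
    fix j assume j: "j \<in> J"
    have "sqrt (\<Sum>k = 1..N. (?g j k)\<^sup>2) \<le> b" using assms(4)[OF j] unfolding phn_def L2_set_def .
    then show "(\<Sum>k = 1..N. (?g j k)\<^sup>2) \<le> b\<^sup>2" by (rule sqrt_le_D)
  qed
  finally have "(\<Sum>k = 1..N. (\<Sum>j\<in>J. ?g j k)\<^sup>2) \<le> card J * b\<^sup>2" by simp
  then have "sqrt (\<Sum>k = 1..N. (\<Sum>j\<in>J. ?g j k)\<^sup>2) \<le> sqrt (card J * b\<^sup>2)" by (rule real_sqrt_le_mono)
  then show ?thesis
    using assms(3) by (simp add: phn_def L2_set_def pairing_sum[OF assms(1)] real_sqrt_mult)
qed

end

text \<open>It suffices to make each new term good for its immediate predecessor: \<open>f\<close>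
  is monotone and \<open>Q\<close> passes to smaller first arguments, which settles all earlier
  terms at once.\<close>

lemma eventually_thinning:
  fixes f :: "nat \<Rightarrow> nat" and Q :: "nat \<Rightarrow> nat \<Rightarrow> bool"
  assumes "\<forall>q. \<forall>\<^sub>F j in sequentially. Q q j" "\<forall>q q' j. q \<le> q' \<longrightarrow> Q q' j \<longrightarrow> Q q j" "mono f"
  obtains r :: "nat \<Rightarrow> nat" where "strict_mono r" "\<forall>i j. i < j \<longrightarrow> Q (f (r i)) (r j)"
proof -
  have "\<exists>j. i < j \<and> Q (f i) j" for i
  proof -
    have "\<forall>\<^sub>F j in sequentially. i < j \<and> Q (f i) j"
      by (rule eventually_conj[OF eventually_gt_at_top assms(1)[rule_format]])
    then show ?thesis by (rule eventually_happens'[OF sequentially_bot])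
  qed
  then obtain g where g: "\<And>i. i < g i" "\<And>i. Q (f i) (g i)" by metis
  define r where "r = rec_nat 0 (\<lambda>_. g)"
  have r: "r (Suc j) = g (r j)" for j by (simp add: r_def)
  have mono: "strict_mono r" unfolding strict_mono_Suc_iff r using g(1) by blast
  have Qr: "Q (f (r i)) (r j)" if ij: "i < j" for i j
  proof -
    obtain k where k: "j = Suc k" "i \<le> k" using ij by (cases j) auto
    have "f (r i) \<le> f (r k)"
      using assms(3) k(2) strict_mono_less_eq[OF mono] by (simp add: monoD)
    moreover have "Q (f (r k)) (r j)" unfolding k(1) r by (rule g(2))
    ultimately show ?thesis by (rule assms(2)[rule_format])
  qed
  show ?thesis using that[OF mono] Qr by blast
qed

text \<open>The sets are disjoint, so only finitely many of them have a point up to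
  \<open>q\<close>, and each of them is finite. A block that starts late enough is therefore missed
  by all functionals reaching an earlier block.\<close>

lemma s_set_bounded:
  assumes "infinite \<sigma>"
  shows "\<exists>M. \<forall>k\<ge>1. (\<exists>i\<in>s_set n \<gamma> \<sigma> k. i \<le> q) \<longrightarrow> s_set n \<gamma> \<sigma> k \<subseteq> {..M}"
proof -
  let ?K = "{k. 1 \<le> k \<and> (\<exists>i\<in>s_set n \<gamma> \<sigma> k. i \<le> q)}"
  have "\<exists>w. \<forall>k\<in>?K. w k \<in> s_set n \<gamma> \<sigma> k \<and> w k \<le> q" by (rule bchoice) blast
  then obtain w where w: "\<And>k. k \<in> ?K \<Longrightarrow> w k \<in> s_set n \<gamma> \<sigma> k \<and> w k \<le> q" by blast
  have "inj_on w ?K"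
  proof (rule inj_onI)
    fix a b assume ab: "a \<in> ?K" "b \<in> ?K" "w a = w b"
    have "\<not> a < b" "\<not> b < a"
      using s_set_successive[OF assms, of a b "w a" n \<gamma> "w b"]
        s_set_successive[OF assms, of b a "w b" n \<gamma> "w a"] w[OF ab(1)] w[OF ab(2)] ab by auto
    then show "a = b" by simp
  qed
  moreover have "w ` ?K \<subseteq> {..q}" using w by blast
  ultimately have "finite ?K" by (meson finite_atMost inj_on_finite)
  then have "finite (\<Union>k\<in>?K. s_set n \<gamma> \<sigma> k)" using s_set_finite[OF assms] by blast
  then obtain M where "(\<Union>k\<in>?K. s_set n \<gamma> \<sigma> k) \<subseteq> {..M}"
    using finite_nat_iff_bounded_le by blast
  then show ?thesis by (intro exI[of _ M]) blast
qed

text \<open>A greedy recursion in which the tolerance may depend on the point where the next vector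
  has to begin. The divisor anticipates the factor \<open>sqrt (p j)\<close> in
  \<open>c0_bound\<close>; its 1 keeps it positive at \<open>p 0 = 0\<close>. The companion
  \<open>y j\<close> leaves room for a vector of \<open>Y\<close> approximated by
  \<open>x j\<close>.\<close>

lemma block_building:
  fixes Pr :: "real \<Rightarrow> 'b \<Rightarrow> (nat \<Rightarrow> real) \<Rightarrow> bool"
  assumes "\<And>q d. 0 < d \<Longrightarrow> \<exists>y. \<exists>x\<in>c00. (\<forall>i. x i \<noteq> 0 \<longrightarrow> q < i) \<and> Pr d y x"
  obtains p y x where "block p x" "\<And>j. Pr ((1 / 2) ^ j / (sqrt (real (p j)) + 1)) (y j) (x j)"
proof -
  \<comment> \<open>The triple consists of the companion, the vector and an end of its range, which
    is the next starting point.\<close>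
  let ?C = "\<lambda>q d t. fst (snd t) \<in> c00 \<and> q < snd (snd t) \<and>
      (\<forall>i. fst (snd t) i \<noteq> 0 \<longrightarrow> q < i \<and> i \<le> snd (snd t)) \<and> Pr d (fst t) (fst (snd t))"
  have "\<exists>t :: 'b \<times> (nat \<Rightarrow> real) \<times> nat. ?C q d t" if d: "0 < d" for q d
  proof -
    obtain y x where x: "x \<in> c00" "\<forall>i. x i \<noteq> 0 \<longrightarrow> q < i" "Pr d y x" using assms[OF d] by blast
    obtain M where M: "{i. x i \<noteq> 0} \<subseteq> {..M}"
      using c00_finite[OF x(1)] finite_nat_iff_bounded_le by blast
    have "q < i \<and> i \<le> max M (Suc q)" if "x i \<noteq> 0" for i
      using x(2) that subsetD[OF M, of i] by simp
    moreover have "q < max M (Suc q)" by simp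
    ultimately have "?C q d (y, x, max M (Suc q))" using x(1,3) by simp
    then show ?thesis by (rule exI)
  qed
  then have F: "?C q d (SOME t. ?C q d t)" if "0 < d" for q d
    using that by (intro someI_ex[of "?C q d"])
  define Y X Z where "Y q d = fst (SOME t. ?C q d t)" and "X q d = fst (snd (SOME t. ?C q d t))"
    and "Z q d = snd (snd (SOME t. ?C q d t))" for q d
  have F: "X q d \<in> c00 \<and> q < Z q d \<and>
      (\<forall>i. X q d i \<noteq> 0 \<longrightarrow> q < i \<and> i \<le> Z q d) \<and> Pr d (Y q d) (X q d)" if "0 < d" for q d
    unfolding X_def Y_def Z_def by (rule F[OF that])
  define e where "e j q = (1 / 2) ^ j / (sqrt (real q) + 1)" for j q
  have e: "0 < e j q" for j q unfolding e_def by (intro divide_pos_pos add_nonneg_pos) auto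
  define p where "p = rec_nat 0 (\<lambda>j q. Z q (e j q))"
  have p: "p (Suc j) = Z (p j) (e j (p j))" for j by (simp add: p_def)
  let ?x = "\<lambda>j. X (p j) (e j (p j))" and ?y = "\<lambda>j. Y (p j) (e j (p j))"
  have "block p ?x"
    unfolding block_def strict_mono_Suc_iff p using F[OF e, of "p _"] by simp
  moreover have "Pr ((1 / 2) ^ j / (sqrt (real (p j)) + 1)) (?y j) (?x j)" for j
    using F[OF e[of j "p j"], of "p j"] unfolding e_def by blast
  ultimately show ?thesis by (rule that)
qed

lemma block_eps_bounds:
  fixes q j :: nat
  defines "e \<equiv> (1 / 2) ^ j / (sqrt (real q) + 1)"
  shows "0 < e" "e \<le> (1 / 2) ^ j" "e \<le> 1" "e * sqrt (real q) \<le> (1 / 2) ^ j"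
proof -
  have s: "1 \<le> sqrt (real q) + 1" by simp
  then have s0: "0 < sqrt (real q) + 1" by linarith
  then show "0 < e" unfolding e_def by (intro divide_pos_pos) simp_all
  have "(1 / 2) ^ j / (sqrt (real q) + 1) \<le> (1 / 2 :: real) ^ j / 1"
    by (rule divide_left_mono[OF s]) (use s0 in simp_all)
  then show le: "e \<le> (1 / 2) ^ j" unfolding e_def by simp
  also have "\<dots> \<le> 1" by (simp add: power_le_one)
  finally show "e \<le> 1" .
  have "e * sqrt (real q) \<le> e * (sqrt (real q) + 1)" using \<open>0 < e\<close> by simp
  also have "\<dots> = (1 / 2) ^ j" unfolding e_def using s0 by simp
  finally show "e * sqrt (real q) \<le> (1 / 2) ^ j" .
qed

context jt_tree
begin

lemma pairing_phi_restrict: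
  assumes "infinite \<sigma>" "x \<in> c00"
  shows "pairing (ph \<sigma> k) (restrict_to \<sigma> x) = pairing (ph \<sigma> k) x"
proof -
  have "restrict_to \<sigma> (ph \<sigma> k) = ph \<sigma> k"
    using phi_support s_set_subset[OF assms(1)] by (intro restrict_eqI) blast
  then show ?thesis by (metis pairing_restrict[OF assms(2)])
qed

lemma segment_norm_le_branch_norm:
  assumes "\<sigma> \<in> branches D R" "x \<in> c00" "ivl E" "s = \<sigma> \<inter> E"
  shows "sn s x \<le> bn \<sigma> x"
proof -
  note inf = branch_infinite[OF assms(1)]
  have "sn s x = bn \<sigma> (restrict_to E (restrict_to \<sigma> x))"
    using segment_norm_eq[OF assms(1) _ assms(2), of s] assms(4)
    by (simp add: restrict_restrict Int_commute)
  also have "\<dots> \<le> bn \<sigma> (restrict_to \<sigma> x)"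
    by (rule branch_norm_restrict[OF inf c00_restrict[OF assms(2)] assms(3)])
  also have "\<dots> \<le> bn \<sigma> x"
  proof (rule branch_norm_le[OF c00_restrict[OF assms(2)]])
    fix F N assume F: "ivl F"
    have "restrict_to F (restrict_to \<sigma> x) = restrict_to \<sigma> (restrict_to F x)"
      by (simp add: restrict_restrict Int_commute)
    then have "phn \<sigma> N (restrict_to F (restrict_to \<sigma> x)) = phn \<sigma> N (restrict_to F x)"
      by (simp add: phn_def pairing_phi_restrict[OF inf c00_restrict[OF assms(2)]])
    then show "phn \<sigma> N (restrict_to F (restrict_to \<sigma> x)) \<le> bn \<sigma> x"
      using phn_le_branch_norm[OF inf assms(2) F] by simp
  qed
  finally show ?thesis .
qed

lemma JN_le_l1: "x \<in> c00 \<Longrightarrow> JN x \<le> l1 x"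
proof (rule JN_le)
  assume x: "x \<in> c00"
  fix i show "\<bar>x i\<bar> \<le> l1 x"
  proof (cases "x i = 0")
    case False
    then show ?thesis unfolding l1_def
      using member_le_sum[of i "{i. x i \<noteq> 0}" "\<lambda>i. \<bar>x i\<bar>"] c00_finite[OF x] by simp
  qed (simp add: l1_nonneg)
next
  assume x: "x \<in> c00"
  fix A assume "adm A"
  then show "L2_set (\<lambda>s. sn s x) A \<le> l1 x" using x by (rule L2_segment_norm_le_l1)
qed

text \<open>Since \<open>P\<close> is closed towards the root, a segment runs through
  \<open>P\<close> first and, once outside, never returns. Its part in \<open>P\<close> lies below a
  single node of one branch in \<open>B\<close>, hence on that branch; the rest is a segment
  starting off \<open>P\<close>.\<close>

lemma segment_split_subtree:
  assumes "s \<in> segments D R" "B \<subseteq> branches D R" "P \<subseteq> D" "P \<subseteq> \<Union>B"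
    and down: "\<forall>a t. t \<in> P \<longrightarrow> a \<in> D \<longrightarrow> (a, t) \<in> R \<longrightarrow> a \<in> P"
  shows "s \<inter> P \<noteq> {} \<Longrightarrow> \<exists>\<sigma>\<in>B. \<forall>x\<in>c00. sn (s \<inter> P) x \<le> bn \<sigma> x"
    and "s - P \<noteq> {} \<Longrightarrow> s - P \<in> segments D R"
    and "a \<in> s \<inter> P \<Longrightarrow> b \<in> s - P \<Longrightarrow> a < b"
    and "x \<in> c00 \<Longrightarrow> sn s x \<le> sn (s \<inter> P) x + sn (s - P) x"
proof -
  note ch = segment_tchain[OF assms(1)] and fin = segment_finite[OF assms(1)]
    and sD = segment_subset_D[OF assms(1)]
  show less: "a < b" if ab: "a \<in> s \<inter> P" "b \<in> s - P" for a b
  proof (rule ccontr)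
    assume "\<not> a < b"
    then have "(b, a) \<in> R" using tchain_le[OF ch, of b a] ab by simp
    then have "b \<in> P" using down ab sD by blast
    then show False using ab by blast
  qed
  show "sn s x \<le> sn (s \<inter> P) x + sn (s - P) x" if "x \<in> c00"
    by (rule segment_norm_split[OF ch that]) blast+
  show "s - P \<in> segments D R" if ne: "s - P \<noteq> {}"
  proof -
    define a b where "a = Min (s - P)" and "b = Max s"
    have f: "finite (s - P)" using fin by simp
    have a: "a \<in> s - P" "\<And>k. k \<in> s - P \<Longrightarrow> a \<le> k"
      unfolding a_def using Min_in[OF f ne] Min_le[OF f] by simp_all
    have sne: "s \<noteq> {}" using ne by blast
    have b: "b \<in> s" "\<And>k. k \<in> s \<Longrightarrow> k \<le> b"
      unfolding b_def using Max_in[OF fin sne] Max_ge[OF fin] by simp_all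
    have "s - P = s \<inter> {a..b}"
    proof (intro equalityI subsetI)
      fix k assume "k \<in> s - P"
      then show "k \<in> s \<inter> {a..b}" using a(2) b(2) by simp
    next
      fix k assume k: "k \<in> s \<inter> {a..b}"
      have "k \<notin> P" using less[of k a] k a(1) by auto
      then show "k \<in> s - P" using k by blast
    qed
    moreover have "s \<inter> {a..b} \<in> segments D R"
      using a(1) b by (intro segment_cut(1)[OF assms(1)]) simp_all
    ultimately show ?thesis by simp
  qed
  show "\<exists>\<sigma>\<in>B. \<forall>x\<in>c00. sn (s \<inter> P) x \<le> bn \<sigma> x" if ne: "s \<inter> P \<noteq> {}"
  proof -
    define a b where "a = Min s" and "b = Max (s \<inter> P)"
    have f: "finite (s \<inter> P)" using fin by simp
    have sne: "s \<noteq> {}" using ne by blast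
    have a: "a \<in> s" "\<And>k. k \<in> s \<Longrightarrow> a \<le> k"
      unfolding a_def using Min_in[OF fin sne] Min_le[OF fin] by simp_all
    have b: "b \<in> s \<inter> P" "\<And>k. k \<in> s \<inter> P \<Longrightarrow> k \<le> b"
      unfolding b_def using Max_in[OF f ne] f by simp_all
    have eq: "s \<inter> P = s \<inter> {a..b}"
    proof (intro equalityI subsetI)
      fix k assume "k \<in> s \<inter> P"
      then show "k \<in> s \<inter> {a..b}" using a(2) b(2) by simp
    next
      fix k assume k: "k \<in> s \<inter> {a..b}"
      have "k \<in> P" using less[OF b(1), of k] k by auto
      then show "k \<in> s \<inter> P" using k by blast
    qed
    have seg: "s \<inter> P \<in> segments D R"
      unfolding eq using a b(1) by (intro segment_cut(1)[OF assms(1)]) simp_all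
    obtain \<sigma> where \<sigma>: "\<sigma> \<in> B" "b \<in> \<sigma>" using b(1) assms(4) by blast
    have \<sigma>b: "\<sigma> \<in> branches D R" using \<sigma>(1) assms(2) by blast
    have "s \<inter> P \<subseteq> \<sigma>"
    proof
      fix k assume k: "k \<in> s \<inter> P"
      have "(k, b) \<in> R" using tchain_le[OF ch] k b by blast
      then show "k \<in> \<sigma>" using branch_down[OF \<sigma>b \<sigma>(2)] k sD by blast
    qed
    from segment_branch_interval[OF seg \<sigma>b this]
    have "sn (s \<inter> P) x \<le> bn \<sigma> x" if "x \<in> c00" for x
      using segment_norm_le_branch_norm[OF \<sigma>b that ivl_atLeastAtMost] by blast
    then show ?thesis using \<sigma>(1) by blast
  qed
qed

lemma sum_coords_le:
  assumes "block p x" "\<And>j. JN (x j) \<le> 2" "finite J"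
  shows "\<bar>\<Sum>j\<in>J. c * x j i\<bar> \<le> 2 * \<bar>c\<bar>"
  using block_sum_coord[OF block_scale[OF assms(1), of "\<lambda>_. c"] assms(3), of i]
proof
  assume "\<exists>j\<in>J. (\<Sum>j\<in>J. c * x j i) = c * x j i"
  then obtain j where j: "(\<Sum>j\<in>J. c * x j i) = c * x j i" by blast
  have "\<bar>x j i\<bar> \<le> 2"
    using abs_coord_le_JN[OF block_c00[OF assms(1)], of j i] assms(2)[of j] by linarith
  then have "\<bar>c\<bar> * \<bar>x j i\<bar> \<le> \<bar>c\<bar> * 2" by (rule mult_left_mono) simp
  then show ?thesis unfolding j abs_mult by simp
qed simp

text \<open>Long averages of a sparse block subsequence are small in the supremum norm and on every
  segment: on the exceptional branches by the \<open>\<ell>\<^sub>2\<close> structure, and off them because a segment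
  meets at most one block in a large piece.\<close>

lemma block_average:
  assumes "block p x" "\<And>j. JN (x j) \<le> 2" "\<epsilon> > 0"
  obtains J where "finite J" "J \<noteq> {}" "\<And>j. j \<in> J \<Longrightarrow> q \<le> p j"
    "\<And>i. \<bar>\<Sum>j\<in>J. (1 / real (card J)) * x j i\<bar> \<le> \<epsilon>"
    "\<And>s. s \<in> segments D R \<Longrightarrow> sn s (\<lambda>i. \<Sum>j\<in>J. (1 / real (card J)) * x j i) \<le> \<epsilon>"
proof -
  have e2: "\<epsilon> / 2 > 0" using assms(3) by simp
  obtain r P B where r: "strict_mono r" and B: "finite B" "B \<subseteq> branches D R" and P: "P \<subseteq> D" "P \<subseteq> \<Union>B"
    and down: "\<And>a t. t \<in> P \<Longrightarrow> a \<in> D \<Longrightarrow> (a, t) \<in> R \<Longrightarrow> a \<in> P"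
    and late: "\<And>t. t \<in> D - P \<Longrightarrow>
      \<forall>\<^sub>F j in sequentially. \<forall>s\<in>segments D R. Min s = t \<longrightarrow> sn s (x (r j)) \<le> \<epsilon> / 2"
    by (rule block_selection[OF assms(1,2) e2]) blast
  note blr = block_subseq[OF assms(1) r]
  \<comment> \<open>To be used with \<open>q\<close> the end of an earlier block. The first clause
    makes segments starting off \<open>P\<close> up to there small on the new block; the second
    makes functionals of the exceptional branches with a support point up to there stop before the
    new block begins.\<close>
  define Q where "Q q j \<longleftrightarrow>
      (\<forall>t\<in>{t \<in> D - P. t \<le> q}. \<forall>s\<in>segments D R. Min s = t \<longrightarrow> sn s (x (r j)) \<le> \<epsilon> / 2) \<and>
      (\<forall>\<sigma>\<in>B. \<forall>k\<ge>1. (\<exists>i\<in>s_set n \<gamma> \<sigma> k. i \<le> q) \<longrightarrow> s_set n \<gamma> \<sigma> k \<subseteq> {..p (r j)})" for q j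
  have Qev: "\<forall>\<^sub>F j in sequentially. Q q j" for q
    unfolding Q_def
  proof (rule eventually_conj)
    have "finite {t \<in> D - P. t \<le> q}" by (rule finite_subset[of _ "{..q}"]) auto
    then show "\<forall>\<^sub>F j in sequentially. \<forall>t\<in>{t \<in> D - P. t \<le> q}. \<forall>s\<in>segments D R.
        Min s = t \<longrightarrow> sn s (x (r j)) \<le> \<epsilon> / 2"
      by (rule eventually_ball_finite) (use late in blast)
    show "\<forall>\<^sub>F j in sequentially. \<forall>\<sigma>\<in>B. \<forall>k\<ge>1. (\<exists>i\<in>s_set n \<gamma> \<sigma> k. i \<le> q) \<longrightarrow>
        s_set n \<gamma> \<sigma> k \<subseteq> {..p (r j)}"
    proof (rule eventually_ball_finite[OF B(1)], rule ballI)
      fix \<sigma> assume "\<sigma> \<in> B"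
      then have "infinite \<sigma>" using B(2) branch_infinite by blast
      from s_set_bounded[OF this] obtain M where
        M: "\<forall>k\<ge>1. (\<exists>i\<in>s_set n \<gamma> \<sigma> k. i \<le> q) \<longrightarrow> s_set n \<gamma> \<sigma> k \<subseteq> {..M}" by blast
      show "\<forall>\<^sub>F j in sequentially. \<forall>k\<ge>1. (\<exists>i\<in>s_set n \<gamma> \<sigma> k. i \<le> q) \<longrightarrow>
          s_set n \<gamma> \<sigma> k \<subseteq> {..p (r j)}"
        using eventually_ge_at_top[of M]
      proof (rule eventually_mono)
        fix j assume "M \<le> j"
        then have "M \<le> p (r j)"
          using strict_mono_imp_increasing[OF block_strict_mono[OF blr], of j] by simp
        then have "{..M} \<subseteq> {..p (r j)}" by auto
        then show "\<forall>k\<ge>1. (\<exists>i\<in>s_set n \<gamma> \<sigma> k. i \<le> q) \<longrightarrow> s_set n \<gamma> \<sigma> k \<subseteq> {..p (r j)}"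
          using M by (meson subset_trans)
      qed
    qed
  qed
  have Qmono: "\<forall>q q' j. q \<le> q' \<longrightarrow> Q q' j \<longrightarrow> Q q j"
  proof (intro allI impI)
    fix q q' j assume that: "q \<le> q'" "Q q' j"
    show "Q q j"
      unfolding Q_def
    proof (intro conjI ballI allI impI)
      fix t s assume "t \<in> {t \<in> D - P. t \<le> q}" "s \<in> segments D R" "Min s = t"
      moreover from this(1) have "t \<in> {t \<in> D - P. t \<le> q'}" using that(1) by simp
      ultimately show "sn s (x (r j)) \<le> \<epsilon> / 2" using that(2) unfolding Q_def by blast
    next
      fix \<sigma> k assume "\<sigma> \<in> B" "1 \<le> k" "\<exists>i\<in>s_set n \<gamma> \<sigma> k. i \<le> q"
      moreover from this(3) have "\<exists>i\<in>s_set n \<gamma> \<sigma> k. i \<le> q'" using that(1) le_trans by blast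
      ultimately show "s_set n \<gamma> \<sigma> k \<subseteq> {..p (r j)}" using that(2) unfolding Q_def by blast
    qed
  qed
  have fmono: "mono (\<lambda>j. p (Suc (r j)))"
    by (intro monoI)
      (simp add: strict_mono_less_eq[OF block_strict_mono[OF assms(1)]] strict_mono_less_eq[OF r])
  obtain r' :: "nat \<Rightarrow> nat" where
    r': "strict_mono r'" and Q: "\<forall>i j. i < j \<longrightarrow> Q (p (Suc (r (r' i)))) (r' j)"
    by (rule eventually_thinning[OF allI[OF Qev] Qmono fmono])
  define g where "g j = r (r' j)" for j :: nat
  define z where "z j = x (g j)" for j :: nat
  have bz: "block (\<lambda>j. p (g j)) z"
    unfolding z_def g_def using block_subseq[OF blr r'] .
  note zc = block_c00[OF bz]
  have z2: "JN (z j) \<le> 2" for j unfolding z_def by (rule assms(2))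
  have zend: "l \<le> p (Suc (g j))" if "z j l \<noteq> 0" for j l
    using block_le[OF assms(1)] that unfolding z_def by blast
  have Qt: "sn s (z j) \<le> \<epsilon> / 2"
    if "i < j" "s \<in> segments D R" "Min s \<in> D - P" "Min s \<le> p (Suc (g i))" for i j s
    using Q[rule_format, OF that(1)] that(2-4) unfolding Q_def z_def g_def by blast
  have Qs: "s_set n \<gamma> \<sigma> k \<subseteq> {..p (g j)}"
    if "i < j" "\<sigma> \<in> B" "1 \<le> k" "l \<in> s_set n \<gamma> \<sigma> k" "l \<le> p (Suc (g i))" for i j \<sigma> k l
    using Q[rule_format, OF that(1)] that(2-5) unfolding Q_def g_def by blast
  \<comment> \<open>The final bound is \<epsilon> / 2 + 6 / sqrt K + 2 / K. Exceptional branches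
    account for 6 / sqrt K: 2 / sqrt K by orthogonality and 4 / K for two cut blocks. A single block
    that is large off \<open>P\<close> accounts for 2 / K. This choice makes 8 / sqrt K at most
    \<epsilon> / 2.\<close>
  obtain K :: nat where K: "(16 / \<epsilon>)\<^sup>2 < K" using reals_Archimedean2 by blast
  then have "0 < real K" using zero_le_power2[of "16 / \<epsilon>"] by linarith
  then have K0: "0 < K" by simp
  have sK: "16 / \<epsilon> \<le> sqrt K" using K by (intro real_le_rsqrt) simp
  have sK1: "1 \<le> sqrt K" using K0 by simp
  have Kinv: "1 / K \<le> 1 / sqrt K"
  proof -
    have "sqrt K * 1 \<le> sqrt K * sqrt K" using sK1 by (intro mult_left_mono) auto
    then have "sqrt K \<le> K" by simp
    then show ?thesis using K0 by (intro divide_left_mono) auto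
  qed
  have Kr: "8 / sqrt K \<le> \<epsilon> / 2"
    using sK assms(3) K0 by (simp add: field_simps)
  let ?J = "{q..<q + K}"
  let ?v = "\<lambda>i. \<Sum>j\<in>?J. (1 / real K) * z j i"
  have vc: "?v \<in> c00" by (intro c00_sum c00_scale zc)
  have sup: "\<bar>?v i\<bar> \<le> \<epsilon>" for i
  proof -
    have "\<bar>?v i\<bar> \<le> 2 * \<bar>1 / real K\<bar>" by (rule sum_coords_le[OF bz z2]) simp
    also have "\<dots> = 2 * (1 / K)" by simp
    finally have "\<bar>?v i\<bar> \<le> 2 * (1 / K)" .
    moreover have "8 * (1 / sqrt K) \<le> \<epsilon> / 2" using Kr by simp
    moreover have "0 \<le> 1 / sqrt K" by simp
    ultimately show ?thesis using Kinv assms(3) by linarith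
  qed
  have branch: "bn \<sigma> ?v \<le> 6 / sqrt K" if \<sigma>: "\<sigma> \<in> B" for \<sigma>
  proof -
    have \<sigma>b: "\<sigma> \<in> branches D R" using \<sigma> B(2) by blast
    have "bn \<sigma> ?v \<le> 2 / sqrt K + 4 * (1 / K)"
    proof (rule branch_norm_block_sum[OF bz z2 \<sigma>b])
      fix J' N assume J': "J' \<subseteq> ?J"
      have fJ': "finite J'" using J' finite_subset by blast
      have "phn \<sigma> N (\<lambda>i. \<Sum>j\<in>J'. (1 / real K) * z j i) \<le> sqrt (card J') * (2 / K)"
      proof (rule phn_sum_disjoint[OF c00_scale[OF zc] fJ'])
        fix j
        have "(1 / K) * phn \<sigma> N (z j) \<le> (1 / K) * 2"
          using phn_le_JN[OF \<sigma>b zc, of N j] z2[of j] by (intro mult_left_mono) auto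
        then show "phn \<sigma> N (\<lambda>i. (1 / real K) * z j i) \<le> 2 / K" unfolding phn_scale by simp
      next
        fix k i j assume k: "1 \<le> k"
          and ij: "pairing (ph \<sigma> k) (\<lambda>l. (1 / real K) * z i l) \<noteq> 0"
            "pairing (ph \<sigma> k) (\<lambda>l. (1 / real K) * z j l) \<noteq> 0"
        have nz: "\<exists>l. z i l \<noteq> 0 \<and> l \<in> s_set n \<gamma> \<sigma> k"
          if "pairing (ph \<sigma> k) (\<lambda>l. (1 / real K) * z i l) \<noteq> 0" for i
        proof (rule ccontr)
          assume "\<not> ?thesis"
          then have zero: "ph \<sigma> k l * ((1 / real K) * z i l) = 0" for l
            using phi_support[of m n \<gamma> \<sigma> k l] by auto
          have "pairing (ph \<sigma> k) (\<lambda>l. (1 / real K) * z i l) = 0"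
            unfolding pairing_def by (intro sum.neutral ballI zero)
          then show False using that by blast
        qed
        have False if "i < j" "z i l \<noteq> 0" "l \<in> s_set n \<gamma> \<sigma> k" "z j l' \<noteq> 0" "l' \<in> s_set n \<gamma> \<sigma> k" for i j l l'
          using Qs[OF that(1) \<sigma> k that(3) zend[OF that(2)]] block_gt[OF bz that(4)] that(5) by auto
        then show "i = j" using nz[OF ij(1)] nz[OF ij(2)] by (meson linorder_neqE_nat)
      qed simp
      also have "\<dots> \<le> sqrt K * (2 / K)"
        using card_mono[OF _ J'] by (intro mult_right_mono) auto
      also have "\<dots> = 2 / sqrt K" using K0 by (simp add: field_simps)
      finally show "phn \<sigma> N (\<lambda>i. \<Sum>j\<in>J'. (1 / real K) * z j i) \<le> 2 / sqrt K" .
    qed simp_all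
    also have "\<dots> \<le> 6 / sqrt K" using Kinv by simp
    finally show ?thesis .
  qed
  have off: "sn s ?v \<le> \<epsilon> / 2 + 2 / K" if s: "s \<in> segments D R" "Min s \<in> D - P" for s
  proof -
    note ch = segment_tchain[OF s(1)]
    define t where "t = Min s"
    \<comment> \<open>Blocks ending before \<open>t\<close> vanish on \<open>s\<close>, and a block
      with an earlier one reaching up to \<open>t\<close> is small by the thinning. What remains is
      at most one index, the first block not ending before \<open>t\<close>.\<close>
    let ?c = "\<lambda>j. if t \<le> p (Suc (g j)) \<and> (\<forall>i<j. p (Suc (g i)) < t) then 2 else (0::real)"
    have each: "sn s (z j) \<le> \<epsilon> / 2 + ?c j" for j
    proof -
      consider "p (Suc (g j)) < t" | i where "i < j" "t \<le> p (Suc (g i))"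
        | "t \<le> p (Suc (g j)) \<and> (\<forall>i<j. p (Suc (g i)) < t)" by (meson not_le)
      then show ?thesis
      proof cases
        case 1
        have "z j i = 0" if "i \<in> s" for i
          using Min_le[OF segment_finite[OF s(1)] that] zend[of j i] 1 unfolding t_def by linarith
        then have "sn s (z j) = 0" by (rule segment_norm_zero[OF ch _ zc])
        then show ?thesis using assms(3) by simp
      next
        case 2
        then show ?thesis using Qt[OF _ s, of i j] unfolding t_def by (simp add: add_increasing2)
      next
        case 3
        then show ?thesis using segment_norm_le_JN[OF s(1) zc, of j] z2[of j] assms(3) by simp
      qed
    qed
    have "(\<Sum>j\<in>?J. ?c j) \<le> 2"
    proof (cases "\<exists>j\<in>?J. t \<le> p (Suc (g j)) \<and> (\<forall>i<j. p (Suc (g i)) < t)")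
      case True
      then obtain j where j: "j \<in> ?J" "t \<le> p (Suc (g j))" "\<forall>i<j. p (Suc (g i)) < t" by blast
      have z: "?c i = 0" if "i \<in> ?J - {j}" for i
      proof -
        have "i < j \<or> j < i" using that by auto
        then have "\<not> (t \<le> p (Suc (g i)) \<and> (\<forall>k<i. p (Suc (g k)) < t))"
          using j(2,3) by (meson not_le)
        then show ?thesis by (rule if_not_P)
      qed
      have "(\<Sum>j\<in>?J. ?c j) = (\<Sum>j\<in>{j}. ?c j)"
        using j(1) z by (intro sum.mono_neutral_right) blast+
      then show ?thesis by simp
    next
      case False
      then have "(\<Sum>j\<in>?J. ?c j) = 0" by (intro sum.neutral) auto
      then show ?thesis by simp
    qed
    then have sc: "(1 / K) * (\<Sum>j\<in>?J. ?c j) \<le> (1 / K) * 2" by (intro mult_left_mono) auto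
    have "sn s ?v \<le> (\<Sum>j\<in>?J. sn s (\<lambda>i. (1 / real K) * z j i))"
      by (rule segment_norm_sum[OF ch c00_scale[OF zc]])
    also have "\<dots> \<le> (\<Sum>j\<in>?J. (1 / K) * (\<epsilon> / 2 + ?c j))"
    proof (rule sum_mono)
      fix j
      have "sn s (\<lambda>i. (1 / real K) * z j i) \<le> \<bar>1 / real K\<bar> * sn s (z j)"
        by (rule segment_norm_scale_le[OF ch zc])
      also have "\<dots> \<le> (1 / K) * (\<epsilon> / 2 + ?c j)"
        using mult_left_mono[OF each[of j], of "1 / K"] by simp
      finally show "sn s (\<lambda>i. (1 / real K) * z j i) \<le> (1 / K) * (\<epsilon> / 2 + ?c j)" .
    qed
    also have "\<dots> = (1 / K) * (\<Sum>j\<in>?J. \<epsilon> / 2 + ?c j)" by (simp only: sum_distrib_left)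
    also have "\<dots> = (1 / K) * (K * (\<epsilon> / 2)) + (1 / K) * (\<Sum>j\<in>?J. ?c j)"
      by (simp add: sum.distrib distrib_left)
    also have "\<dots> \<le> \<epsilon> / 2 + (1 / K) * 2" using sc K0 by simp
    finally show ?thesis by simp
  qed
  have seg: "sn s ?v \<le> \<epsilon>" if s: "s \<in> segments D R" for s
  proof -
    have "\<forall>a t. t \<in> P \<longrightarrow> a \<in> D \<longrightarrow> (a, t) \<in> R \<longrightarrow> a \<in> P" using down by blast
    note split = segment_split_subtree[OF s B(2) P this]
    have "sn (s \<inter> P) ?v \<le> 6 / sqrt K"
    proof (cases "s \<inter> P = {}")
      case True
      then have "sn (s \<inter> P) ?v = 0" by (intro segment_norm_zero vc) (auto simp: tchain_def)
      then show ?thesis by simp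
    next
      case False
      then obtain \<sigma> where "\<sigma> \<in> B" "sn (s \<inter> P) ?v \<le> bn \<sigma> ?v" using split(1) vc by blast
      then show ?thesis using branch[of \<sigma>] by linarith
    qed
    moreover have "sn (s - P) ?v \<le> \<epsilon> / 2 + 2 / K"
    proof (cases "s - P = {}")
      case True
      then have "sn (s - P) ?v = 0" by (intro segment_norm_zero vc) (auto simp: tchain_def)
      then show ?thesis using assms(3) by simp
    next
      case False
      have m: "s - P \<in> segments D R" by (rule split(2)[OF False])
      show ?thesis using off[OF m] segment_Min[OF m] segment_subset_D[OF s] by blast
    qed
    ultimately have "sn s ?v \<le> 6 / sqrt K + (\<epsilon> / 2 + 2 * (1 / K))" using split(4)[OF vc] by simp
    also have "\<dots> \<le> 6 / sqrt K + (\<epsilon> / 2 + 2 * (1 / sqrt K))" using Kinv by simp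
    also have "\<dots> \<le> \<epsilon>" using Kr by simp
    finally show ?thesis .
  qed
  have inj: "inj_on g ?J"
  proof -
    have "strict_mono g" unfolding g_def using strict_monoD[OF r] strict_monoD[OF r']
      by (intro strict_monoI) blast
    then show ?thesis by (rule strict_mono_imp_inj_on)
  qed
  have cardg: "card (g ` ?J) = K" by (simp add: card_image[OF inj])
  have sumg: "(\<Sum>j\<in>g ` ?J. (1 / real (card (g ` ?J))) * x j i) = ?v i" for i
    unfolding cardg by (simp add: sum.reindex[OF inj] z_def)
  show ?thesis
  proof (rule that[of "g ` ?J"])
    show "g ` ?J \<noteq> {}" using K0 by auto
    fix j assume "j \<in> g ` ?J"
    then obtain i where i: "q \<le> i" "j = g i" by auto
    then show "q \<le> p j"
      using strict_mono_imp_increasing[OF block_strict_mono[OF bz], of i] by simp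
  next
    show "\<bar>\<Sum>j\<in>g ` ?J. (1 / real (card (g ` ?J))) * x j i\<bar> \<le> \<epsilon>" for i unfolding sumg by (rule sup)
    show "sn s (\<lambda>i. \<Sum>j\<in>g ` ?J. (1 / real (card (g ` ?J))) * x j i) \<le> \<epsilon>"
      if "s \<in> segments D R" for s unfolding sumg by (rule seg[OF that])
  qed simp
qed

end

section \<open>Sequences in the completion\<close>

lemma coords_sum: "coords (\<Sum>j\<in>J. f j) i = (\<Sum>j\<in>J. coords (f j) i)"
  by (induction J rule: infinite_finite_induct) (simp_all add: plus_l2.rep_eq zero_l2.rep_eq)

lemma norm_sum_l2_unit:
  assumes "finite J"
  shows "norm (\<Sum>j\<in>J. l2_unit j) = sqrt (card J)"
proof -
  have c: "coords (\<Sum>j\<in>J. l2_unit j) i = (if i \<in> J then 1 else 0)" for i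
    using assms by (simp add: coords_sum l2_unit.rep_eq sum.delta')
  have "(\<Sum>i. (coords (\<Sum>j\<in>J. l2_unit j) i)\<^sup>2) = (\<Sum>i\<in>J. (coords (\<Sum>j\<in>J. l2_unit j) i)\<^sup>2)"
    by (rule suminf_finite[OF assms]) (simp add: c)
  also have "\<dots> = card J" by (simp add: c)
  finally show ?thesis by (simp add: norm_l2.rep_eq)
qed

lemma equivalent_l2_unit_lower:
  assumes "equivalent_sequences z l2_unit"
  obtains A where "A > 0" "\<And>J. finite J \<Longrightarrow> A * sqrt (card J) \<le> norm (\<Sum>j\<in>J. z j)"
proof -
  from assms obtain A where A: "A > 0" and le: "\<forall>a :: nat \<Rightarrow> real. finite {i. a i \<noteq> 0} \<longrightarrow>
      A * norm (\<Sum>i | a i \<noteq> 0. a i *\<^sub>R l2_unit i) \<le> norm (\<Sum>i | a i \<noteq> 0. a i *\<^sub>R z i)"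
    unfolding equivalent_sequences_def by blast
  have "A * sqrt (card J) \<le> norm (\<Sum>j\<in>J. z j)" if J: "finite J" for J
  proof -
    let ?a = "\<lambda>i. if i \<in> J then 1 else (0::real)"
    have s: "{i. ?a i \<noteq> 0} = J" by auto
    have "(\<Sum>i\<in>J. ?a i *\<^sub>R l2_unit i) = (\<Sum>i\<in>J. l2_unit i)" "(\<Sum>i\<in>J. ?a i *\<^sub>R z i) = (\<Sum>i\<in>J. z i)"
      by (auto intro: sum.cong)
    then show ?thesis using le[rule_format, of ?a] J unfolding s norm_sum_l2_unit[OF J, symmetric] by simp
  qed
  then show ?thesis by (rule that[OF A])
qed

section \<open>Bounded block sequences are weakly null\<close>

locale jt_space = jt_tree m n \<gamma> D R
  for m n \<gamma> :: "nat \<Rightarrow> nat" and D :: "nat set" and R :: "nat rel" +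
  fixes \<iota> :: "(nat \<Rightarrow> real) \<Rightarrow> 'a::banach"
  assumes completion: "is_completion (JT_norm m n \<gamma> D R) \<iota>"
begin

lemma io_add: "x \<in> c00 \<Longrightarrow> y \<in> c00 \<Longrightarrow> \<iota> (\<lambda>i. x i + y i) = \<iota> x + \<iota> y"
  using completion unfolding is_completion_def by blast

lemma io_scale: "x \<in> c00 \<Longrightarrow> \<iota> (\<lambda>i. c * x i) = c *\<^sub>R \<iota> x"
  using completion unfolding is_completion_def by blast

lemma norm_io: "x \<in> c00 \<Longrightarrow> norm (\<iota> x) = JN x"
  using completion unfolding is_completion_def by blast

lemma io_zero: "\<iota> (\<lambda>_. 0) = 0"
  using io_scale[OF c00_zero, of 0] by simp

lemma io_sum: "(\<And>j. j \<in> J \<Longrightarrow> x j \<in> c00) \<Longrightarrow> \<iota> (\<lambda>i. \<Sum>j\<in>J. x j i) = (\<Sum>j\<in>J. \<iota> (x j))"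
proof (induction J rule: infinite_finite_induct)
  case (insert j J)
  then show ?case by (simp add: io_add c00_sum)
qed (simp_all add: io_zero)

lemma io_dense:
  assumes "0 < e"
  obtains x where "x \<in> c00" "norm (y - \<iota> x) < e"
proof -
  have "y \<in> closure (\<iota> ` c00)" using completion unfolding is_completion_def by simp
  then obtain z where "z \<in> \<iota> ` c00" "dist z y < e" using assms closure_approachable by blast
  then show ?thesis using that by (auto simp: dist_norm norm_minus_commute)
qed

lemma JN_scale: "x \<in> c00 \<Longrightarrow> JN (\<lambda>i. c * x i) = \<bar>c\<bar> * JN x"
  using norm_scaleR[of c "\<iota> x"] by (simp add: norm_io[symmetric] c00_scale io_scale)

lemma JN_average_le:
  assumes "\<And>j. j \<in> J \<Longrightarrow> x j \<in> c00" "\<And>j. j \<in> J \<Longrightarrow> JN (x j) \<le> 2" "finite J" "J \<noteq> {}"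
  shows "JN (\<lambda>i. \<Sum>j\<in>J. (1 / real (card J)) * x j i) \<le> 2"
proof -
  have c: "(\<lambda>i. (1 / real (card J)) * x j i) \<in> c00" if "j \<in> J" for j using c00_scale assms(1) that by blast
  have "JN (\<lambda>i. \<Sum>j\<in>J. (1 / real (card J)) * x j i) = norm (\<Sum>j\<in>J. \<iota> (\<lambda>i. (1 / real (card J)) * x j i))"
    by (subst norm_io[symmetric, OF c00_sum[OF c]]) (simp_all only: io_sum[OF c])
  also have "\<dots> \<le> (\<Sum>j\<in>J. norm (\<iota> (\<lambda>i. (1 / real (card J)) * x j i)))" by (rule norm_sum)
  also have "\<dots> \<le> (\<Sum>j\<in>J. (1 / real (card J)) * 2)"
  proof (rule sum_mono)
    fix j assume j: "j \<in> J"
    have "norm (\<iota> (\<lambda>i. (1 / real (card J)) * x j i)) = (1 / real (card J)) * JN (x j)"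
      by (simp only: norm_io[OF c[OF j]] JN_scale[OF assms(1)[OF j]]) simp
    then show "norm (\<iota> (\<lambda>i. (1 / real (card J)) * x j i)) \<le> (1 / real (card J)) * 2"
      using assms(2)[OF j] by (simp only: mult_left_mono divide_nonneg_nonneg of_nat_0_le_iff zero_le_one)
  qed
  also have "\<dots> = 2" using assms(3,4) by simp
  finally show ?thesis .
qed

text \<open>Averages keep the lower bound on \<open>f\<close>, and by \<open>block_average\<close>
  they can be made small on every segment. Successive averages with rapidly decreasing segment norms
  have sums bounded by 4, while \<open>f\<close> grows linearly along these sums.\<close>

lemma block_no_lower_functional:
  fixes f :: "'a \<Rightarrow> real"
  assumes "block p x" "\<And>j. JN (x j) \<le> 2" "bounded_linear f" "\<delta> > 0" "\<And>j. \<delta> \<le> f (\<iota> (x j))"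
  shows False
proof -
  interpret f: bounded_linear f by (rule assms(3))
  note xc = block_c00[OF assms(1)]
  \<comment> \<open>The companion in \<open>block_building\<close> is a dummy here, since only
    blocks are constructed.\<close>
  define Pr where "Pr d (y :: unit) v \<longleftrightarrow>
      JN v \<le> 2 \<and> (\<forall>s\<in>segments D R. sn s v \<le> d) \<and> \<delta> \<le> f (\<iota> v)" for d y v
  have "\<exists>y. \<exists>v\<in>c00. (\<forall>i. v i \<noteq> 0 \<longrightarrow> q < i) \<and> Pr d y v" if d: "0 < d" for q d
  proof -
    obtain J where J: "finite J" "J \<noteq> {}" "\<And>j. j \<in> J \<Longrightarrow> q \<le> p j"
      and small: "\<And>s. s \<in> segments D R \<Longrightarrow> sn s (\<lambda>i. \<Sum>j\<in>J. (1 / real (card J)) * x j i) \<le> d"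
      by (rule block_average[OF assms(1,2) d, of q]) blast
    let ?v = "\<lambda>i. \<Sum>j\<in>J. (1 / real (card J)) * x j i"
    have vc: "?v \<in> c00" by (intro c00_sum c00_scale xc)
    have deep: "q < i" if v: "?v i \<noteq> 0" for i
    proof -
      obtain j where j: "j \<in> J" "(1 / real (card J)) * x j i \<noteq> 0"
        using v by (rule sum.not_neutral_contains_not_neutral)
      then have "p j < i" using block_gt[OF assms(1), of j i] by simp
      then show ?thesis using J(3)[OF j(1)] by simp
    qed
    have v2: "JN ?v \<le> 2" by (rule JN_average_le[OF xc assms(2) J(1,2)])
    have fv: "\<delta> \<le> f (\<iota> ?v)"
    proof -
      have "f (\<iota> ?v) = (\<Sum>j\<in>J. (1 / real (card J)) * f (\<iota> (x j)))"
        by (simp only: io_sum[OF c00_scale[OF xc]] io_scale[OF xc] f.sum f.scaleR real_scaleR_def)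
      moreover have "(\<Sum>j\<in>J. (1 / real (card J)) * \<delta>) \<le> (\<Sum>j\<in>J. (1 / real (card J)) * f (\<iota> (x j)))"
        by (intro sum_mono mult_left_mono assms(5)) simp
      moreover have "(\<Sum>j\<in>J. (1 / real (card J)) * \<delta>) = \<delta>" using J(1,2) by simp
      ultimately show ?thesis by linarith
    qed
    show ?thesis
      unfolding Pr_def
      by (intro exI[of _ "()"] bexI[OF _ vc] conjI allI ballI impI deep v2 fv small)
  qed
  then obtain q v where bv: "block q v" and v: "\<And>j. \<exists>y. Pr ((1 / 2) ^ j / (sqrt (real (q j)) + 1)) y (v j)"
    using block_building[of Pr] by metis
  have vc: "\<And>j. v j \<in> c00" by (rule block_c00[OF bv])
  have fv: "\<delta> \<le> f (\<iota> (v j))" for j using v[of j] unfolding Pr_def by blast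
  have sum_le: "JN (\<lambda>i. \<Sum>j\<in>J. v j i) \<le> 4" if "finite J" for J
  proof (rule c0_bound[OF bv _ _ _ _ that])
    show "JN (v j) \<le> 2" for j using v[of j] unfolding Pr_def by blast
    show "0 \<le> (1 / 2) ^ j / (sqrt (real (q j)) + 1)" for j using block_eps_bounds(1)[of j "q j"] by linarith
    show "sn s (v j) \<le> (1 / 2) ^ j / (sqrt (real (q j)) + 1)" if "s \<in> segments D R" for j s
      using v[of j] that unfolding Pr_def by blast
    show "(1 / 2) ^ j / (sqrt (real (q j)) + 1) * sqrt (real (q j)) \<le> (1 / 2) ^ j" for j
      by (rule block_eps_bounds(4))
  qed
  obtain C where C: "\<And>z. norm (f z) \<le> norm z * C" "0 \<le> C" using f.nonneg_bounded by blast
  obtain L :: nat where L: "4 * C / \<delta> < L" using reals_Archimedean2 by blast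
  have "L * \<delta> \<le> (\<Sum>j<L. f (\<iota> (v j)))" using sum_mono[of "{..<L}" "\<lambda>_. \<delta>"] fv by simp
  also have "\<dots> = f (\<iota> (\<lambda>i. \<Sum>j<L. v j i))" by (simp add: io_sum[OF vc] f.sum)
  also have "\<dots> \<le> norm (\<iota> (\<lambda>i. \<Sum>j<L. v j i)) * C" using C(1) by (metis abs_le_D1 real_norm_def)
  also have "\<dots> \<le> 4 * C"
    using sum_le[of "{..<L}"] C(2) by (intro mult_right_mono) (simp_all add: norm_io c00_sum[OF vc])
  finally have "L \<le> 4 * C / \<delta>" using assms(4) by (simp add: field_simps)
  then show False using L by simp
qed

text \<open>Consequently the unit vector basis is shrinking.\<close>

lemma block_weakly_null:
  assumes "block p x" "\<And>j. JN (x j) \<le> 2" "(\<lambda>j. y j - \<iota> (x j)) \<longlonglongrightarrow> 0"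
  shows "weakly_null y"
  unfolding weakly_null_def
proof (intro allI impI, rule ccontr)
  fix f :: "'a \<Rightarrow> real" assume f: "bounded_linear f" and ne: "\<not> (\<lambda>j. f (y j)) \<longlonglongrightarrow> 0"
  interpret f: bounded_linear f by (rule f)
  note xc = block_c00[OF assms(1)]
  have 1: "(\<lambda>j. f (y j - \<iota> (x j))) \<longlonglongrightarrow> 0" using f.tendsto_zero[OF assms(3)] .
  have "\<not> (\<lambda>j. f (\<iota> (x j))) \<longlonglongrightarrow> 0"
  proof
    assume "(\<lambda>j. f (\<iota> (x j))) \<longlonglongrightarrow> 0"
    from tendsto_add[OF 1 this] have "(\<lambda>j. f (y j)) \<longlonglongrightarrow> 0" by (simp add: f.diff)
    then show False using ne by blast
  qed
  then obtain \<delta> where \<delta>: "\<delta> > 0" "\<forall>M. \<exists>j\<ge>M. \<not> \<bar>f (\<iota> (x j))\<bar> < \<delta>"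
    unfolding lim_sequentially by auto
  then have inf: "infinite {j. \<delta> \<le> \<bar>f (\<iota> (x j))\<bar>}"
    unfolding infinite_nat_iff_unbounded_le by (simp add: not_less)
  define r where "r = enumerate {j. \<delta> \<le> \<bar>f (\<iota> (x j))\<bar>}"
  have r: "strict_mono r" unfolding r_def by (rule strict_mono_enumerate[OF inf])
  have rb: "\<delta> \<le> \<bar>f (\<iota> (x (r j)))\<bar>" for j using enumerate_in_set[OF inf, of j] unfolding r_def by simp
  \<comment> \<open>Signs turn the lower bound for the absolute values into one for the
    values.\<close>
  define c where "c j = sgn (f (\<iota> (x (r j))))" for j
  have fc: "c j * f (\<iota> (x (r j))) = \<bar>f (\<iota> (x (r j)))\<bar>" for j by (simp add: c_def abs_sgn mult.commute)
  have c1: "\<bar>c j\<bar> = 1" for j using rb[of j] \<delta>(1) by (auto simp: c_def abs_sgn_eq)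
  show False
  proof (rule block_no_lower_functional[OF block_scale[OF block_subseq[OF assms(1) r], of c] _ f \<delta>(1)])
    show "JN (\<lambda>i. c j * x (r j) i) \<le> 2" for j using assms(2)[of "r j"] by (simp add: JN_scale[OF xc] c1)
    show "\<delta> \<le> f (\<iota> (\<lambda>i. c j * x (r j) i))" for j
      using rb[of j] by (simp add: io_scale[OF xc] f.scaleR fc)
  qed
qed

end

section \<open>Unit vectors of the subspace close to block sequences\<close>

locale jt_subspace = jt_space m n \<gamma> D R \<iota>
  for m n \<gamma> :: "nat \<Rightarrow> nat" and D :: "nat set" and R :: "nat rel"
    and \<iota> :: "(nat \<Rightarrow> real) \<Rightarrow> 'a::banach" +
  fixes Y :: "'a set"
  assumes subspace_Y: "subspace Y"
    and l2_subsequences: "\<And>x :: nat \<Rightarrow> 'a. (\<And>i. x i \<in> Y) \<Longrightarrow> (\<And>i. norm (x i) = 1) \<Longrightarrow> weakly_null x \<Longrightarrow>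
      \<exists>r. strict_mono r \<and> equivalent_sequences (x \<circ> r) l2_unit"
begin

text \<open>Being close to bounded blocks, the vectors \<open>y j\<close> are weakly null, and the
  hypothesis on \<open>Y\<close> applies. The errors are summable with total at most 2, so sums of
  blocks inherit the \<open>\<ell>\<^sub>2\<close> lower bound up to a constant.\<close>

lemma near_block_l2:
  assumes "block p x" "\<And>j. y j \<in> Y" "\<And>j. norm (y j) = 1" "\<And>j. norm (y j - \<iota> (x j)) \<le> (1 / 2) ^ j"
  obtains r :: "nat \<Rightarrow> nat" and A where "strict_mono r" "A > 0" "\<And>J. finite J \<Longrightarrow> A * sqrt (card J) \<le> norm (\<Sum>j\<in>J. y (r j))"
    "\<And>J. finite J \<Longrightarrow> norm ((\<Sum>j\<in>J. y (r j)) - \<iota> (\<lambda>i. \<Sum>j\<in>J. x (r j) i)) \<le> 2"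
    "\<And>j. JN (x j) \<le> 2"
proof -
  note xc = block_c00[OF assms(1)]
  have JN2: "JN (x j) \<le> 2" for j
  proof -
    have "norm (\<iota> (x j)) \<le> norm (y j) + norm (y j - \<iota> (x j))"
      using norm_triangle_ineq4[of "y j" "y j - \<iota> (x j)"] by simp
    also have "\<dots> \<le> 1 + (1 / 2) ^ j" using assms(3,4)[of j] by simp
    also have "(1 / 2 :: real) ^ j \<le> 1" by (simp add: power_le_one)
    finally show ?thesis by (simp add: norm_io[OF xc])
  qed
  have "(\<lambda>j. (1 / 2 :: real) ^ j) \<longlonglongrightarrow> 0" by (rule LIMSEQ_power_zero) simp
  then have "(\<lambda>j. y j - \<iota> (x j)) \<longlonglongrightarrow> 0"
    by (rule Lim_null_comparison[rotated]) (use assms(4) in simp)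
  then have "weakly_null y" by (rule block_weakly_null[OF assms(1) JN2])
  then obtain r where r: "strict_mono r" "equivalent_sequences (y \<circ> r) l2_unit"
    using l2_subsequences[of y] assms(2,3) by blast
  obtain A where A: "A > 0" "\<And>J. finite J \<Longrightarrow> A * sqrt (card J) \<le> norm (\<Sum>j\<in>J. (y \<circ> r) j)"
    using equivalent_l2_unit_lower[OF r(2)] by blast
  have "norm ((\<Sum>j\<in>J. y (r j)) - \<iota> (\<lambda>i. \<Sum>j\<in>J. x (r j) i)) \<le> 2" if J: "finite J" for J
  proof -
    have "(\<Sum>j\<in>J. y (r j)) - \<iota> (\<lambda>i. \<Sum>j\<in>J. x (r j) i) = (\<Sum>j\<in>J. y (r j) - \<iota> (x (r j)))"
      by (simp add: io_sum[OF xc] sum_subtractf)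
    also have "norm \<dots> \<le> (\<Sum>j\<in>J. norm (y (r j) - \<iota> (x (r j))))" by (rule norm_sum)
    also have "\<dots> \<le> (\<Sum>j\<in>J. (1 / 2) ^ j)"
    proof (rule sum_mono)
      fix j
      have "norm (y (r j) - \<iota> (x (r j))) \<le> (1 / 2) ^ r j" by (rule assms(4))
      also have "\<dots> \<le> (1 / 2) ^ j"
        by (rule power_decreasing[OF strict_mono_imp_increasing[OF r(1)]]) simp_all
      finally show "norm (y (r j) - \<iota> (x (r j))) \<le> (1 / 2) ^ j" .
    qed
    also have "\<dots> \<le> 2" by (rule sum_half_powers[OF J])
    finally show ?thesis .
  qed
  then show ?thesis using that[OF r(1) A(1)] A(2) JN2 by simp
qed

text \<open>The quantitative form of the equivalence of norms far out. If it failed, there would be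
  blocks near unit vectors of \<open>Y\<close> with rapidly decreasing segment norms; by
  \<open>c0_bound\<close> their sums stay bounded, against the growth \<open>A * sqrt K\<close>
  forced by the hypothesis on \<open>Y\<close>.\<close>

lemma nonsmall_deep_vectors:
  obtains \<eta> p0 where "\<eta> > 0" "\<forall>y\<in>Y. \<forall>x\<in>c00. norm y = 1 \<longrightarrow> (\<forall>i. x i \<noteq> 0 \<longrightarrow> p0 < i) \<longrightarrow>
    norm (y - \<iota> x) < \<eta> \<longrightarrow> (\<exists>i. \<eta> \<le> \<bar>x i\<bar>) \<or> (\<exists>s\<in>segments D R. \<eta> \<le> sn s x)"
proof (rule ccontr)
  note found = that
  assume nt: "\<not> thesis"
  have neg: "\<exists>y\<in>Y. \<exists>x\<in>c00. norm y = 1 \<and> (\<forall>i. x i \<noteq> 0 \<longrightarrow> q < i) \<and> norm (y - \<iota> x) < d \<and>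
      (\<forall>s\<in>segments D R. sn s x < d)" if d: "0 < d" for q d
  proof (rule ccontr)
    assume "\<not> ?thesis"
    then have "\<forall>y\<in>Y. \<forall>x\<in>c00. norm y = 1 \<longrightarrow> (\<forall>i. x i \<noteq> 0 \<longrightarrow> q < i) \<longrightarrow>
        norm (y - \<iota> x) < d \<longrightarrow> (\<exists>i. d \<le> \<bar>x i\<bar>) \<or> (\<exists>s\<in>segments D R. d \<le> sn s x)"
      by (meson not_le)
    from found[OF d this] nt show False by blast
  qed
  define Pr where "Pr d y x \<longleftrightarrow> y \<in> Y \<and> norm y = 1 \<and> norm (y - \<iota> x) < d \<and>
      (\<forall>s\<in>segments D R. sn s x \<le> d)" for d y x
  have "\<exists>y. \<exists>x\<in>c00. (\<forall>i. x i \<noteq> 0 \<longrightarrow> q < i) \<and> Pr d y x" if d: "0 < d" for q d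
    using neg[OF d, of q] unfolding Pr_def by (meson less_imp_le)
  then obtain p y x where bx: "block p x"
    and yx: "\<And>j. Pr ((1 / 2) ^ j / (sqrt (real (p j)) + 1)) (y j) (x j)"
    using block_building[of Pr] by metis
  have close: "norm (y j - \<iota> (x j)) \<le> (1 / 2) ^ j" for j
  proof -
    have "norm (y j - \<iota> (x j)) < (1 / 2) ^ j / (sqrt (real (p j)) + 1)"
      using yx[of j] unfolding Pr_def by blast
    then show ?thesis using block_eps_bounds(2)[of j "p j"] by linarith
  qed
  have y: "y j \<in> Y" "norm (y j) = 1" for j using yx[of j] unfolding Pr_def by blast+
  obtain r :: "nat \<Rightarrow> nat" and A where r: "strict_mono r" and A: "A > 0"
    and low: "\<And>J. finite J \<Longrightarrow> A * sqrt (card J) \<le> norm (\<Sum>j\<in>J. y (r j))"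
    and cl: "\<And>J. finite J \<Longrightarrow> norm ((\<Sum>j\<in>J. y (r j)) - \<iota> (\<lambda>i. \<Sum>j\<in>J. x (r j) i)) \<le> 2"
    and JN2: "\<And>j. JN (x j) \<le> 2"
    by (rule near_block_l2[OF bx y close]) blast
  have up: "JN (\<lambda>i. \<Sum>j\<in>J. x j i) \<le> 4" if "finite J" for J
  proof (rule c0_bound[OF bx JN2 _ _ _ that])
    show "0 \<le> (1 / 2) ^ j / (sqrt (real (p j)) + 1)" for j using block_eps_bounds(1)[of j "p j"] by linarith
    show "sn s (x j) \<le> (1 / 2) ^ j / (sqrt (real (p j)) + 1)" if "s \<in> segments D R" for j s
      using yx[of j] that unfolding Pr_def by blast
    show "(1 / 2) ^ j / (sqrt (real (p j)) + 1) * sqrt (real (p j)) \<le> (1 / 2) ^ j" for j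
      by (rule block_eps_bounds(4))
  qed
  \<comment> \<open>The 6 is the bound 4 for sums of blocks plus the total approximation error
    2.\<close>
  obtain K :: nat where K: "(6 / A)\<^sup>2 < K" using reals_Archimedean2 by blast
  have xc: "\<And>j. x j \<in> c00" by (rule block_c00[OF bx])
  have "norm (\<iota> (\<lambda>i. \<Sum>j<K. x (r j) i)) \<le> 4"
  proof -
    have inj: "inj_on r {..<K}" by (rule strict_mono_imp_inj_on[OF r])
    have "(\<lambda>i. \<Sum>j<K. x (r j) i) = (\<lambda>i. \<Sum>j\<in>r ` {..<K}. x j i)" by (simp add: sum.reindex[OF inj])
    then show ?thesis using up[of "r ` {..<K}"] by (simp add: norm_io c00_sum[OF xc])
  qed
  then have "norm (\<Sum>j<K. y (r j)) \<le> 6"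
    using cl[of "{..<K}"] norm_triangle_sub[of "\<Sum>j<K. y (r j)" "\<iota> (\<lambda>i. \<Sum>j<K. x (r j) i)"] by simp
  then have "A * sqrt K \<le> 6" using low[of "{..<K}"] by simp
  then have "sqrt K \<le> 6 / A" using A by (simp add: field_simps)
  moreover have "6 / A < sqrt K" using K by (intro real_less_rsqrt)
  ultimately show False by simp
qed

text \<open>\<open>null_dir B\<close> says that the functionals of the branches in \<open>B\<close>, together with finitely many
  coordinates, do not bound the norm of \<open>Y\<close> from above.\<close>

definition null_dir :: "nat set set \<Rightarrow> bool" where
  "null_dir B \<longleftrightarrow> (\<forall>q. \<forall>d>0. \<exists>y\<in>Y. \<exists>x\<in>c00. norm y = 1 \<and> (\<forall>i. x i \<noteq> 0 \<longrightarrow> q < i) \<and>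
    norm (y - \<iota> x) < d \<and> (\<forall>\<sigma>\<in>B. \<forall>N. phn \<sigma> N x \<le> d))"

text \<open>Averaging turns smallness of the functionals into smallness of the norms of the branches,
  since an interval cuts at most two blocks.\<close>

lemma null_dir_flat:
  assumes "null_dir B" "B \<subseteq> branches D R" "\<epsilon> > 0"
  shows "\<exists>y\<in>Y. \<exists>x\<in>c00. norm y = 1 \<and> (\<forall>i. x i \<noteq> 0 \<longrightarrow> q < i) \<and>
    norm (y - \<iota> x) < \<epsilon> \<and> (\<forall>i. \<bar>x i\<bar> \<le> \<epsilon>) \<and> (\<forall>\<sigma>\<in>B. bn \<sigma> x \<le> \<epsilon>)"
proof -
  define Pr where "Pr d y x \<longleftrightarrow> y \<in> Y \<and> norm y = 1 \<and> norm (y - \<iota> x) < d \<and>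
      (\<forall>\<sigma>\<in>B. \<forall>N. phn \<sigma> N x \<le> d)" for d y x
  have "\<exists>y. \<exists>x\<in>c00. (\<forall>i. x i \<noteq> 0 \<longrightarrow> q < i) \<and> Pr d y x" if d: "0 < d" for q d
    using assms(1)[unfolded null_dir_def, rule_format, OF d, of q] unfolding Pr_def by blast
  then obtain p y x where bx: "block p x"
    and yx: "\<And>j. Pr ((1 / 2) ^ j / (sqrt (real (p j)) + 1)) (y j) (x j)"
    using block_building[of Pr] by metis
  have y: "y j \<in> Y" "norm (y j) = 1" for j using yx[of j] unfolding Pr_def by blast+
  have close: "norm (y j - \<iota> (x j)) \<le> (1 / 2) ^ j" for j
  proof -
    have "norm (y j - \<iota> (x j)) < (1 / 2) ^ j / (sqrt (real (p j)) + 1)"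
      using yx[of j] unfolding Pr_def by blast
    then show ?thesis using block_eps_bounds(2)[of j "p j"] by linarith
  qed
  have small: "phn \<sigma> N (x j) \<le> (1 / 2) ^ j" if "\<sigma> \<in> B" for \<sigma> N j
  proof -
    have "phn \<sigma> N (x j) \<le> (1 / 2) ^ j / (sqrt (real (p j)) + 1)"
      using yx[of j] that unfolding Pr_def by blast
    then show ?thesis using block_eps_bounds(2)[of j "p j"] by linarith
  qed
  obtain r :: "nat \<Rightarrow> nat" and A where r: "strict_mono r" and A: "A > 0"
    and low: "\<And>J. finite J \<Longrightarrow> A * sqrt (card J) \<le> norm (\<Sum>j\<in>J. y (r j))"
    and cl: "\<And>J. finite J \<Longrightarrow> norm ((\<Sum>j\<in>J. y (r j)) - \<iota> (\<lambda>i. \<Sum>j\<in>J. x (r j) i)) \<le> 2"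
    and JN2: "\<And>j. JN (x j) \<le> 2"
    by (rule near_block_l2[OF bx y close]) blast
  note bz = block_subseq[OF bx r]
  note zc = block_c00[OF bz]
  \<comment> \<open>With \<open>c = 1 / norm u\<close> and \<open>norm u\<close> at least
    \<open>A * sqrt K\<close>, this gives \<open>7 * c < \<epsilon>\<close>. The largest quantity to
    absorb is the norm on a branch: \<open>2 * c\<close> for the sum of the small functional norms
    and \<open>4 * c\<close> for two cut blocks.\<close>
  obtain K :: nat where K: "(7 / (A * \<epsilon>))\<^sup>2 < K" using reals_Archimedean2 by blast
  have sK: "7 / (A * \<epsilon>) < sqrt K" using K by (intro real_less_rsqrt)
  \<comment> \<open>Starting at \<open>q\<close> puts all blocks used beyond \<open>q\<close>, since
    \<open>j \<le> p (r j)\<close>.\<close>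
  let ?J = "{q..<q + K}"
  define u where "u = (\<Sum>j\<in>?J. y (r j))"
  have Ku: "A * sqrt K \<le> norm u" using low[of ?J] by (simp add: u_def)
  have "7 / \<epsilon> < A * sqrt K" using sK A assms(3) by (simp add: field_simps)
  then have big: "7 / \<epsilon> < norm u" using Ku by linarith
  have upos: "0 < norm u" using big assms(3) by (smt (verit) divide_pos_pos)
  define c where "c = 1 / norm u"
  have c: "0 < c" "7 * c < \<epsilon>"
    using upos big assms(3) by (simp_all add: c_def field_simps)
  let ?x = "\<lambda>i. \<Sum>j\<in>?J. c * x (r j) i"
  have xc: "?x \<in> c00" by (intro c00_sum c00_scale zc)
  have uY: "c *\<^sub>R u \<in> Y"
    unfolding u_def by (intro subspace_scale subspace_sum subspace_Y y)
  have u1: "norm (c *\<^sub>R u) = 1" using upos by (simp add: c_def)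
  have deep: "q < i" if v: "?x i \<noteq> 0" for i
  proof -
    obtain j where j: "j \<in> ?J" "c * x (r j) i \<noteq> 0"
      using v by (rule sum.not_neutral_contains_not_neutral)
    then have "p (r j) < i" using block_gt[OF bz, of j i] by simp
    moreover have "j \<le> p (r j)" by (rule strict_mono_imp_increasing[OF block_strict_mono[OF bz]])
    ultimately show ?thesis using j(1) by simp
  qed
  have close: "norm (c *\<^sub>R u - \<iota> ?x) < \<epsilon>"
  proof -
    have "\<iota> ?x = c *\<^sub>R \<iota> (\<lambda>i. \<Sum>j\<in>?J. x (r j) i)"
      by (simp add: io_scale[OF c00_sum[OF zc], symmetric] sum_distrib_left)
    then have "norm (c *\<^sub>R u - \<iota> ?x) = c * norm (u - \<iota> (\<lambda>i. \<Sum>j\<in>?J. x (r j) i))"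
      using c(1) by (simp flip: scaleR_diff_right)
    also have "\<dots> \<le> c * 2" using cl[of ?J] c(1) by (intro mult_left_mono) (simp_all add: u_def)
    finally show ?thesis using c by linarith
  qed
  have sup: "\<bar>?x i\<bar> \<le> \<epsilon>" for i
  proof -
    have "\<bar>?x i\<bar> \<le> 2 * \<bar>c\<bar>" by (rule sum_coords_le[OF bz JN2]) simp
    then show ?thesis using c by linarith
  qed
  have flat: "bn \<sigma> ?x \<le> \<epsilon>" if \<sigma>: "\<sigma> \<in> B" for \<sigma>
  proof -
    have "bn \<sigma> ?x \<le> 2 * c + 4 * c"
    proof (rule branch_norm_block_sum[OF bz JN2])
      show "\<sigma> \<in> branches D R" using \<sigma> assms(2) by blast
      fix J' N assume J': "J' \<subseteq> ?J"
      have fJ': "finite J'" using J' finite_subset by blast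
      have "phn \<sigma> N (\<lambda>i. \<Sum>j\<in>J'. c * x (r j) i) \<le> (\<Sum>j\<in>J'. phn \<sigma> N (\<lambda>i. c * x (r j) i))"
        unfolding phn_def pairing_sum[OF c00_scale[OF zc]] by (rule L2_set_sum_le[OF fJ'])
      also have "\<dots> \<le> (\<Sum>j\<in>J'. c * (1 / 2) ^ j)"
      proof (rule sum_mono)
        fix j
        have "phn \<sigma> N (x (r j)) \<le> (1 / 2) ^ r j" by (rule small[OF \<sigma>])
        also have "\<dots> \<le> (1 / 2) ^ j"
          by (rule power_decreasing[OF strict_mono_imp_increasing[OF r]]) simp_all
        finally show "phn \<sigma> N (\<lambda>i. c * x (r j) i) \<le> c * (1 / 2) ^ j"
          unfolding phn_scale using c(1) by simp
      qed
      also have "\<dots> = c * (\<Sum>j\<in>J'. (1 / 2) ^ j)" by (simp only: sum_distrib_left)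
      also have "\<dots> \<le> c * 2" using sum_half_powers[OF fJ'] c(1) by (intro mult_left_mono) auto
      finally show "phn \<sigma> N (\<lambda>i. \<Sum>j\<in>J'. c * x (r j) i) \<le> 2 * c" by simp
    qed (use c(1) in simp_all)
    then show ?thesis using c by linarith
  qed
  show ?thesis
    by (intro bexI[OF _ uY] bexI[OF _ xc] conjI allI ballI impI u1 deep close sup flat)
qed

end

section \<open>Finitely many branches control the subspace\<close>

context jt_subspace
begin

text \<open>One stage of the construction. \<open>B0\<close> stands for the exceptional branches of
  earlier stages, on which the new sequence is flat; \<open>B\<close> and \<open>P\<close> are the
  branches and the subtree that \<open>block_selection\<close> attaches to the new sequence, which
  is already thinned to the selected subsequence.\<close>

definition flat_seq ::
  "real \<Rightarrow> nat set set \<Rightarrow> (nat \<Rightarrow> nat) \<Rightarrow> (nat \<Rightarrow> 'a) \<Rightarrow> (nat \<Rightarrow> nat \<Rightarrow> real) \<Rightarrow>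
    nat set set \<Rightarrow> nat set \<Rightarrow> bool" where
  "flat_seq \<epsilon> B0 p y x B P \<longleftrightarrow> block p x \<and>
    (\<forall>j. y j \<in> Y \<and> norm (y j) = 1 \<and> norm (y j - \<iota> (x j)) < \<epsilon> \<and> JN (x j) \<le> 2 \<and>
      (\<forall>i. \<bar>x j i\<bar> \<le> \<epsilon>) \<and> (\<forall>\<sigma>\<in>B0. bn \<sigma> (x j) \<le> \<epsilon>)) \<and>
    finite B \<and> B \<subseteq> branches D R \<and> P \<subseteq> D \<and> P \<subseteq> \<Union>B \<and>
    (\<forall>a t. t \<in> P \<longrightarrow> a \<in> D \<longrightarrow> (a, t) \<in> R \<longrightarrow> a \<in> P) \<and>
    (\<forall>t\<in>D - P. \<forall>\<^sub>F j in sequentially. \<forall>s\<in>segments D R. Min s = t \<longrightarrow> sn s (x j) \<le> \<epsilon>)"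

lemma flat_seq_exists:
  assumes "null_dir B0" "B0 \<subseteq> branches D R" "0 < \<epsilon>" "\<epsilon> \<le> 1"
  shows "\<exists>p y x B P. flat_seq \<epsilon> B0 p y x B P"
proof -
  \<comment> \<open>The tolerance is kept at the constant \<epsilon>; \<open>block_building\<close>
    serves to arrange successive supports.\<close>
  define Pr where "Pr (d :: real) y x \<longleftrightarrow> y \<in> Y \<and> norm y = 1 \<and> norm (y - \<iota> x) < \<epsilon> \<and>
      (\<forall>i. \<bar>x i\<bar> \<le> \<epsilon>) \<and> (\<forall>\<sigma>\<in>B0. bn \<sigma> x \<le> \<epsilon>)" for d y x
  have "\<exists>y. \<exists>x\<in>c00. (\<forall>i. x i \<noteq> 0 \<longrightarrow> q < i) \<and> Pr d y x" for q d
    using null_dir_flat[OF assms(1-3), of q] unfolding Pr_def by blast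
  then obtain p y x where bx: "block p x"
    and yx: "\<And>j. Pr ((1 / 2) ^ j / (sqrt (real (p j)) + 1)) (y j) (x j)"
    using block_building[of Pr] by metis
  have yx: "y j \<in> Y" "norm (y j) = 1" "norm (y j - \<iota> (x j)) < \<epsilon>" "\<forall>i. \<bar>x j i\<bar> \<le> \<epsilon>"
    "\<forall>\<sigma>\<in>B0. bn \<sigma> (x j) \<le> \<epsilon>" for j using yx[of j] unfolding Pr_def by blast+
  have JN2: "JN (x j) \<le> 2" for j
    using norm_triangle_ineq4[of "y j" "y j - \<iota> (x j)"] yx(2,3)[of j] assms(4)
    by (simp add: norm_io[OF block_c00[OF bx], symmetric])
  obtain r P B where r: "strict_mono r" and B: "finite B" "B \<subseteq> branches D R" and P: "P \<subseteq> D" "P \<subseteq> \<Union>B"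
    and down: "\<And>a t. t \<in> P \<Longrightarrow> a \<in> D \<Longrightarrow> (a, t) \<in> R \<Longrightarrow> a \<in> P"
    and late: "\<And>t. t \<in> D - P \<Longrightarrow>
      \<forall>\<^sub>F j in sequentially. \<forall>s\<in>segments D R. Min s = t \<longrightarrow> sn s (x (r j)) \<le> \<epsilon>"
    by (rule block_selection[OF bx JN2 assms(3)]) blast
  have d: "\<forall>a t. t \<in> P \<longrightarrow> a \<in> D \<longrightarrow> (a, t) \<in> R \<longrightarrow> a \<in> P" using down by blast
  have A: "\<forall>j. y (r j) \<in> Y \<and> norm (y (r j)) = 1 \<and> norm (y (r j) - \<iota> (x (r j))) < \<epsilon> \<and>
      JN (x (r j)) \<le> 2 \<and> (\<forall>i. \<bar>x (r j) i\<bar> \<le> \<epsilon>) \<and> (\<forall>\<sigma>\<in>B0. bn \<sigma> (x (r j)) \<le> \<epsilon>)"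
    by (intro allI conjI yx JN2)
  have L: "\<forall>t\<in>D - P. \<forall>\<^sub>F j in sequentially. \<forall>s\<in>segments D R. Min s = t \<longrightarrow> sn s (x (r j)) \<le> \<epsilon>"
    by (intro ballI late)
  have "flat_seq \<epsilon> B0 (\<lambda>j. p (r j)) (\<lambda>j. y (r j)) (\<lambda>j. x (r j)) B P"
    unfolding flat_seq_def by (intro conjI block_subseq[OF bx r] A B P d L)
  then show ?thesis by (intro exI)
qed

text \<open>Every stage adds only finitely many branches, so the assumption can be applied again to
  all branches collected so far. The estimates clash in \<open>nonsmall_deep_vectors\<close>,
  applied to the normalized sum.\<close>

lemma finite_branches_control: "\<exists>B. finite B \<and> B \<subseteq> branches D R \<and> \<not> null_dir B"
proof (rule ccontr)
  assume "\<not> ?thesis"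
  then have null: "null_dir B" if "finite B" "B \<subseteq> branches D R" for B using that by blast
  obtain \<eta> p0 where \<eta>: "\<eta> > 0" and big: "\<forall>y\<in>Y. \<forall>x\<in>c00. norm y = 1 \<longrightarrow> (\<forall>i. x i \<noteq> 0 \<longrightarrow> p0 < i) \<longrightarrow>
    norm (y - \<iota> x) < \<eta> \<longrightarrow> (\<exists>i. \<eta> \<le> \<bar>x i\<bar>) \<or> (\<exists>s\<in>segments D R. \<eta> \<le> sn s x)"
    by (rule nonsmall_deep_vectors)
  define h where "h = min \<eta> 1"
  have h: "0 < h" "h \<le> 1" "h \<le> \<eta>" using \<eta> by (auto simp: h_def)
  \<comment> \<open>Then \<open>h * sqrt K > 8 / h\<close>, so the sum has norm above
    \<open>4 / h\<close> and is scaled by at most \<open>h / 4\<close>. Its segment norms, at most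
    \<open>h / 8 + 2 \<le> 3\<close>, drop to \<open>3 * h / 4\<close>, and its coordinates drop to
    \<open>h / 2\<close>.\<close>
  obtain K :: nat where K: "(8 / h\<^sup>2)\<^sup>2 < K" using reals_Archimedean2 by blast
  have sK: "8 / h\<^sup>2 < sqrt K" using K by (intro real_less_rsqrt)
  have h2: "0 < h\<^sup>2" "h\<^sup>2 \<le> h" using h by (simp_all add: power2_eq_square mult_left_le)
  have hsK: "8 / h < h * sqrt K"
    using sK h by (simp add: power2_eq_square field_simps)
  have "8 \<le> 8 / h" using h by (simp add: field_simps)
  then have hs8: "8 < h * sqrt K" using hsK by linarith
  have "K \<noteq> 0" using hs8 by (intro notI) simp
  then have K0: "0 < real K" by simp
  \<comment> \<open>\<open>K\<close> errors of this size add up to \<open>h / 8\<close>.\<close>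
  define \<epsilon> where "\<epsilon> = h / (8 * K)"
  have \<epsilon>: "0 < \<epsilon>" "K * \<epsilon> = h / 8" using h K0 by (simp_all add: \<epsilon>_def)
  have "\<epsilon> \<le> K * \<epsilon>" using \<epsilon>(1) K0 by simp
  then have \<epsilon>h: "\<epsilon> < h" "\<epsilon> \<le> 1" using \<epsilon>(2) h by linarith+
  \<comment> \<open>The conditions on \<open>B0\<close> stand under the quantifier, so that one
    choice function serves the whole recursion.\<close>
  have "\<exists>t :: (nat \<Rightarrow> nat) \<times> (nat \<Rightarrow> 'a) \<times> (nat \<Rightarrow> nat \<Rightarrow> real) \<times> nat set set \<times> nat set.
      finite B0 \<longrightarrow> B0 \<subseteq> branches D R \<longrightarrow> flat_seq \<epsilon> B0 (fst t) (fst (snd t)) (fst (snd (snd t)))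
        (fst (snd (snd (snd t)))) (snd (snd (snd (snd t))))" for B0
  proof (cases "finite B0 \<and> B0 \<subseteq> branches D R")
    case True
    then obtain p y x B P where "flat_seq \<epsilon> B0 p y x B P"
      using flat_seq_exists[OF null _ \<epsilon>(1) \<epsilon>h(2), of B0] by blast
    then show ?thesis by (intro exI[of _ "(p, y, x, B, P)"]) simp
  qed blast
  then obtain F :: "nat set set \<Rightarrow>
      (nat \<Rightarrow> nat) \<times> (nat \<Rightarrow> 'a) \<times> (nat \<Rightarrow> nat \<Rightarrow> real) \<times> nat set set \<times> nat set"
    where F: "\<forall>B0. finite B0 \<longrightarrow> B0 \<subseteq> branches D R \<longrightarrow> flat_seq \<epsilon> B0 (fst (F B0)) (fst (snd (F B0)))
      (fst (snd (snd (F B0)))) (fst (snd (snd (snd (F B0))))) (snd (snd (snd (snd (F B0)))))"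
    using choice by metis
  \<comment> \<open>Exceptional branches of all stages before the given one.\<close>
  define acc where "acc = rec_nat {} (\<lambda>_ B0. B0 \<union> fst (snd (snd (snd (F B0)))))"
  have acc0: "acc 0 = {}" and accS: "acc (Suc i) = acc i \<union> fst (snd (snd (snd (F (acc i)))))" for i
    by (simp_all add: acc_def)
  define p y x B P where "p i = fst (F (acc i))" and "y i = fst (snd (F (acc i)))"
    and "x i = fst (snd (snd (F (acc i))))" and "B i = fst (snd (snd (snd (F (acc i)))))"
    and "P i = snd (snd (snd (snd (F (acc i)))))" for i
  have acc: "finite (acc i) \<and> acc i \<subseteq> branches D R" for i
  proof (induction i)
    case (Suc i)
    then have "flat_seq \<epsilon> (acc i) (p i) (y i) (x i) (B i) (P i)"
      using F unfolding p_def y_def x_def B_def P_def by blast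
    then show ?case using Suc unfolding accS flat_seq_def B_def by blast
  qed (simp add: acc0)
  have fs: "flat_seq \<epsilon> (acc i) (p i) (y i) (x i) (B i) (P i)" for i
    using F acc unfolding p_def y_def x_def B_def P_def by blast
  have acc_B: "B i \<subseteq> acc j" if "i < j" for i j
    using that
  proof (induction j)
    case (Suc j)
    then show ?case using accS[of j] unfolding B_def by (cases "i = j") auto
  qed simp
  have bl: "block (p i) (x i)" for i using fs[of i] unfolding flat_seq_def by blast
  have seq: "y i j \<in> Y" "norm (y i j) = 1" "norm (y i j - \<iota> (x i j)) < \<epsilon>" "JN (x i j) \<le> 2"
    "\<And>k. \<bar>x i j k\<bar> \<le> \<epsilon>" for i j
    using fs[of i] unfolding flat_seq_def by blast+
  have flat: "bn \<sigma> (x i j) \<le> \<epsilon>" if "\<sigma> \<in> B i'" "i' < i" for \<sigma> i i' j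
    using fs[of i] acc_B[OF that(2)] that(1) unfolding flat_seq_def by blast
  have tree: "B i \<subseteq> branches D R" "P i \<subseteq> D" "P i \<subseteq> \<Union> (B i)"
    "\<forall>a t. t \<in> P i \<longrightarrow> a \<in> D \<longrightarrow> (a, t) \<in> R \<longrightarrow> a \<in> P i" for i
    using fs[of i] unfolding flat_seq_def by blast+
  have late: "\<forall>\<^sub>F j in sequentially. \<forall>s\<in>segments D R. Min s = t \<longrightarrow> sn s (x i j) \<le> \<epsilon>"
    if "t \<in> D - P i" for t i
    using fs[of i] that unfolding flat_seq_def by blast
  \<comment> \<open>Index \<open>j\<close> of stage \<open>i\<close> is acceptable after
    \<open>q\<close> if its vector begins beyond \<open>q\<close> and segments starting off
    \<open>P i\<close> no later than \<open>q\<close> are already small on it.\<close>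
  let ?jj = "\<lambda>i q j. q \<le> p i j \<and>
      (\<forall>t\<in>{t \<in> D - P i. t \<le> q}. \<forall>s\<in>segments D R. Min s = t \<longrightarrow> sn s (x i j) \<le> \<epsilon>)"
  have ex: "\<exists>j. ?jj i q j" for i q
  proof -
    have "finite {t \<in> D - P i. t \<le> q}" by (rule finite_subset[of _ "{..q}"]) auto
    then have "\<forall>\<^sub>F j in sequentially. \<forall>t\<in>{t \<in> D - P i. t \<le> q}.
        \<forall>s\<in>segments D R. Min s = t \<longrightarrow> sn s (x i j) \<le> \<epsilon>"
      by (rule eventually_ball_finite) (use late in blast)
    then have "\<forall>\<^sub>F j in sequentially. q \<le> j \<and> (\<forall>t\<in>{t \<in> D - P i. t \<le> q}.
        \<forall>s\<in>segments D R. Min s = t \<longrightarrow> sn s (x i j) \<le> \<epsilon>)"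
      by (rule eventually_conj[OF eventually_ge_at_top])
    then obtain j where j: "q \<le> j" "\<forall>t\<in>{t \<in> D - P i. t \<le> q}.
        \<forall>s\<in>segments D R. Min s = t \<longrightarrow> sn s (x i j) \<le> \<epsilon>"
      using eventually_happens'[OF sequentially_bot] by blast
    moreover have "j \<le> p i j" by (rule strict_mono_imp_increasing[OF block_strict_mono[OF bl]])
    ultimately show ?thesis by (meson le_trans)
  qed
  define jj where "jj i q = (SOME j. ?jj i q j)" for i q
  have jj_ex: "?jj i q (jj i q)" for i q
    unfolding jj_def by (rule someI_ex[OF ex])
  then have jj: "\<And>i q. q \<le> p i (jj i q)"
    "\<And>i q. \<forall>t\<in>{t \<in> D - P i. t \<le> q}. \<forall>s\<in>segments D R. Min s = t \<longrightarrow> sn s (x i (jj i q)) \<le> \<epsilon>"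
    by blast+
  \<comment> \<open>The ranges lie beyond \<open>p0\<close>, where
    \<open>nonsmall_deep_vectors\<close> applies, and beyond \<open>K\<close>, so that
    \<open>K\<close> disjoint segments inside them are admissible. Step \<open>l\<close> draws from
    stage \<open>K - 1 - l\<close>.\<close>
  define e where "e = rec_nat (max p0 K) (\<lambda>l q. p (K - 1 - l) (Suc (jj (K - 1 - l) q)))"
  have e0: "e 0 = max p0 K" and eS: "e (Suc l) = p (K - 1 - l) (Suc (jj (K - 1 - l) (e l)))" for l
    by (simp_all add: e_def)
  define z w where "z l = x (K - 1 - l) (jj (K - 1 - l) (e l))"
    and "w l = y (K - 1 - l) (jj (K - 1 - l) (e l))" for l
  have ze: "e l < i \<and> i \<le> e (Suc l)" if "z l i \<noteq> 0" for l i
    using block_gt[OF bl] block_le[OF bl] that jj(1)[of "e l" "K - 1 - l"] unfolding z_def eS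
    by (meson le_less_trans)
  have "e l < e (Suc l)" for l
  proof -
    have "p (K - 1 - l) (jj (K - 1 - l) (e l)) < e (Suc l)"
      unfolding eS using strict_monoD[OF block_strict_mono[OF bl]] by simp
    then show ?thesis using jj(1)[of "e l" "K - 1 - l"] by linarith
  qed
  then have em: "strict_mono e" by (simp add: strict_mono_Suc_iff)
  have bz: "block e z"
    unfolding block_def
  proof (intro conjI allI impI em)
    show "z l \<in> c00" for l unfolding z_def by (rule block_c00[OF bl])
    show "e l < i" "i \<le> e (Suc l)" if "z l i \<noteq> 0" for l i using ze[OF that] by auto
  qed
  note zc = block_c00[OF bz]
  have zw: "w l \<in> Y" "norm (w l) = 1" "norm (w l - \<iota> (z l)) < \<epsilon>" "JN (z l) \<le> 2" "\<And>i. \<bar>z l i\<bar> \<le> \<epsilon>" for l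
    unfolding z_def w_def by (rule seq)+
  text \<open>The sequences are used in reversed order, so that the earlier vector of a pair is small on
    the exceptional branches of the later one.\<close>
  have one: "sn s (z l') \<le> \<epsilon> \<or> sn s (z l) \<le> \<epsilon>"
    if ll: "l' < l" "l < K" and s: "s \<in> segments D R" for l l' s
  proof -
    define i where "i = K - 1 - l"
    have i: "i < K - 1 - l'" using ll unfolding i_def by linarith
    note split = segment_split_subtree[OF s tree[of i]]
    have Pc: "tchain D R (s \<inter> P i)" using tchain_subset[OF segment_tchain[OF s]] by simp
    have Qc: "tchain D R (s - P i)" using tchain_subset[OF segment_tchain[OF s]] by simp
    \<comment> \<open>If \<open>s\<close> has left \<open>P i\<close> by \<open>e l\<close>, the
      later vector \<open>z l\<close> meets only the part off \<open>P i\<close>, where it is small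
      by the choice of its index. If not, the earlier vector \<open>z l'\<close> meets only the part
      in \<open>P i\<close>, on a branch of \<open>B i\<close>; its stage comes after stage
      \<open>i\<close>, so it is flat there.\<close>
    show ?thesis
    proof (cases "\<exists>t\<in>s - P i. t \<le> e l")
      case True
      then have ne: "s - P i \<noteq> {}" by blast
      note seg = split(2)[OF ne]
      define t where "t = Min (s - P i)"
      have t: "t \<in> s - P i" unfolding t_def by (rule segment_Min[OF seg])
      have te: "t \<le> e l"
        using True Min_le[OF segment_finite[OF seg]] unfolding t_def by (meson le_trans)
      have "t \<in> {t \<in> D - P i. t \<le> e l}" using t te segment_subset_D[OF s] by blast
      then have "sn (s - P i) (z l) \<le> \<epsilon>"
        using jj(2)[where i = i and q = "e l"] seg unfolding z_def i_def[symmetric] t_def by blast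
      moreover have "sn (s \<inter> P i) (z l) = 0"
      proof (rule segment_norm_zero[OF Pc _ zc])
        fix k assume "k \<in> s \<inter> P i"
        then have "k < t" using split(3)[OF _ t] by blast
        then show "z l k = 0" using ze[of l k] te by linarith
      qed
      ultimately show ?thesis using split(4)[OF zc, of l] by linarith
    next
      case False
      have "sn (s - P i) (z l') = 0"
      proof (rule segment_norm_zero[OF Qc _ zc])
        fix k assume "k \<in> s - P i"
        then have "e l < k" using False by (meson not_le)
        moreover have "e (Suc l') \<le> e l" using strict_mono_less_eq[OF em] ll(1) by simp
        ultimately show "z l' k = 0" using ze[of l' k] by linarith
      qed
      moreover have "sn (s \<inter> P i) (z l') \<le> \<epsilon>"
      proof (cases "s \<inter> P i = {}")
        case True
        then have "sn (s \<inter> P i) (z l') = 0" by (intro segment_norm_zero[OF Pc _ zc]) blast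
        then show ?thesis using \<epsilon>(1) by simp
      next
        case False
        then obtain \<sigma> where \<sigma>: "\<sigma> \<in> B i" "sn (s \<inter> P i) (z l') \<le> bn \<sigma> (z l')"
          using split(1) zc by blast
        have "bn \<sigma> (z l') \<le> \<epsilon>" unfolding z_def by (rule flat[OF \<sigma>(1) i])
        then show ?thesis using \<sigma>(2) by linarith
      qed
      ultimately show ?thesis using split(4)[OF zc, of l'] by linarith
    qed
  qed
  let ?Z = "\<lambda>i. \<Sum>l<K. z l i"
  have Zc: "?Z \<in> c00" by (rule c00_sum[OF zc])
  have Zs: "sn s ?Z \<le> h / 8 + 2" if s: "s \<in> segments D R" for s
  proof -
    \<comment> \<open>By \<open>one\<close>, at most one of the \<open>K\<close> vectors exceeds
      \<epsilon> on \<open>s\<close>, and its norm is at most 2.\<close>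
    let ?c = "\<lambda>l. if \<epsilon> < sn s (z l) then 2 else (0::real)"
    have "(\<Sum>l<K. ?c l) \<le> 2"
    proof (cases "\<exists>l<K. \<epsilon> < sn s (z l)")
      case True
      then obtain l where l: "l < K" "\<epsilon> < sn s (z l)" by blast
      have c0: "?c l' = 0" if "l' \<in> {..<K} - {l}" for l'
        using one[of l' l s] one[of l l' s] l that s by (cases "l' < l") auto
      have "(\<Sum>l<K. ?c l) = (\<Sum>l\<in>{l}. ?c l)"
        using l(1) c0 by (intro sum.mono_neutral_right) blast+
      then show ?thesis by simp
    next
      case False
      then have "(\<Sum>l<K. ?c l) = 0" by (intro sum.neutral) auto
      then show ?thesis by simp
    qed
    moreover have "sn s ?Z \<le> (\<Sum>l<K. sn s (z l))"
      by (rule segment_norm_sum[OF segment_tchain[OF s] zc])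
    moreover have "(\<Sum>l<K. sn s (z l)) \<le> (\<Sum>l<K. \<epsilon> + ?c l)"
    proof (rule sum_mono)
      fix l
      show "sn s (z l) \<le> \<epsilon> + ?c l"
        using segment_norm_le_JN[OF s zc, of l] zw(4)[of l] \<epsilon>(1) by simp
    qed
    ultimately show ?thesis using \<epsilon>(2) by (simp add: sum.distrib)
  qed
  \<comment> \<open>Small coordinates leave a large segment as the only alternative in
    \<open>nonsmall_deep_vectors\<close>. Trimming it to the range of \<open>z l\<close> makes the
    segments for different \<open>l\<close> disjoint.\<close>
  have "\<exists>s\<in>segments D R. s \<subseteq> {e l<..e (Suc l)} \<and> h \<le> sn s (z l)" for l
  proof -
    have "\<exists>s\<in>segments D R. \<eta> \<le> sn s (z l)"
    proof -
      have "p0 < i" if "z l i \<noteq> 0" for i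
        using ze[OF that] strict_mono_less_eq[OF em, of 0 l] e0 by simp
      moreover have "\<not> \<eta> \<le> \<bar>z l i\<bar>" for i using zw(5)[of l i] \<epsilon>h h by linarith
      moreover have "norm (w l - \<iota> (z l)) < \<eta>" using zw(3)[of l] \<epsilon>h h by linarith
      ultimately show ?thesis using big zw(1,2)[of l] zc[of l] by blast
    qed
    then obtain s where s: "s \<in> segments D R" "\<eta> \<le> sn s (z l)" by blast
    have pos: "0 < sn s (z l)" using s(2) \<eta> by linarith
    obtain s' where s': "s' \<in> segments D R" "s' \<subseteq> {e l<..e (Suc l)}" "sn s' (z l) = sn s (z l)"
      by (rule segment_range[OF s(1) zc ze pos])
    have "h \<le> sn s' (z l)" using s(2) h(3) s'(3) by linarith
    then show ?thesis using s'(1,2) by blast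
  qed
  then obtain S where S: "\<And>l. S l \<in> segments D R" "\<And>l. S l \<subseteq> {e l<..e (Suc l)}" "\<And>l. h \<le> sn (S l) (z l)"
    by metis
  have sep: "S l \<inter> S l' = {}" if "l < l'" for l l'
  proof -
    have "e (Suc l) \<le> e l'" using strict_mono_less_eq[OF em] that by simp
    then show ?thesis using S(2)[of l] S(2)[of l'] by fastforce
  qed
  have sep: "S l \<inter> S l' = {}" if "l \<noteq> l'" for l l'
    using sep[of l l'] sep[of l' l] that by (metis Int_commute linorder_neqE_nat)
  have inj: "inj_on S {..<K}"
    using sep S(1) segment_nonempty unfolding inj_on_def by (metis inf.idem)
  have "adm (S ` {..<K})"
  proof (rule admI)
    show "disjoint (S ` {..<K})"
    proof (rule disjointI)
      fix a b assume "a \<in> S ` {..<K}" "b \<in> S ` {..<K}" "a \<noteq> b"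
      then obtain l l' where "a = S l" "b = S l'" "l \<noteq> l'" by auto
      then show "a \<inter> b = {}" using sep[of l l'] by simp
    qed
    fix s assume "s \<in> S ` {..<K}"
    then obtain l where l: "s = S l" by blast
    have "Min s \<in> {e l<..e (Suc l)}" unfolding l by (rule subsetD[OF S(2) segment_Min[OF S(1)]])
    moreover have "K \<le> e l" using strict_mono_less_eq[OF em, of 0 l] e0 by simp
    ultimately show "card (S ` {..<K}) \<le> Min s" using card_image_le[of "{..<K}" S] by simp
  qed (use S(1) in auto)
  then have "L2_set (\<lambda>s. sn s ?Z) (S ` {..<K}) \<le> JN ?Z" by (rule L2_segment_norm_le_JN[OF _ Zc])
  moreover have "h * sqrt K \<le> L2_set (\<lambda>s. sn s ?Z) (S ` {..<K})"
  proof -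
    have "sn (S l) ?Z = sn (S l) (z l)" if "l < K" for l
    proof (rule segment_norm_cong[OF segment_tchain[OF S(1)] Zc zc])
      fix i assume i: "i \<in> S l"
      have "z l' i = 0" if "l' \<in> {..<K} - {l}" for l'
      proof (rule ccontr)
        assume "z l' i \<noteq> 0"
        from ze[OF this] have "e l' < i" "i \<le> e (Suc l')" by auto
        moreover have "e l < i" "i \<le> e (Suc l)" using subsetD[OF S(2) i] by auto
        moreover have "e (Suc l) \<le> e l' \<or> e (Suc l') \<le> e l"
          using strict_mono_less_eq[OF em] that by (auto simp: Suc_le_eq)
        ultimately show False by linarith
      qed
      then have "?Z i = (\<Sum>l\<in>{l}. z l i)"
        using that by (intro sum.mono_neutral_right) auto
      then show "?Z i = z l i" by simp
    qed
    then have "h\<^sup>2 \<le> (sn (S l) ?Z)\<^sup>2" if "l < K" for l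
      using S(3)[of l] h(1) that by (intro power_mono) auto
    then have "K * h\<^sup>2 \<le> (\<Sum>l<K. (sn (S l) ?Z)\<^sup>2)"
      using sum_mono[of "{..<K}" "\<lambda>_. h\<^sup>2" "\<lambda>l. (sn (S l) ?Z)\<^sup>2"] by simp
    also have "\<dots> = (\<Sum>s\<in>S ` {..<K}. (sn s ?Z)\<^sup>2)" by (simp add: sum.reindex[OF inj])
    finally have "sqrt (K * h\<^sup>2) \<le> L2_set (\<lambda>s. sn s ?Z) (S ` {..<K})"
      unfolding L2_set_def by (rule real_sqrt_le_mono)
    then show ?thesis using h(1) by (simp add: real_sqrt_mult mult.commute)
  qed
  ultimately have JZ: "h * sqrt K \<le> norm (\<iota> ?Z)" by (simp add: norm_io[OF Zc])
  define u where "u = (\<Sum>l<K. w l)"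
  have uZ: "norm (u - \<iota> ?Z) \<le> h / 8"
  proof -
    have "norm (u - \<iota> ?Z) = norm (\<Sum>l<K. w l - \<iota> (z l))"
      by (simp add: u_def io_sum[OF zc] sum_subtractf)
    also have "\<dots> \<le> (\<Sum>l<K. norm (w l - \<iota> (z l)))" by (rule norm_sum)
    also have "\<dots> \<le> (\<Sum>l<K. \<epsilon>)" by (intro sum_mono less_imp_le zw(3))
    finally show ?thesis using \<epsilon>(2) by simp
  qed
  have "norm (\<iota> ?Z) \<le> norm u + h / 8"
    using norm_triangle_ineq4[of u "u - \<iota> ?Z"] uZ by simp
  then have un: "4 / h < norm u" using JZ hsK \<open>8 \<le> 8 / h\<close> h by simp
  have "0 < 4 / h" using h by simp
  then have upos: "0 < norm u" using un by linarith
  define c where "c = 1 / norm u"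
  have c: "0 < c" "c \<le> h / 4" using upos un h by (simp_all add: c_def field_simps)
  let ?x = "\<lambda>i. c * ?Z i"
  have xc: "?x \<in> c00" by (rule c00_scale[OF Zc])
  have yY: "c *\<^sub>R u \<in> Y" unfolding u_def by (intro subspace_scale subspace_sum subspace_Y zw)
  have y1: "norm (c *\<^sub>R u) = 1" using upos by (simp add: c_def)
  have deep: "p0 < i" if v: "?x i \<noteq> 0" for i
  proof -
    have "?Z i \<noteq> 0" using v by simp
    then obtain l where "z l i \<noteq> 0" by (rule sum.not_neutral_contains_not_neutral)
    then show ?thesis using ze[of l i] strict_mono_less_eq[OF em, of 0 l] e0 by simp
  qed
  have "norm (c *\<^sub>R u - \<iota> ?x) = c * norm (u - \<iota> ?Z)"
    using c(1) by (simp add: io_scale[OF Zc] flip: scaleR_diff_right)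
  also have "\<dots> \<le> h / 4 * (h / 8)" using c uZ h by (intro mult_mono) auto
  also have "\<dots> < h" using h mult_left_le[of h h] by simp
  finally have cl: "norm (c *\<^sub>R u - \<iota> ?x) < \<eta>" using h by linarith
  have sup: "\<not> \<eta> \<le> \<bar>?x i\<bar>" for i
  proof -
    have "\<bar>?Z i\<bar> \<le> 2" using sum_coords_le[OF bz zw(4), of "{..<K}" 1 i] by simp
    then have "c * \<bar>?Z i\<bar> \<le> h / 4 * 2" using c h by (intro mult_mono) auto
    then have "\<bar>?x i\<bar> \<le> h / 2" using c(1) by (simp add: abs_mult)
    then show ?thesis using h by linarith
  qed
  have seg: "\<not> \<eta> \<le> sn s ?x" if s: "s \<in> segments D R" for s
  proof -
    note ch = segment_tchain[OF s]
    have "sn s ?x \<le> \<bar>c\<bar> * sn s ?Z" by (rule segment_norm_scale_le[OF ch Zc])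
    also have "\<dots> \<le> h / 4 * 3"
      using c h Zs[OF s] segment_norm_nonneg[OF ch Zc] by (intro mult_mono) auto
    finally show ?thesis using h by linarith
  qed
  show False
    using big[rule_format, OF yY xc y1 deep cl] sup seg by blast
qed

end

section \<open>The Hilbert space structure\<close>

lemma square_summable_mult:
  fixes a b :: "nat \<Rightarrow> real"
  assumes "summable (\<lambda>i. (a i)\<^sup>2)" "summable (\<lambda>i. (b i)\<^sup>2)"
  shows "summable (\<lambda>i. a i * b i)"
proof (rule summable_comparison_test')
  show "summable (\<lambda>i. (a i)\<^sup>2 + (b i)\<^sup>2)" by (rule summable_add[OF assms])
  fix i :: nat assume "i \<ge> 0"
  have "2 * (\<bar>a i\<bar> * \<bar>b i\<bar>) \<le> (a i)\<^sup>2 + (b i)\<^sup>2"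
    using sum_squares_bound[of "\<bar>a i\<bar>" "\<bar>b i\<bar>"] by (simp add: mult.assoc)
  moreover have "0 \<le> \<bar>a i\<bar> * \<bar>b i\<bar>" by simp
  ultimately have "\<bar>a i\<bar> * \<bar>b i\<bar> \<le> (a i)\<^sup>2 + (b i)\<^sup>2" by linarith
  then show "norm (a i * b i) \<le> (a i)\<^sup>2 + (b i)\<^sup>2" by (simp add: abs_mult)
qed

instantiation l2 :: real_inner
begin

lift_definition inner_l2 :: "l2 \<Rightarrow> l2 \<Rightarrow> real" is "\<lambda>a b. \<Sum>i. a i * b i" .

instance
proof
  fix a b c :: l2 and r :: real
  show "inner a b = inner b a" by transfer (simp add: mult.commute)
  show "inner (a + b) c = inner a c + inner b c"
    by transfer (simp add: distrib_right suminf_add square_summable_mult)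
  show "inner (r *\<^sub>R a) b = r * inner a b"
    by transfer (simp add: mult.assoc suminf_mult square_summable_mult)
  show "0 \<le> inner a a"
    by transfer (simp add: suminf_nonneg flip: power2_eq_square)
  show "inner a a = 0 \<longleftrightarrow> a = 0"
    by transfer (simp add: suminf_eq_zero_iff fun_eq_iff flip: power2_eq_square)
  show "norm a = sqrt (inner a a)"
    by transfer (simp flip: power2_eq_square)
qed

end

lemma coords_le_norm: "\<bar>coords a i\<bar> \<le> norm a"
proof -
  have "(coords a i)\<^sup>2 \<le> (\<Sum>i. (coords a i)\<^sup>2)"
    using sum_le_suminf[of "\<lambda>i. (coords a i)\<^sup>2" "{i}"] coords[of a] by simp
  then have "sqrt ((coords a i)\<^sup>2) \<le> norm a" unfolding norm_l2.rep_eq by (rule real_sqrt_le_mono)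
  then show ?thesis by simp
qed

lemma bounded_linear_coords: "bounded_linear (\<lambda>a. coords a i)"
  by (rule bounded_linear_intro[of _ 1]) (simp_all add: plus_l2.rep_eq scaleR_l2.rep_eq coords_le_norm)

lemma l2_eq_0I: "(\<And>i. coords a i = 0) \<Longrightarrow> a = 0"
  by (rule coords_inject[THEN iffD1]) (simp add: fun_eq_iff zero_l2.rep_eq)

lemma l2_constructI:
  fixes f :: "nat \<Rightarrow> real"
  assumes "\<And>N. (\<Sum>i<N. (f i)\<^sup>2) \<le> C\<^sup>2" "0 \<le> C"
  shows "coords (Abs_l2 f) = f" "norm (Abs_l2 f) \<le> C"
proof -
  have s: "summable (\<lambda>i. (f i)\<^sup>2)" by (rule summableI_nonneg_bounded[of _ "C\<^sup>2"]) (simp_all add: assms)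
  then show c: "coords (Abs_l2 f) = f" by (simp add: Abs_l2_inverse)
  have "(\<Sum>i. (f i)\<^sup>2) \<le> C\<^sup>2" by (rule suminf_le_const[OF s assms(1)])
  then have "sqrt (\<Sum>i. (f i)\<^sup>2) \<le> sqrt (C\<^sup>2)" by (rule real_sqrt_le_mono)
  then show "norm (Abs_l2 f) \<le> C" using assms(2) by (simp add: norm_l2.rep_eq c)
qed

lemma bounded_linear_into_l2:
  fixes f :: "nat \<Rightarrow> 'a::real_normed_vector \<Rightarrow> real"
  assumes "\<And>i. linear (f i)" "\<And>N x. (\<Sum>i<N. (f i x)\<^sup>2) \<le> (C * norm x)\<^sup>2" "0 \<le> C"
  shows "bounded_linear (\<lambda>x. Abs_l2 (\<lambda>i. f i x))" "\<And>x i. coords (Abs_l2 (\<lambda>i. f i x)) i = f i x"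
proof -
  have nn: "0 \<le> C * norm x" for x using assms(3) by simp
  note c = l2_constructI(1)[OF assms(2) nn] and n = l2_constructI(2)[OF assms(2) nn]
  show "\<And>x i. coords (Abs_l2 (\<lambda>i. f i x)) i = f i x" by (simp add: c)
  show "bounded_linear (\<lambda>x. Abs_l2 (\<lambda>i. f i x))"
  proof (rule bounded_linear_intro)
    fix x y :: 'a and r :: real
    show "Abs_l2 (\<lambda>i. f i (x + y)) = Abs_l2 (\<lambda>i. f i x) + Abs_l2 (\<lambda>i. f i y)"
      by (rule coords_inject[THEN iffD1], unfold c plus_l2.rep_eq)
        (simp add: linear_add[OF assms(1)])
    show "Abs_l2 (\<lambda>i. f i (r *\<^sub>R x)) = r *\<^sub>R Abs_l2 (\<lambda>i. f i x)"
      by (rule coords_inject[THEN iffD1], unfold c scaleR_l2.rep_eq)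
        (simp add: linear_scale[OF assms(1)])
    show "norm (Abs_l2 (\<lambda>i. f i x)) \<le> norm x * C" using n by (simp add: mult.commute)
  qed
qed

lemma orthonormal_norm_sum:
  fixes g :: "nat \<Rightarrow> 'b::real_inner"
  assumes "\<And>i j. inner (g i) (g j) = (if i = j then 1 else 0)" "finite J"
  shows "norm (\<Sum>j\<in>J. a j *\<^sub>R g j) = sqrt (\<Sum>j\<in>J. (a j)\<^sup>2)"
proof -
  have "inner (\<Sum>i\<in>J. a i *\<^sub>R g i) (\<Sum>j\<in>J. a j *\<^sub>R g j) =
      (\<Sum>j\<in>J. \<Sum>i\<in>J. a j * (a i * (if i = j then 1 else 0)))"
    by (simp add: inner_sum_left inner_sum_right assms(1) sum_distrib_left)
  also have "\<dots> = (\<Sum>j\<in>J. (a j)\<^sup>2)"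
  proof (rule sum.cong[OF refl])
    fix j assume j: "j \<in> J"
    have "(\<Sum>i\<in>J. a j * (a i * (if i = j then 1 else 0))) = (\<Sum>i\<in>J. if i = j then a j * a i else 0)"
      by (rule sum.cong) auto
    then show "(\<Sum>i\<in>J. a j * (a i * (if i = j then 1 else 0))) = (a j)\<^sup>2"
      using assms(2) j by (simp add: sum.delta power2_eq_square)
  qed
  finally show ?thesis by (simp add: norm_eq_sqrt_inner)
qed

lemma Bessel_inequality:
  fixes g :: "nat \<Rightarrow> 'b::real_inner"
  assumes "\<And>i j. inner (g i) (g j) = (if i = j then 1 else 0)"
  shows "(\<Sum>i<N. (inner x (g i))\<^sup>2) \<le> (norm x)\<^sup>2"
proof -
  let ?s = "\<Sum>i<N. inner x (g i) *\<^sub>R g i"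
  have "inner x ?s = (\<Sum>i<N. (inner x (g i))\<^sup>2)" by (simp add: inner_sum_right power2_eq_square)
  moreover have "inner ?s ?s = (\<Sum>i<N. (inner x (g i))\<^sup>2)"
    using orthonormal_norm_sum[OF assms, of "{..<N}" "\<lambda>i. inner x (g i)"]
    by (simp add: norm_eq_sqrt_inner)
  moreover have "0 \<le> inner (x - ?s) (x - ?s)" by simp
  ultimately show ?thesis
    by (simp add: inner_diff_left inner_diff_right inner_commute power2_norm_eq_inner)
qed

text \<open>On \<open>Y\<close>, \<open>norm (T y)\<close> is an equivalent Hilbert norm.
  Orthogonality is measured after applying \<open>T\<close> while the vectors stay in
  \<open>Y\<close>, so that limits are taken in the Banach space and remain in
  \<open>Y\<close>.\<close>

locale l2_bounded_below =
  fixes T :: "'a::banach \<Rightarrow> l2" and Y :: "'a set" and \<delta> :: real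
  assumes T: "bounded_linear T" and sub: "subspace Y" and cl: "closed Y"
    and pos: "0 < \<delta>" and below: "\<And>y. y \<in> Y \<Longrightarrow> \<delta> * norm y \<le> norm (T y)"
begin

sublocale T: bounded_linear T by (rule T)

lemma norm_le: "y \<in> Y \<Longrightarrow> norm y \<le> norm (T y) / \<delta>"
  using below[of y] pos by (simp add: field_simps)

text \<open>By the parallelogram identity, the images of a minimizing sequence are Cauchy; the lower
  bound on \<open>T\<close> carries this back to \<open>Z\<close>, where the limit exists.
  Minimality at the limit gives orthogonality.\<close>

lemma orthogonal_projection:
  assumes Z: "subspace Z" "closed Z" "Z \<subseteq> Y" and h: "h \<in> Y"
  obtains z where "z \<in> Z" "\<And>w. w \<in> Z \<Longrightarrow> inner (T (h - z)) (T w) = 0"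
proof -
  let ?f = "\<lambda>w. (norm (T (h - w)))\<^sup>2"
  define d where "d = (INF w\<in>Z. ?f w)"
  have ne: "Z \<noteq> {}" using subspace_0[OF Z(1)] by blast
  have bdd: "bdd_below (?f ` Z)" by (rule bdd_belowI2[of _ 0]) simp
  have d_le: "d \<le> ?f w" if "w \<in> Z" for w unfolding d_def by (rule cINF_lower[OF bdd that])
  have "\<exists>w\<in>Z. ?f w < d + inverse (Suc k)" for k
    using cINF_less_iff[OF ne bdd, of "d + inverse (Suc k)"] unfolding d_def by simp
  then obtain w where w: "\<And>k. w k \<in> Z" "\<And>k. ?f (w k) < d + inverse (Suc k)" by metis
  have dist: "(\<delta> * norm (w k - w l))\<^sup>2 \<le> 2 * inverse (Suc k) + 2 * inverse (Suc l)" for k l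
  proof -
    have diff: "w k - w l \<in> Z" by (rule subspace_diff[OF Z(1) w(1) w(1)])
    have mid: "(1 / 2) *\<^sub>R (w k + w l) \<in> Z"
      by (rule subspace_scale[OF Z(1) subspace_add[OF Z(1) w(1) w(1)]])
    let ?a = "T (h - w k)" and ?b = "T (h - w l)"
    have "T (w k - w l) = ?b - ?a" by (simp flip: T.diff)
    moreover have "?a + ?b = 2 *\<^sub>R T (h - (1 / 2) *\<^sub>R (w k + w l))"
    proof -
      have "(h - w k) + (h - w l) = 2 *\<^sub>R (h - (1 / 2) *\<^sub>R (w k + w l))"
        by (simp add: scaleR_diff_right algebra_simps scaleR_2)
      then show ?thesis by (metis T.add T.scaleR)
    qed
    then have "(norm (?a + ?b))\<^sup>2 = 4 * ?f ((1 / 2) *\<^sub>R (w k + w l))" by (simp add: power_mult_distrib)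
    then have "4 * d \<le> (norm (?a + ?b))\<^sup>2" using d_le[OF mid] by simp
    moreover have "(norm (?b - ?a))\<^sup>2 = 2 * (norm ?a)\<^sup>2 + 2 * (norm ?b)\<^sup>2 - (norm (?a + ?b))\<^sup>2"
      by (simp add: power2_norm_eq_inner inner_diff_left inner_diff_right inner_add_left inner_add_right
          inner_commute)
    ultimately have "(norm (T (w k - w l)))\<^sup>2 \<le> 2 * inverse (Suc k) + 2 * inverse (Suc l)"
      using w(2)[of k] w(2)[of l] by simp
    moreover have "(\<delta> * norm (w k - w l))\<^sup>2 \<le> (norm (T (w k - w l)))\<^sup>2"
      using below[of "w k - w l"] diff Z(3) pos by (intro power_mono) auto
    ultimately show ?thesis by linarith
  qed
  have "Cauchy w"
  proof (rule metric_CauchyI)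
    fix e :: real assume e: "0 < e"
    obtain N where N: "4 / (\<delta> * e)\<^sup>2 < real N" using reals_Archimedean2 by blast
    have "dist (w k) (w l) < e" if kl: "N \<le> k" "N \<le> l" for k l
    proof -
      have "inverse (real (Suc k)) \<le> inverse (real (Suc N))" "inverse (real (Suc l)) \<le> inverse (real (Suc N))"
        using kl by (simp_all add: le_imp_inverse_le)
      then have "(\<delta> * norm (w k - w l))\<^sup>2 \<le> 4 * inverse (real (Suc N))"
        using dist[of k l] by linarith
      also have "\<dots> < (\<delta> * e)\<^sup>2"
      proof -
        have p: "0 < (\<delta> * e)\<^sup>2" using e pos by simp
        have "4 / (\<delta> * e)\<^sup>2 < real (Suc N)" using N by simp
        then show ?thesis using p by (simp add: field_simps)
      qed
      finally have "\<delta> * norm (w k - w l) < \<delta> * e" 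
        by (rule power2_less_imp_less) (use e pos in simp)
      then show ?thesis using pos by (simp add: dist_norm)
    qed
    then show "\<exists>M. \<forall>m\<ge>M. \<forall>n\<ge>M. dist (w m) (w n) < e" by blast
  qed
  then obtain z where z: "w \<longlonglongrightarrow> z" using Cauchy_convergent convergent_def by blast
  have zZ: "z \<in> Z" using closed_sequentially[OF Z(2) w(1) z] .
  have "(\<lambda>k. ?f (w k)) \<longlonglongrightarrow> ?f z" by (intro tendsto_intros T.tendsto z)
  moreover have "(\<lambda>k. d + inverse (real (Suc k))) \<longlonglongrightarrow> d + 0"
    by (intro tendsto_intros LIMSEQ_inverse_real_of_nat)
  ultimately have fz: "?f z \<le> d + 0"
    by (rule LIMSEQ_le) (use w(2) in \<open>auto intro: less_imp_le\<close>)
  have "inner (T (h - z)) (T v) = 0" if v: "v \<in> Z" for v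
  proof -
    let ?p = "inner (T (h - z)) (T v)" and ?q = "inner (T v) (T v)"
    have quad: "2 * t * ?p \<le> t\<^sup>2 * ?q" for t
    proof -
      have "z + t *\<^sub>R v \<in> Z" by (intro subspace_add[OF Z(1) zZ] subspace_scale[OF Z(1) v])
      from d_le[OF this] have "?f z \<le> ?f (z + t *\<^sub>R v)" using fz by linarith
      moreover have "T (h - (z + t *\<^sub>R v)) = T (h - z) - t *\<^sub>R T v"
        by (simp add: T.diff T.add T.scaleR)
      moreover have "(norm (T (h - z) - t *\<^sub>R T v))\<^sup>2 = ?f z - 2 * t * ?p + t\<^sup>2 * ?q"
        by (simp only: power2_norm_eq_inner inner_diff_left inner_diff_right inner_scaleR_left
            inner_scaleR_right inner_commute[of "T v" "T (h - z)"])
          (simp add: power2_eq_square algebra_simps)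
      ultimately show ?thesis by simp
    qed
    show ?thesis
    proof (rule ccontr)
      assume p0: "?p \<noteq> 0"
      have q0: "0 \<le> ?q" by simp
      \<comment> \<open>Up to the added 1, this minimizes the quadratic function of \<open>t\<close>
        behind \<open>quad\<close>; the 1 keeps the divisor positive when
        \<open>T v = 0\<close>.\<close>
      define t where "t = ?p / (?q + 1)"
      have "2 * t * ?p \<le> t\<^sup>2 * ?q" by (rule quad)
      also have "\<dots> \<le> t\<^sup>2 * (?q + 1)" by (simp add: distrib_left)
      also have "\<dots> = t * ?p" using q0 by (simp add: t_def power2_eq_square)
      finally have "t * ?p \<le> 0" by simp
      moreover have "t * ?p = ?p\<^sup>2 / (?q + 1)" by (simp add: t_def power2_eq_square)
      moreover have "0 < ?q + 1" using q0 by linarith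
      then have "0 < ?p\<^sup>2 / (?q + 1)" using p0 by (intro divide_pos_pos) simp_all
      ultimately show False by linarith
    qed
  qed
  then show ?thesis using that zZ by blast
qed

section \<open>An orthonormal basis of the subspace obtained as in an echelon form\<close>

definition vanishing :: "nat \<Rightarrow> 'a set" where
  "vanishing k = {y \<in> Y. \<forall>i<k. coords (T y) i = 0}"

text \<open>These are the pivots: \<open>vanishing (Suc k)\<close> is the kernel of one functional
  on \<open>vanishing k\<close>, so the filtration drops by at most one dimension at each step, and
  it drops exactly at these \<open>k\<close>.\<close>

definition leading :: "nat set" where
  "leading = {k. \<exists>y\<in>vanishing k. coords (T y) k \<noteq> 0}"

lemma bounded_linear_coords_T: "bounded_linear (\<lambda>y. coords (T y) i)"
  by (rule bounded_linear_compose[OF bounded_linear_coords T])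

lemma subspace_vanishing: "subspace (vanishing k)"
proof (rule subspaceI)
  show "0 \<in> vanishing k"
    using subspace_0[OF sub] by (simp add: vanishing_def T.zero zero_l2.rep_eq)
  show "x + y \<in> vanishing k" if "x \<in> vanishing k" "y \<in> vanishing k" for x y
    using subspace_add[OF sub, of x y] that by (simp add: vanishing_def T.add plus_l2.rep_eq)
  show "c *\<^sub>R x \<in> vanishing k" if "x \<in> vanishing k" for c x
    using subspace_scale[OF sub, of x c] that by (simp add: vanishing_def T.scaleR scaleR_l2.rep_eq)
qed

lemma closed_vanishing: "closed (vanishing k)"
proof -
  have "vanishing k = Y \<inter> (\<Inter>i\<in>{..<k}. {y. coords (T y) i = 0})" by (auto simp: vanishing_def)
  moreover have "closed {y. coords (T y) i = 0}" for i
    by (intro closed_Collect_eq continuous_on_const linear_continuous_on bounded_linear_coords_T)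
  ultimately show ?thesis using cl by (auto intro!: closed_Int closed_INT)
qed

lemma vanishing_mono: "i \<le> k \<Longrightarrow> vanishing k \<subseteq> vanishing i"
  by (auto simp: vanishing_def)

text \<open>Subtracting the projection onto \<open>vanishing (Suc k)\<close> makes \<open>h\<close>
  orthogonal to that space and leaves coordinate \<open>k\<close> unchanged, because this coordinate
  vanishes there.\<close>

lemma leading_vector:
  assumes "k \<in> leading"
  shows "\<exists>v\<in>vanishing k. norm (T v) = 1 \<and> coords (T v) k \<noteq> 0 \<and>
    (\<forall>w\<in>vanishing (Suc k). inner (T v) (T w) = 0)"
proof -
  obtain h where h: "h \<in> vanishing k" "coords (T h) k \<noteq> 0" using assms unfolding leading_def by blast
  have Y: "vanishing (Suc k) \<subseteq> Y" "h \<in> Y" using h by (auto simp: vanishing_def)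
  obtain z where z: "z \<in> vanishing (Suc k)" "\<And>w. w \<in> vanishing (Suc k) \<Longrightarrow> inner (T (h - z)) (T w) = 0"
    by (rule orthogonal_projection[OF subspace_vanishing closed_vanishing Y]) blast
  let ?u = "h - z"
  have u: "?u \<in> vanishing k"
    using subspace_diff[OF subspace_vanishing h(1)] z(1) vanishing_mono[of k "Suc k"] by auto
  have "coords (T z) k = 0" using z(1) by (simp add: vanishing_def)
  then have c: "coords (T ?u) k \<noteq> 0" using h(2) by (simp add: T.diff minus_l2.rep_eq)
  then have n: "norm (T ?u) \<noteq> 0" by (auto simp: zero_l2.rep_eq)
  let ?v = "(1 / norm (T ?u)) *\<^sub>R ?u"
  show ?thesis
  proof (intro bexI conjI ballI)
    show "?v \<in> vanishing k" by (rule subspace_scale[OF subspace_vanishing u])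
    show "norm (T ?v) = 1" using n by (simp add: T.scaleR)
    show "coords (T ?v) k \<noteq> 0" using c n by (simp add: T.scaleR scaleR_l2.rep_eq)
    show "inner (T ?v) (T w) = 0" if "w \<in> vanishing (Suc k)" for w
      using z(2)[OF that] by (simp only: T.scaleR inner_scaleR_left)
  qed
qed

definition basis :: "nat \<Rightarrow> 'a" where
  "basis k = (SOME v. v \<in> vanishing k \<and> norm (T v) = 1 \<and> coords (T v) k \<noteq> 0 \<and>
    (\<forall>w\<in>vanishing (Suc k). inner (T v) (T w) = 0))"

lemma
  assumes "k \<in> leading"
  shows basis_vanishing: "basis k \<in> vanishing k" and basis_norm: "norm (T (basis k)) = 1"
    and basis_coord: "coords (T (basis k)) k \<noteq> 0"
    and basis_orthogonal: "w \<in> vanishing (Suc k) \<Longrightarrow> inner (T (basis k)) (T w) = 0"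
proof -
  have "\<exists>v. v \<in> vanishing k \<and> norm (T v) = 1 \<and> coords (T v) k \<noteq> 0 \<and>
      (\<forall>w\<in>vanishing (Suc k). inner (T v) (T w) = 0)"
    using leading_vector[OF assms] by blast
  from someI_ex[OF this] show "basis k \<in> vanishing k" "norm (T (basis k)) = 1"
    "coords (T (basis k)) k \<noteq> 0" "w \<in> vanishing (Suc k) \<Longrightarrow> inner (T (basis k)) (T w) = 0"
    unfolding basis_def by blast+
qed

lemma vanishing_subset: "vanishing k \<subseteq> Y"
  by (auto simp: vanishing_def)

lemma basis_orthonormal:
  assumes "i \<in> leading" "j \<in> leading"
  shows "inner (T (basis i)) (T (basis j)) = (if i = j then 1 else 0)"
proof -
  have *: "inner (T (basis i)) (T (basis j)) = 0" if "i < j" "i \<in> leading" "j \<in> leading" for i j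
    using basis_orthogonal[OF that(2)] basis_vanishing[OF that(3)] vanishing_mono[of "Suc i" j] that(1)
    by auto
  show ?thesis
  proof (cases "i = j")
    case True
    have "inner (T (basis j)) (T (basis j)) = (norm (T (basis j)))\<^sup>2"
      by (simp only: power2_norm_eq_inner)
    then show ?thesis using True basis_norm[OF assms(2)] by simp
  next
    case False
    then have "i < j \<or> j < i" by auto
    then show ?thesis using *[of i j] *[of j i] assms False by (auto simp: inner_commute)
  qed
qed

text \<open>If all coordinates before \<open>k\<close> vanish, a multiple \<open>a\<close> of
  \<open>basis k\<close> removes coordinate \<open>k\<close> too. The difference is then orthogonal
  to \<open>basis k\<close>, as is \<open>h\<close>, so \<open>a = 0\<close> and coordinate
  \<open>k\<close> was already zero. Hence \<open>T h = 0\<close>, and \<open>T\<close> is bounded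
  below.\<close>

lemma orthogonal_basis_zero:
  assumes "h \<in> Y" "\<And>k. k \<in> leading \<Longrightarrow> inner (T h) (T (basis k)) = 0"
  shows "h = 0"
proof -
  have "h \<in> vanishing k" for k
  proof (induction k)
    case (Suc k)
    have "coords (T h) k = 0"
    proof (rule ccontr)
      assume c: "coords (T h) k \<noteq> 0"
      then have k: "k \<in> leading" using Suc unfolding leading_def by blast
      define a where "a = coords (T h) k / coords (T (basis k)) k"
      have "h - a *\<^sub>R basis k \<in> vanishing k"
        by (intro subspace_diff[OF subspace_vanishing Suc] subspace_scale[OF subspace_vanishing] basis_vanishing k)
      moreover have "coords (T (h - a *\<^sub>R basis k)) k = 0"
        using basis_coord[OF k] by (simp add: T.diff T.scaleR minus_l2.rep_eq scaleR_l2.rep_eq a_def)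
      ultimately have "h - a *\<^sub>R basis k \<in> vanishing (Suc k)" by (auto simp: vanishing_def less_Suc_eq)
      then have "inner (T (basis k)) (T (h - a *\<^sub>R basis k)) = 0" by (rule basis_orthogonal[OF k])
      then have "a = 0"
        using assms(2)[OF k] basis_orthonormal[OF k k]
        by (simp add: T.diff T.scaleR inner_diff_right inner_commute)
      then show False using c basis_coord[OF k] by (simp add: a_def)
    qed
    then show ?case using Suc by (auto simp: vanishing_def less_Suc_eq)
  qed (simp add: vanishing_def assms(1))
  then have "coords (T h) k = 0" for k using spec[of "\<lambda>k. h \<in> vanishing k" "Suc k"] by (auto simp: vanishing_def)
  then have "T h = 0" by (rule l2_eq_0I)
  then show ?thesis using norm_le[OF assms(1)] by simp
qed

text \<open>With finitely many pivots, every vector of \<open>Y\<close> minus its finite expansion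
  would be orthogonal to the basis and hence zero, so \<open>Y\<close> would be finitely
  spanned.\<close>

lemma leading_infinite:
  assumes "infinite_dimensional Y"
  shows "infinite leading"
proof
  assume fin: "finite leading"
  have "y \<in> span (basis ` leading)" if y: "y \<in> Y" for y
  proof -
    let ?s = "\<Sum>k\<in>leading. inner (T y) (T (basis k)) *\<^sub>R basis k"
    have bY: "basis k \<in> Y" if "k \<in> leading" for k using basis_vanishing[OF that] vanishing_subset by blast
    have sY: "?s \<in> Y" by (intro subspace_sum[OF sub] subspace_scale[OF sub] bY)
    have "inner (T (y - ?s)) (T (basis j)) = 0" if j: "j \<in> leading" for j
    proof -
      have "inner (T ?s) (T (basis j)) =
          (\<Sum>k\<in>leading. inner (T y) (T (basis k)) * inner (T (basis k)) (T (basis j)))"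
        by (simp add: T.sum T.scaleR inner_sum_left)
      also have "\<dots> = (\<Sum>k\<in>leading. if k = j then inner (T y) (T (basis k)) else 0)"
        by (rule sum.cong) (simp_all add: basis_orthonormal[OF _ j])
      also have "\<dots> = inner (T y) (T (basis j))" using fin j by (simp add: sum.delta)
      finally show ?thesis by (simp add: T.diff inner_diff_left)
    qed
    then have "y - ?s = 0" by (intro orthogonal_basis_zero subspace_diff[OF sub y sY])
    moreover have "?s \<in> span (basis ` leading)"
      by (intro span_sum span_scale span_base) blast
    ultimately show ?thesis by simp
  qed
  then show False using assms fin unfolding infinite_dimensional_def by blast
qed

text \<open>\<open>S\<close> takes coefficients and \<open>U\<close> sums the series.
  \<open>S\<close> is defined on the whole space because \<open>T\<close> is; hence
  \<open>S \<circ> U\<close> is the identity, \<open>U \<circ> S\<close> is a projection onto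
  \<open>Y\<close>, and \<open>U\<close> with inverse \<open>S\<close> on \<open>Y\<close> is the
  isomorphism.\<close>

lemma complemented_isomorphic:
  assumes "infinite_dimensional Y"
  shows "complemented Y \<and> isomorphic_to_l2 Y"
proof -
  note inf = leading_infinite[OF assms]
  define b where "b k = basis (enumerate leading k)" for k
  have L: "enumerate leading k \<in> leading" for k by (rule enumerate_in_set[OF inf])
  have bY: "b k \<in> Y" for k using basis_vanishing[OF L] vanishing_subset unfolding b_def by blast
  have on: "inner (T (b i)) (T (b j)) = (if i = j then 1 else 0)" for i j
    using basis_orthonormal[OF L L, of i j] inj_enumerate[OF inf] by (auto simp: b_def inj_def)
  have zero: "h = 0" if "h \<in> Y" "\<And>k. inner (T h) (T (b k)) = 0" for h
  proof (rule orthogonal_basis_zero[OF that(1)])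
    fix k assume "k \<in> leading"
    then obtain i where "enumerate leading i = k" using enumerate_Ex[OF inf] by blast
    then show "inner (T h) (T (basis k)) = 0" using that(2)[of i] by (auto simp: b_def)
  qed
  obtain C where C: "0 \<le> C" "\<And>x. norm (T x) \<le> norm x * C" using T.nonneg_bounded by blast
  define S where "S x = Abs_l2 (\<lambda>i. inner (T x) (T (b i)))" for x
  have lin: "linear (\<lambda>x. inner (T x) (T (b i)))" for i
    by (intro linearI) (simp_all add: T.add T.scaleR inner_add_left)
  have bessel: "(\<Sum>i<N. (inner (T x) (T (b i)))\<^sup>2) \<le> (C * norm x)\<^sup>2" for N x
  proof -
    have "(\<Sum>i<N. (inner (T x) (T (b i)))\<^sup>2) \<le> (norm (T x))\<^sup>2" by (rule Bessel_inequality) (rule on)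
    also have "\<dots> \<le> (C * norm x)\<^sup>2" using C(2)[of x] by (intro power_mono) (simp_all add: mult.commute)
    finally show ?thesis .
  qed
  have S: "bounded_linear S" and Sc: "coords (S x) i = inner (T x) (T (b i))" for x i
    unfolding S_def using bounded_linear_into_l2[OF lin bessel C(1)] by blast+
  have nb: "norm (\<Sum>k\<in>J. coords a k *\<^sub>R b k) \<le> sqrt (\<Sum>k\<in>J. (coords a k)\<^sup>2) / \<delta>" if "finite J" for a J
  proof -
    have "(\<Sum>k\<in>J. coords a k *\<^sub>R b k) \<in> Y" by (intro subspace_sum[OF sub] subspace_scale[OF sub] bY)
    from norm_le[OF this] show ?thesis
      using orthonormal_norm_sum[of "\<lambda>k. T (b k)" J "coords a", OF on that] by (simp add: T.sum T.scaleR)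
  qed
  \<comment> \<open>Norms of finite sums in \<open>Y\<close> are at most 1 / \<delta> times those of
    their images, which are orthonormal sums; so the tails are controlled by the tails of the square
    sum.\<close>
  have summ: "summable (\<lambda>k. coords a k *\<^sub>R b k)" for a
    unfolding summable_Cauchy
  proof (intro allI impI)
    fix e :: real assume e: "0 < e"
    have "summable (\<lambda>k. (coords a k)\<^sup>2)" using coords[of a] by simp
    then obtain N where N: "\<And>m n. N \<le> m \<Longrightarrow> norm (\<Sum>k = m..<n. (coords a k)\<^sup>2) < (\<delta> * e)\<^sup>2"
      unfolding summable_Cauchy using e pos by (meson mult_pos_pos zero_less_power)
    have "norm (\<Sum>k = m..<n. coords a k *\<^sub>R b k) < e" if "N \<le> m" for m n
    proof -
      have "sqrt (\<Sum>k = m..<n. (coords a k)\<^sup>2) < sqrt ((\<delta> * e)\<^sup>2)"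
        using N[OF that, of n] by (intro real_sqrt_less_mono) simp
      moreover have "sqrt ((\<delta> * e)\<^sup>2) = \<delta> * e" using e pos by (simp only: real_sqrt_abs) simp
      ultimately have "sqrt (\<Sum>k = m..<n. (coords a k)\<^sup>2) < \<delta> * e" by simp
      then have "sqrt (\<Sum>k = m..<n. (coords a k)\<^sup>2) / \<delta> < e" using e pos by (simp add: field_simps)
      then show ?thesis using nb[of "{m..<n}" a] by simp
    qed
    then show "\<exists>N. \<forall>m\<ge>N. \<forall>n. norm (\<Sum>k = m..<n. coords a k *\<^sub>R b k) < e" by blast
  qed
  define U where "U a = (\<Sum>k. coords a k *\<^sub>R b k)" for a
  have Ulim: "(\<lambda>N. \<Sum>k<N. coords a k *\<^sub>R b k) \<longlonglongrightarrow> U a" for a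
    unfolding U_def by (rule summable_LIMSEQ[OF summ])
  have UY: "U a \<in> Y" for a
    by (rule closed_sequentially[OF cl _ Ulim]) (intro subspace_sum[OF sub] subspace_scale[OF sub] bY)
  have U: "bounded_linear U"
  proof (rule bounded_linear_intro)
    fix a c r
    show "U (a + c) = U a + U c"
      unfolding U_def by (simp add: plus_l2.rep_eq scaleR_add_left suminf_add[OF summ summ])
    show "U (r *\<^sub>R a) = r *\<^sub>R U a"
      unfolding U_def by (simp add: scaleR_l2.rep_eq suminf_scaleR_right[OF summ] flip: scaleR_scaleR)
    show "norm (U a) \<le> norm a * (1 / \<delta>)"
    proof (rule LIMSEQ_le_const2[OF tendsto_norm[OF Ulim]], intro exI allI impI)
      fix N
      have "sqrt (\<Sum>k<N. (coords a k)\<^sup>2) \<le> norm a"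
        unfolding norm_l2.rep_eq using coords[of a]
        by (intro real_sqrt_le_mono sum_le_suminf) auto
      then have "sqrt (\<Sum>k<N. (coords a k)\<^sup>2) / \<delta> \<le> norm a * (1 / \<delta>)" using pos by (simp add: divide_right_mono)
      then show "norm (\<Sum>k<N. coords a k *\<^sub>R b k) \<le> norm a * (1 / \<delta>)" using nb[of "{..<N}" a] by simp
    qed
  qed
  have SU: "S (U a) = a" for a
  proof -
    have "coords (S (U a)) i = coords a i" for i
    proof -
      have "(\<lambda>N. inner (T (\<Sum>k<N. coords a k *\<^sub>R b k)) (T (b i))) \<longlonglongrightarrow> inner (T (U a)) (T (b i))"
        by (intro tendsto_intros T.tendsto Ulim)
      moreover have "inner (T (\<Sum>k<N. coords a k *\<^sub>R b k)) (T (b i)) = (if i < N then coords a i else 0)" for N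
        by (simp add: T.sum T.scaleR inner_sum_left on sum.delta if_distrib cong: if_cong)
      ultimately have "(\<lambda>N. if i < N then coords a i else 0) \<longlonglongrightarrow> inner (T (U a)) (T (b i))" by simp
      moreover have "(\<lambda>N. if i < N then coords a i else 0) \<longlonglongrightarrow> coords a i"
        by (rule tendsto_eventually, rule eventually_mono[OF eventually_gt_at_top[of i]]) simp
      ultimately show ?thesis unfolding Sc by (rule LIMSEQ_unique)
    qed
    then show ?thesis by (intro coords_inject[THEN iffD1] ext)
  qed
  have US: "U (S y) = y" if y: "y \<in> Y" for y
  proof -
    have "inner (T (y - U (S y))) (T (b k)) = 0" for k
      using Sc[of y k] Sc[of "U (S y)" k] by (simp add: SU T.diff inner_diff_left)
    then have "y - U (S y) = 0" by (intro zero subspace_diff[OF sub y UY])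
    then show ?thesis by simp
  qed
  have "bounded_linear (U \<circ> S)" unfolding comp_def by (rule bounded_linear_compose[OF U S])
  moreover have "(U \<circ> S) \<circ> (U \<circ> S) = U \<circ> S" by (simp add: fun_eq_iff SU)
  moreover have "range (U \<circ> S) = Y"
  proof (intro equalityI subsetI)
    fix y assume "y \<in> Y"
    then have "y = (U \<circ> S) y" using US by simp
    then show "y \<in> range (U \<circ> S)" by (rule range_eqI)
  qed (use UY in auto)
  ultimately have "complemented Y" unfolding complemented_def by blast
  moreover have "homeomorphism UNIV Y U S"
    unfolding homeomorphism_def
  proof (intro conjI ballI SU US)
    show "range U = Y"
    proof (intro equalityI subsetI)
      fix y assume "y \<in> Y"
      from US[OF this, symmetric] show "y \<in> range U" by (rule range_eqI)
    qed (use UY in auto)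
    show "S ` Y = UNIV"
    proof (intro equalityI subsetI)
      fix a
      show "a \<in> S ` Y" using SU[of a] UY[of a] by (metis image_eqI)
    qed simp
  qed (simp_all add: linear_continuous_on U S)
  then have "isomorphic_to_l2 Y"
    unfolding isomorphic_to_l2_def using bounded_linear.linear[OF U] by blast
  ultimately show ?thesis by blast
qed

end

section \<open>The controlling operator\<close>

context jt_space
begin

text \<open>Extension by density. The Lipschitz estimate makes \<open>g\<close> depend on
  \<open>\<iota> x\<close> only, and \<open>key\<close> makes the limit independent of the
  approximating sequence; linearity follows by choosing sums and multiples of
  approximations.\<close>

lemma functional_extension:
  assumes add: "\<And>x y. x \<in> c00 \<Longrightarrow> y \<in> c00 \<Longrightarrow> g (\<lambda>i. x i + y i) = g x + g y"
    and scale: "\<And>c x. x \<in> c00 \<Longrightarrow> g (\<lambda>i. c * x i) = c * (g x :: real)"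
    and bound: "\<And>x. x \<in> c00 \<Longrightarrow> \<bar>g x\<bar> \<le> JN x"
  shows "\<exists>f. bounded_linear f \<and> (\<forall>x\<in>c00. f (\<iota> x) = g x)"
proof -
  have lip: "\<bar>g x - g y\<bar> \<le> norm (\<iota> x - \<iota> y)" if x: "x \<in> c00" and y: "y \<in> c00" for x y
  proof -
    let ?d = "\<lambda>i. x i + (- 1) * y i"
    have y': "(\<lambda>i. (- 1) * y i) \<in> c00" by (rule c00_scale[OF y])
    have d: "?d \<in> c00" by (rule c00_add[OF x y'])
    have "g ?d = g x - g y" unfolding add[OF x y'] scale[OF y] by simp
    moreover have "\<iota> ?d = \<iota> x - \<iota> y" unfolding io_add[OF x y'] io_scale[OF y] by simp
    ultimately show ?thesis using bound[OF d] norm_io[OF d] by simp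
  qed
  have "\<exists>x. x \<in> c00 \<and> norm (y - \<iota> x) < inverse (Suc k)" for y k
    using io_dense[of "inverse (Suc k)" y] by (metis inverse_positive_iff_positive of_nat_0_less_iff zero_less_Suc)
  then obtain a where a: "\<And>y k. a y k \<in> c00" "\<And>y k. norm (y - \<iota> (a y k)) < inverse (Suc k)" by metis
  have alim: "(\<lambda>k. \<iota> (a y k)) \<longlonglongrightarrow> y" for y
  proof -
    have "(\<lambda>k. y - \<iota> (a y k)) \<longlonglongrightarrow> 0"
      by (rule Lim_null_comparison[OF _ LIMSEQ_inverse_real_of_nat], rule always_eventually)
        (intro allI less_imp_le a(2))
    from tendsto_diff[OF tendsto_const[of y] this] show ?thesis by simp
  qed
  have "Cauchy (\<lambda>k. g (a y k))" for y
  proof (rule metric_CauchyI)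
    fix e :: real assume "0 < e"
    then obtain M where "\<forall>m\<ge>M. \<forall>n\<ge>M. dist (\<iota> (a y m)) (\<iota> (a y n)) < e"
      using metric_CauchyD[OF LIMSEQ_imp_Cauchy[OF alim[of y]]] by blast
    then show "\<exists>M. \<forall>m\<ge>M. \<forall>n\<ge>M. dist (g (a y m)) (g (a y n)) < e"
      using lip[OF a(1) a(1)] by (metis dist_norm le_less_trans real_norm_def)
  qed
  then have "\<exists>l. (\<lambda>k. g (a y k)) \<longlonglongrightarrow> l" for y using Cauchy_convergent convergent_def by blast
  then obtain f where f: "\<And>y. (\<lambda>k. g (a y k)) \<longlonglongrightarrow> f y" by metis
  have key: "f y = l" if x: "\<And>k. x k \<in> c00" and xy: "(\<lambda>k. \<iota> (x k)) \<longlonglongrightarrow> y" and gl: "(\<lambda>k. g (x k)) \<longlonglongrightarrow> l"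
    for x y l
  proof -
    have "(\<lambda>k. \<iota> (x k) - \<iota> (a y k)) \<longlonglongrightarrow> 0" using tendsto_diff[OF xy alim[of y]] by simp
    then have "(\<lambda>k. norm (\<iota> (x k) - \<iota> (a y k))) \<longlonglongrightarrow> 0" by (rule tendsto_norm_zero)
    then have "(\<lambda>k. g (x k) - g (a y k)) \<longlonglongrightarrow> 0"
      by (rule Lim_null_comparison[rotated]) (simp add: lip[OF x a(1)])
    from tendsto_diff[OF gl this] have "(\<lambda>k. g (a y k)) \<longlonglongrightarrow> l" by simp
    then show ?thesis using f LIMSEQ_unique by blast
  qed
  have "bounded_linear f"
  proof (rule bounded_linear_intro)
    fix y z :: 'a and r :: real
    show "f (y + z) = f y + f z"
    proof (rule key)
      show "(\<lambda>i. a y k i + a z k i) \<in> c00" for k by (intro c00_add a)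
      show "(\<lambda>k. \<iota> (\<lambda>i. a y k i + a z k i)) \<longlonglongrightarrow> y + z"
        unfolding io_add[OF a(1) a(1)] by (intro tendsto_add alim)
      show "(\<lambda>k. g (\<lambda>i. a y k i + a z k i)) \<longlonglongrightarrow> f y + f z"
        unfolding add[OF a(1) a(1)] by (intro tendsto_add f)
    qed
    show "f (r *\<^sub>R y) = r *\<^sub>R f y"
    proof (rule key)
      show "(\<lambda>i. r * a y k i) \<in> c00" for k by (intro c00_scale a)
      show "(\<lambda>k. \<iota> (\<lambda>i. r * a y k i)) \<longlonglongrightarrow> r *\<^sub>R y"
        unfolding io_scale[OF a(1)] by (intro tendsto_scaleR tendsto_const alim)
      show "(\<lambda>k. g (\<lambda>i. r * a y k i)) \<longlonglongrightarrow> r *\<^sub>R f y"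
        unfolding scale[OF a(1)] real_scaleR_def by (intro tendsto_mult tendsto_const f)
    qed
    show "norm (f y) \<le> norm y * 1"
    proof (rule LIMSEQ_le[OF tendsto_norm[OF f]])
      show "(\<lambda>k. norm (\<iota> (a y k)) * 1) \<longlonglongrightarrow> norm y * 1" by (intro tendsto_intros alim)
      show "\<exists>N. \<forall>k\<ge>N. norm (g (a y k)) \<le> norm (\<iota> (a y k)) * 1"
        using bound[OF a(1)] by (simp add: norm_io[OF a(1)])
    qed
  qed
  moreover have "f (\<iota> x) = g x" if "x \<in> c00" for x
    by (rule key[of "\<lambda>_. x"]) (simp_all add: that)
  ultimately show ?thesis by blast
qed

lemma control_operator:
  assumes "finite B" "B \<subseteq> branches D R"
  obtains T :: "'a \<Rightarrow> l2" where "bounded_linear T"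
    "\<And>x k. x \<in> c00 \<Longrightarrow> k \<le> q \<Longrightarrow> \<bar>x k\<bar> \<le> norm (T (\<iota> x))"
    "\<And>x \<sigma> N. x \<in> c00 \<Longrightarrow> \<sigma> \<in> B \<Longrightarrow> phn \<sigma> N x \<le> norm (T (\<iota> x))"
proof -
  obtain Bs where Bs: "set Bs = B" using finite_list[OF assms(1)] by blast
  define b where "b = length Bs"
  \<comment> \<open>Row 0 holds the coordinates up to \<open>q\<close>, row \<open>r\<close> the
    functionals of the branch at list position \<open>r - 1\<close>. Functionals are numbered from
    1, so column \<open>k\<close> holds functional \<open>Suc k\<close>. Padding with 0 lets
    \<open>prod_decode\<close> flatten the rows into one sequence.\<close>
  define G where "G r k x = (if r = 0 then if k \<le> q then x k else 0
      else if r \<le> b then pairing (ph (Bs ! (r - 1)) (Suc k)) x else 0)" for r k and x :: "nat \<Rightarrow> real"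
  have br: "Bs ! (r - 1) \<in> branches D R" if "r \<noteq> 0" "r \<le> b" for r
    using nth_mem[of "r - 1" Bs] that Bs assms(2) by (auto simp: b_def)
  have psum: "(\<Sum>k\<le>N. (pairing (ph \<sigma> (Suc k)) x)\<^sup>2) \<le> (JN x)\<^sup>2"
    if \<sigma>: "\<sigma> \<in> branches D R" and x: "x \<in> c00" for \<sigma> x N
  proof -
    have "(\<Sum>k\<le>N. (pairing (ph \<sigma> (Suc k)) x)\<^sup>2) = (\<Sum>k = 1..Suc N. (pairing (ph \<sigma> k) x)\<^sup>2)"
      by (rule sum.reindex_bij_witness[of _ "\<lambda>k. k - 1" Suc]) auto
    also have "\<dots> = (phn \<sigma> (Suc N) x)\<^sup>2" by (simp add: phn_def L2_set_def sum_nonneg)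
    also have "\<dots> \<le> (JN x)\<^sup>2" by (intro power_mono phn_le_JN \<sigma> x phn_nonneg)
    finally show ?thesis .
  qed
  have inner: "(\<Sum>k\<le>N. (G r k x)\<^sup>2) \<le> (if r \<le> b then (Suc q) * (JN x)\<^sup>2 else 0)" if x: "x \<in> c00" for r N x
  proof (cases "r = 0")
    case True
    have "(\<Sum>k\<le>N. (G r k x)\<^sup>2) \<le> (\<Sum>k\<le>N. if k \<le> q then (JN x)\<^sup>2 else 0)"
    proof (rule sum_mono)
      fix k
      have "\<bar>x k\<bar>\<^sup>2 \<le> (JN x)\<^sup>2" by (intro power_mono abs_coord_le_JN x) simp
      then show "(G r k x)\<^sup>2 \<le> (if k \<le> q then (JN x)\<^sup>2 else 0)" using True by (simp add: G_def)
    qed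
    also have "\<dots> = (\<Sum>k\<in>{..N} \<inter> {..q}. (JN x)\<^sup>2)"
      by (simp only: sum.inter_restrict[OF finite_atMost] atMost_iff)
    also have "\<dots> \<le> (\<Sum>k\<in>{..q}. (JN x)\<^sup>2)" by (rule sum_mono2) auto
    finally show ?thesis using True by simp
  next
    case False
    show ?thesis
    proof (cases "r \<le> b")
      case True
      have "(\<Sum>k\<le>N. (G r k x)\<^sup>2) \<le> (JN x)\<^sup>2" using psum[OF br[OF False True] x] False True by (simp add: G_def)
      also have "\<dots> \<le> (Suc q) * (JN x)\<^sup>2" by (simp add: distrib_right)
      finally show ?thesis using True by simp
    qed (simp add: G_def False)
  qed
  \<comment> \<open>Each of the \<open>b + 1\<close> rows contributes at most \<open>Suc q\<close>
    times \<open>(JN x)\<^sup>2\<close>. Since \<open>C\<close> is at least 1, its square is an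
    upper bound as well.\<close>
  define C where "C = real ((b + 1) * Suc q)"
  have total: "(\<Sum>j<N. (case prod_decode j of (r, k) \<Rightarrow> G r k x)\<^sup>2) \<le> (C * JN x)\<^sup>2"
    if x: "x \<in> c00" for N x
  proof -
    let ?h = "\<lambda>p. (case p of (r, k) \<Rightarrow> G r k x)\<^sup>2"
    have sub: "prod_decode ` {..<N} \<subseteq> {..N} \<times> {..N}"
    proof
      fix p assume "p \<in> prod_decode ` {..<N}"
      then have "prod_encode p < N" by auto
      then show "p \<in> {..N} \<times> {..N}"
        using le_prod_encode_1[of "fst p" "snd p"] le_prod_encode_2[of "snd p" "fst p"] by (cases p) auto
    qed
    have "(\<Sum>j<N. ?h (prod_decode j)) = (\<Sum>p\<in>prod_decode ` {..<N}. ?h p)"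
      by (simp add: sum.reindex[OF inj_prod_decode])
    also have "\<dots> \<le> (\<Sum>p\<in>{..N} \<times> {..N}. ?h p)" by (rule sum_mono2[OF _ sub]) auto
    also have "\<dots> = (\<Sum>r\<le>N. \<Sum>k\<le>N. (G r k x)\<^sup>2)" by (simp add: sum.cartesian_product case_prod_unfold)
    also have "\<dots> \<le> (\<Sum>r\<le>N. if r \<le> b then (Suc q) * (JN x)\<^sup>2 else 0)" by (intro sum_mono inner x)
    also have "\<dots> = (\<Sum>r\<in>{..N} \<inter> {..b}. (Suc q) * (JN x)\<^sup>2)"
      by (simp only: sum.inter_restrict[OF finite_atMost] atMost_iff)
    also have "\<dots> \<le> (\<Sum>r\<in>{..b}. (Suc q) * (JN x)\<^sup>2)" by (rule sum_mono2) auto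
    also have "\<dots> = C * (JN x)\<^sup>2" by (simp add: C_def algebra_simps)
    also have "\<dots> \<le> C\<^sup>2 * (JN x)\<^sup>2"
    proof (rule mult_right_mono)
      have "1 \<le> C" by (simp add: C_def)
      then show "C \<le> C\<^sup>2" by (simp add: power2_eq_square)
    qed simp
    finally show ?thesis by (simp add: power_mult_distrib)
  qed
  have ext: "\<exists>f. bounded_linear f \<and> (\<forall>x\<in>c00. f (\<iota> x) = (case prod_decode j of (r, k) \<Rightarrow> G r k x))" for j
  proof (rule functional_extension)
    obtain r k where rk: "prod_decode j = (r, k)" by fastforce
    show "(case prod_decode j of (r, k) \<Rightarrow> G r k (\<lambda>i. x i + y i)) =
        (case prod_decode j of (r, k) \<Rightarrow> G r k x) + (case prod_decode j of (r, k) \<Rightarrow> G r k y)"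
      if "x \<in> c00" "y \<in> c00" for x y
      by (simp add: rk G_def pairing_add that)
    show "(case prod_decode j of (r, k) \<Rightarrow> G r k (\<lambda>i. c * x i)) = c * (case prod_decode j of (r, k) \<Rightarrow> G r k x)"
      for c x by (simp add: rk G_def pairing_scale)
    show "\<bar>case prod_decode j of (r, k) \<Rightarrow> G r k x\<bar> \<le> JN x" if x: "x \<in> c00" for x
    proof -
      have "\<bar>G r k x\<bar> \<le> JN x"
      proof (cases "r \<noteq> 0 \<and> r \<le> b")
        case True
        have "(pairing (ph (Bs ! (r - 1)) (Suc k)) x)\<^sup>2 \<le> (\<Sum>i\<le>k. (pairing (ph (Bs ! (r - 1)) (Suc i)) x)\<^sup>2)"
          by (rule member_le_sum) auto
        also have "\<dots> \<le> (JN x)\<^sup>2" using psum[OF br x] True by blast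
        finally have "\<bar>pairing (ph (Bs ! (r - 1)) (Suc k)) x\<bar> \<le> JN x"
          by (intro abs_le_square_iff[THEN iffD2, of _ "JN x", simplified abs_of_nonneg[OF JN_nonneg[OF x]]])
        then show ?thesis using True by (simp add: G_def)
      next
        case False
        then show ?thesis using abs_coord_le_JN[OF x, of k] JN_nonneg[OF x] by (auto simp: G_def)
      qed
      then show ?thesis by (simp add: rk)
    qed
  qed
  then have "\<exists>f. \<forall>j. bounded_linear (f j) \<and> (\<forall>x\<in>c00. f j (\<iota> x) = (case prod_decode j of (r, k) \<Rightarrow> G r k x))"
    by (intro choice allI)
  then obtain f where f: "\<And>j. bounded_linear (f j)"
    and fx: "\<And>j x. x \<in> c00 \<Longrightarrow> f j (\<iota> x) = (case prod_decode j of (r, k) \<Rightarrow> G r k x)" by blast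
  have fb: "(\<Sum>j<N. (f j y)\<^sup>2) \<le> (C * norm y)\<^sup>2" for N y
  proof -
    have "\<exists>x. x \<in> c00 \<and> norm (y - \<iota> x) < inverse (Suc k)" for k
      using io_dense[of "inverse (Suc k)" y] by (metis inverse_positive_iff_positive of_nat_0_less_iff zero_less_Suc)
    then obtain x where x: "\<And>k. x k \<in> c00" "\<And>k. norm (y - \<iota> (x k)) < inverse (Suc k)" by metis
    have "(\<lambda>k. y - \<iota> (x k)) \<longlonglongrightarrow> 0"
      by (rule Lim_null_comparison[OF _ LIMSEQ_inverse_real_of_nat], rule always_eventually)
        (intro allI less_imp_le x(2))
    from tendsto_diff[OF tendsto_const[of y] this] have lim: "(\<lambda>k. \<iota> (x k)) \<longlonglongrightarrow> y" by simp
    show ?thesis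
    proof (rule LIMSEQ_le)
      show "(\<lambda>k. \<Sum>j<N. (f j (\<iota> (x k)))\<^sup>2) \<longlonglongrightarrow> (\<Sum>j<N. (f j y)\<^sup>2)"
        by (intro tendsto_sum tendsto_power bounded_linear.tendsto[OF f] lim)
      show "(\<lambda>k. (C * norm (\<iota> (x k)))\<^sup>2) \<longlonglongrightarrow> (C * norm y)\<^sup>2" by (intro tendsto_intros lim)
      show "\<exists>M. \<forall>k\<ge>M. (\<Sum>j<N. (f j (\<iota> (x k)))\<^sup>2) \<le> (C * norm (\<iota> (x k)))\<^sup>2"
        using total[OF x(1)] by (simp add: fx[OF x(1)] norm_io[OF x(1)])
    qed
  qed
  define T where "T y = Abs_l2 (\<lambda>j. f j y)" for y
  have C0: "0 \<le> C" by (simp add: C_def)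
  have T: "bounded_linear T" and Tc: "coords (T y) j = f j y" for y j
    unfolding T_def using bounded_linear_into_l2[OF bounded_linear.linear[OF f] fb C0] by blast+
  have TG: "coords (T (\<iota> x)) (prod_encode (r, k)) = G r k x" if "x \<in> c00" for x r k
    by (simp add: Tc fx[OF that])
  have "\<bar>x k\<bar> \<le> norm (T (\<iota> x))" if "x \<in> c00" "k \<le> q" for x k
    using coords_le_norm[of "T (\<iota> x)" "prod_encode (0, k)"] that by (simp add: TG G_def)
  moreover have "phn \<sigma> N x \<le> norm (T (\<iota> x))" if x: "x \<in> c00" and \<sigma>: "\<sigma> \<in> B" for x \<sigma> N
  proof -
    obtain i where i: "i < b" "Bs ! i = \<sigma>" using \<sigma> Bs by (auto simp: in_set_conv_nth b_def)
    let ?e = "\<lambda>k. prod_encode (Suc i, k - 1)"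
    have inj: "inj_on ?e {1..N}"
      by (rule inj_onI) (auto dest!: inj_prod_encode[THEN injD])
    have "(\<Sum>k = 1..N. (pairing (ph \<sigma> k) x)\<^sup>2) = (\<Sum>k = 1..N. (coords (T (\<iota> x)) (?e k))\<^sup>2)"
      by (rule sum.cong) (use i in \<open>auto simp: TG[OF x] G_def\<close>)
    also have "\<dots> = (\<Sum>j\<in>?e ` {1..N}. (coords (T (\<iota> x)) j)\<^sup>2)"
      by (subst sum.reindex[OF inj]) (simp add: comp_def)
    also have "\<dots> \<le> (\<Sum>j. (coords (T (\<iota> x)) j)\<^sup>2)"
      using coords[of "T (\<iota> x)"] by (intro sum_le_suminf) auto
    finally show ?thesis
      unfolding phn_def L2_set_def norm_l2.rep_eq by (rule real_sqrt_le_mono)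
  qed
  ultimately show ?thesis using that[OF T] by blast
qed

end

context jt_subspace
begin

text \<open>If \<open>T\<close> were small at a unit vector of \<open>Y\<close>, an approximating
  \<open>x\<close> would have small coordinates up to \<open>q\<close>. Cutting them off would leave
  a deep vector still close to \<open>y\<close> on which all functionals of \<open>B\<close> are
  small, against the choice of \<open>q\<close> and \<open>d\<close>.\<close>

lemma bounded_below_operator:
  obtains T :: "'a \<Rightarrow> l2" and \<delta> where "bounded_linear T" "0 < \<delta>"
    "\<And>y. y \<in> Y \<Longrightarrow> \<delta> * norm y \<le> norm (T y)"
proof -
  obtain B where B: "finite B" "B \<subseteq> branches D R" "\<not> null_dir B" using finite_branches_control by blast
  then obtain q d where d: "0 < d" and large: "\<And>y x. y \<in> Y \<Longrightarrow> x \<in> c00 \<Longrightarrow> norm y = 1 \<Longrightarrow>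
      \<forall>i. x i \<noteq> 0 \<longrightarrow> q < i \<Longrightarrow> norm (y - \<iota> x) < d \<Longrightarrow> \<not> (\<forall>\<sigma>\<in>B. \<forall>N. phn \<sigma> N x \<le> d)"
    unfolding null_dir_def by blast
  obtain T :: "'a \<Rightarrow> l2" where T: "bounded_linear T"
    and Tk: "\<And>x k. x \<in> c00 \<Longrightarrow> k \<le> q \<Longrightarrow> \<bar>x k\<bar> \<le> norm (T (\<iota> x))"
    and Tp: "\<And>x \<sigma> N. x \<in> c00 \<Longrightarrow> \<sigma> \<in> B \<Longrightarrow> phn \<sigma> N x \<le> norm (T (\<iota> x))"
    by (rule control_operator[OF B(1,2), of q]) blast
  interpret T: bounded_linear T by (rule T)
  obtain C where C: "0 \<le> C" "\<And>x. norm (T x) \<le> norm x * C" using T.nonneg_bounded by blast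
  \<comment> \<open>Here \<open>\<kappa> = (1 + C) * \<delta>\<close> bounds
    \<open>norm (T (\<iota> x))\<close>. Each of the \<open>q + 1\<close> coordinates cut off costs
    at most \<kappa>, and the total \<open>(q + 2) * \<kappa>\<close> stays below
    \<open>(q + 4) * \<kappa> = d\<close>.\<close>
  define \<delta> where "\<delta> = d / ((real q + 4) * (1 + C))"
  have \<delta>: "0 < \<delta>" unfolding \<delta>_def using d C(1) by (intro divide_pos_pos mult_pos_pos) auto
  define \<kappa> where "\<kappa> = (1 + C) * \<delta>"
  have \<kappa>: "\<delta> \<le> \<kappa>" "0 < \<kappa>" using \<delta> C(1) by (simp_all add: \<kappa>_def distrib_right add_pos_nonneg)
  have \<kappa>d: "(real q + 4) * \<kappa> = d" using C(1) by (simp add: \<kappa>_def \<delta>_def)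
  then have \<kappa>q: "(real q + 2) * \<kappa> < d" using \<kappa>(2) by (simp add: distrib_right)
  have unit: "\<delta> \<le> norm (T y)" if y: "y \<in> Y" "norm y = 1" for y
  proof (rule ccontr)
    assume "\<not> \<delta> \<le> norm (T y)"
    then have small: "norm (T y) < \<delta>" by simp
    obtain x where x: "x \<in> c00" "norm (y - \<iota> x) < \<delta>" by (rule io_dense[OF \<delta>])
    have "norm (T (\<iota> x)) \<le> norm (T y) + norm (T (y - \<iota> x))"
      using norm_triangle_ineq4[of "T y" "T (y - \<iota> x)"] by (simp add: T.diff)
    also have "\<dots> \<le> \<delta> + \<delta> * C"
      using small C(2)[of "y - \<iota> x"] x(2) C(1) mult_right_mono[of "norm (y - \<iota> x)" \<delta> C] by linarith
    also have "\<dots> = \<kappa>" by (simp add: \<kappa>_def algebra_simps)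
    finally have Tx: "norm (T (\<iota> x)) \<le> \<kappa>" .
    let ?x1 = "restrict_to {..q} x" and ?x2 = "restrict_to {q<..} x"
    have x1: "?x1 \<in> c00" and x2: "?x2 \<in> c00" by (rule c00_restrict[OF x(1)])+
    have "JN ?x1 \<le> l1 ?x1" by (rule JN_le_l1[OF x1])
    also have "l1 ?x1 = (\<Sum>k\<le>q. \<bar>?x1 k\<bar>)" by (rule l1_eq) (auto simp: restrict_to_def split: if_splits)
    also have "\<dots> \<le> (\<Sum>k\<le>q. \<kappa>)"
    proof (rule sum_mono)
      fix k assume "k \<in> {..q}"
      then show "\<bar>?x1 k\<bar> \<le> \<kappa>" using Tk[OF x(1), of k] Tx by (simp add: restrict_to_def)
    qed
    finally have J1: "JN ?x1 \<le> (real q + 1) * \<kappa>" by (simp add: add.commute)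
    have "x = (\<lambda>i. ?x1 i + ?x2 i)" by (auto simp: restrict_to_def fun_eq_iff)
    then have "\<iota> x = \<iota> ?x1 + \<iota> ?x2" using io_add[OF x1 x2] by simp
    then have eq: "y - \<iota> ?x2 = (y - \<iota> x) + \<iota> ?x1" by simp
    have "norm (y - \<iota> ?x2) \<le> norm (y - \<iota> x) + JN ?x1"
      unfolding eq norm_io[OF x1, symmetric] by (rule norm_triangle_ineq)
    also have "\<dots> \<le> (real q + 2) * \<kappa>" using x(2) J1 \<kappa>(1) by (simp add: distrib_right)
    finally have close: "norm (y - \<iota> ?x2) < d" using \<kappa>q by linarith
    have "phn \<sigma> N ?x2 \<le> d" if \<sigma>: "\<sigma> \<in> B" for \<sigma> N
    proof -
      have \<sigma>b: "\<sigma> \<in> branches D R" using \<sigma> B(2) by blast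
      have "?x2 = (\<lambda>i. x i + (- 1) * ?x1 i)" by (auto simp: restrict_to_def fun_eq_iff)
      then have "phn \<sigma> N ?x2 \<le> phn \<sigma> N x + phn \<sigma> N (\<lambda>i. (- 1) * ?x1 i)"
        using phn_add[OF x(1) c00_scale[OF x1], of \<sigma> N "- 1"] by simp
      also have "phn \<sigma> N (\<lambda>i. (- 1) * ?x1 i) = phn \<sigma> N ?x1" by (simp add: phn_scale[of _ _ "- 1", simplified])
      also have "phn \<sigma> N x + phn \<sigma> N ?x1 \<le> \<kappa> + (real q + 1) * \<kappa>"
        using Tp[OF x(1) \<sigma>, of N] Tx phn_le_JN[OF \<sigma>b x1, of N] J1 by linarith
      also have "\<dots> \<le> d" using \<kappa>q by (simp add: distrib_right)
      finally show ?thesis .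
    qed
    moreover have "\<forall>i. ?x2 i \<noteq> 0 \<longrightarrow> q < i" by (simp add: restrict_to_def)
    ultimately show False using large[OF y(1) x2 y(2) _ close] by blast
  qed
  have "\<delta> * norm y \<le> norm (T y)" if y: "y \<in> Y" for y
  proof (cases "y = 0")
    case False
    have "\<delta> \<le> norm (T ((1 / norm y) *\<^sub>R y))"
      using False by (intro unit subspace_scale[OF subspace_Y y]) simp
    then show ?thesis using False by (simp add: T.scaleR field_simps)
  qed simp
  then show ?thesis using that[OF T \<delta>] by blast
qed

end

theorem theorem2p7p7:
  fixes m n \<gamma> :: "nat \<Rightarrow> nat" and D :: "nat set" and R :: "nat rel"
    and \<iota> :: "(nat \<Rightarrow> real) \<Rightarrow> 'a::banach" and Y :: "'a set"
  assumes "jt_tree m n \<gamma> D R"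
    and "is_completion (JT_norm m n \<gamma> D R) \<iota>"
    and "subspace Y" and "closed Y" and "infinite_dimensional Y"
    and "\<And>x :: nat \<Rightarrow> 'a. (\<And>i. x i \<in> Y) \<Longrightarrow> (\<And>i. norm (x i) = 1) \<Longrightarrow> weakly_null x \<Longrightarrow>
      \<exists>r. strict_mono r \<and> equivalent_sequences (x \<circ> r) l2_unit"
  shows "complemented Y \<and> isomorphic_to_l2 Y"
proof -
  interpret jt_tree m n \<gamma> D R by (rule assms(1))
  interpret jt_subspace m n \<gamma> D R \<iota> Y
    by unfold_locales (fact assms)+
  obtain T :: "'a \<Rightarrow> l2" and \<delta> where T: "bounded_linear T" "0 < \<delta>"
    and below: "\<And>y. y \<in> Y \<Longrightarrow> \<delta> * norm y \<le> norm (T y)"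
    by (rule bounded_below_operator) blast
  interpret l2_bounded_below T Y \<delta>
    by (rule l2_bounded_below.intro[OF T(1) assms(3,4) T(2) below])
  show ?thesis by (rule complemented_isomorphic[OF assms(5)])
qed

end
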